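(* Let $G$ be simply connected of type $\mathbf{D}_n$, $n\ge6$. (1) Whether $n$ is even or odd, the Tits section is optimal. Moreover, for any section $\mathcal S$, the element $\mathcal S(s_i)$ has order $4$ for all $i$. Thus there is only one order profile of sections, represented by the Tits section. (2) If $n$ is even, two sections are $T$-conjugate if and only if they have the same $a$ and $b$. If $n$ is odd, two sections are $T$-conjugate if and only if they have the same $c$.
   Context: $F$ is an algebraically closed field, $G$ an almost-simple connected reductive group over $F$, $T$ a maximal torus, $N=N_G(T)$, $W=N/T$, $\pi:N\to W$ the projection. Let $\alpha_1,\dots,\alpha_n$ be the simple roots in Bourbaki numbering ($\alpha_i=e_i-e_{i+1}$ for $i<n$, $\alpha_n=e_{n-1}+e_n$), $s_i$ the corresponding reflections, $\alpha_i^\vee$ the simple coroots. Fix a realization of the root system: isomorphisms $u_\alpha:\mathbf G_a\to U_\alpha$ onto the root subgroups with $tu_\alpha(x)t^{-1}=u_\alpha(\alpha(t)x)$, such that $\sigma_\alpha=u_\alpha(1)u_{-\alpha}(-1)u_\alpha(1)\in N$ maps to $s_\alpha$ and $u_\alpha(x)u_{-\alpha}(-x^{-1})u_\alpha(x)=\alpha^\vee(x)\sigma_\alpha$ for $x\in F^\times$; put $\sigma_i=\sigma_{\alpha_i}$. A section is a map $\mathcal S:W\to N$ with $\pi\circ\mathcal S=\mathrm{id}$ satisfying the braid relations (equivalently $\mathcal S$ is multiplicative along reduced expressions). It is determined by $\mathcal S(s_i)=t_i\sigma_i$, $t_i\in T$. The Tits section $\mathcal N_\circ$ is the one with all $t_i=1$.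 The order profile of $\mathcal S$ is the Dynkin diagram with the node of each $\alpha_i$ labeled by the order of $\mathcal S(s_i)$. For two sections write $\mathcal S'<\mathcal S$ if the order of $\mathcal S'(s_i)$ is greater than the order of $\mathcal S(s_i)$ for all $i$; this translates to a partial order on order profiles, and a section is called optimal if it has the unique maximal order profile with respect to this partial order. Two sections $\mathcal S,\mathcal S'$ are $T$-conjugate if there is $t\in T$ with $t\mathcal S(w)t^{-1}=\mathcal S'(w)$ for all $w\in W$. Coordinates: $(x_1,\dots,x_n)$ denotes $\alpha_1^\vee(x_1)\cdots\alpha_n^\vee(x_n)\in T$. The sections are exactly those given by $t_i$ of the following form, with $a_{i,i}\in F^\times$ arbitrary. If $n$ is even, there are $a,b\in F^\times$ with $a^2=b^2=1$ such that, for every $i$, the $i$-th coordinate of $t_i$ is $a_{i,i}$ and for $k\neq i$ the $k$-th coordinate of $t_i$ is: $ab$ if $k\le n-2$ is odd; $1$ if $k\le n-2$ is even; $a$ if $k=n-1$; $b$ if $k=n$. If $n$ is odd, there is $c\in F^\times$ with $c^4=1$ such that, for every $i$, the $i$-th coordinate of $t_i$ is $a_{i,i}$ and for $k\ne i$ the $k$-th coordinate of $t_i$ is: $c^2$ if $k\le n-2$ is odd; $1$ if $k\le n-2$ is even; $c^{-1}$ if $k=n-1$; $c$ if $k=n$.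
   Formalization: The claim that S(s_i) has order 4 for all i is stated only when F has characteristic other than 2, because in characteristic 2 every S(s_i) has order 2; all other claims are stated in every characteristic. *)

theory Defs
  imports
    "HOL-Analysis.Analysis"
    "HOL-Algebra.Generated_Groups"
    "HOL-Algebra.Multiplicative_Group"
    "HOL-Library.Extended_Nat"
    "HOL-Computational_Algebra.Polynomial"
begin

section \<open>Linear algebraic groups over an algebraically closed field\<close>

text \<open>
  An affine algebraic group over the algebraically closed field \<open>'a\<close> is given by its group of
  rational points, embedded as a Zariski closed subgroup of some general linear group. The type
  \<open>'m\<close> only indexes the coordinates of that embedding.
\<close>

definition mat_group :: "('a::field^'m::finite^'m) set \<Rightarrow> ('a^'m^'m) monoid" where
  "mat_group H = \<lparr>carrier = H, monoid.mult = (**), one = mat 1\<rparr>"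

definition GL :: "('a::field^'m::finite^'m) set" where
  "GL = {g. invertible g}"

inductive_set regular_fun :: "('a::field^'m::finite^'m \<Rightarrow> 'a) set" where
  const: "(\<lambda>_. c) \<in> regular_fun"
| entry: "(\<lambda>g. g $ i $ j) \<in> regular_fun"
| inv_det: "(\<lambda>g. inverse (det g)) \<in> regular_fun"
| add: "f \<in> regular_fun \<Longrightarrow> h \<in> regular_fun \<Longrightarrow> (\<lambda>g. f g + h g) \<in> regular_fun"
| mult: "f \<in> regular_fun \<Longrightarrow> h \<in> regular_fun \<Longrightarrow> (\<lambda>g. f g * h g) \<in> regular_fun"

definition zariski_closed :: "('a::field^'m::finite^'m) set \<Rightarrow> bool" where
  "zariski_closed X \<longleftrightarrow> (\<exists>P. P \<subseteq> regular_fun \<and> X = {g \<in> GL. \<forall>f\<in>P. f g = 0})"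

definition zariski_connected :: "('a::field^'m::finite^'m) set \<Rightarrow> bool" where
  "zariski_connected X \<longleftrightarrow>
     (\<nexists>A B. zariski_closed A \<and> zariski_closed B \<and> X \<subseteq> A \<union> B \<and>
            A \<inter> B \<inter> X = {} \<and> A \<inter> X \<noteq> {} \<and> B \<inter> X \<noteq> {})"

definition algebraic_group :: "('a::field^'m::finite^'m) set \<Rightarrow> bool" where
  "algebraic_group G \<longleftrightarrow> subgroup G (mat_group GL) \<and> zariski_closed G"

definition unipotent :: "'a::field^'m::finite^'m \<Rightarrow> bool" where
  "unipotent g \<longleftrightarrow> (\<exists>k. (((**) (g - mat 1)) ^^ k) (mat 1) = 0)"

text \<open>Reductive means that the unipotent radical, i.e. the largest closed connected normal
  unipotent subgroup, is trivial.\<close>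

definition reductive :: "('a::field^'m::finite^'m) set \<Rightarrow> bool" where
  "reductive G \<longleftrightarrow> algebraic_group G \<and>
     (\<forall>U. U \<lhd> mat_group G \<and> zariski_closed U \<and> zariski_connected U \<and> (\<forall>g\<in>U. unipotent g)
          \<longrightarrow> U = {mat 1})"

definition almost_simple :: "('a::field^'m::finite^'m) set \<Rightarrow> bool" where
  "almost_simple G \<longleftrightarrow> algebraic_group G \<and> \<not> comm_group (mat_group G) \<and>
     (\<forall>H. H \<lhd> mat_group G \<and> zariski_closed H \<and> zariski_connected H \<longrightarrow> H = {mat 1} \<or> H = G)"


section \<open>Tori, characters and root subgroups\<close>

text \<open>Characters are made extensional so that equality of characters is equality on \<open>T\<close>.\<close>

definition characters :: "('a::field^'m::finite^'m) set \<Rightarrow> ('a^'m^'m \<Rightarrow> 'a) set" where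
  "characters T = {\<psi> \<in> extensional T.
     (\<forall>t\<in>T. \<psi> t \<noteq> 0) \<and> (\<forall>s\<in>T. \<forall>t\<in>T. \<psi> (s ** t) = \<psi> s * \<psi> t) \<and>
     (\<exists>f\<in>regular_fun. \<forall>t\<in>T. \<psi> t = f t)}"

text \<open>The value of a cocharacter at \<open>0\<close> is irrelevant. The entries are Laurent polynomials.\<close>

definition cocharacters :: "('a::field^'m::finite^'m) set \<Rightarrow> ('a \<Rightarrow> 'a^'m^'m) set" where
  "cocharacters T = {\<phi>.
     (\<forall>x. x \<noteq> 0 \<longrightarrow> \<phi> x \<in> T) \<and>
     (\<forall>x y. x \<noteq> 0 \<longrightarrow> y \<noteq> 0 \<longrightarrow> \<phi> (x * y) = \<phi> x ** \<phi> y) \<and>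
     (\<forall>i j. \<exists>(p::'a poly) (k::nat). \<forall>x. x \<noteq> 0 \<longrightarrow> \<phi> x $ i $ j = poly p x / x ^ k)}"

definition mat_prod :: "('b \<Rightarrow> 'a::field^'m::finite^'m) \<Rightarrow> 'b list \<Rightarrow> 'a^'m^'m" where
  "mat_prod f ks = foldr (\<lambda>k g. f k ** g) ks (mat 1)"

text \<open>A torus is an algebraic group isomorphic to a power \<open>r\<close> of the multiplicative group:
  the \<open>\<psi> j\<close> are the components of such an isomorphism and the \<open>\<phi> j\<close> those of its inverse.\<close>

definition torus :: "('a::field^'m::finite^'m) set \<Rightarrow> bool" where
  "torus T \<longleftrightarrow> algebraic_group T \<and>
     (\<exists>r \<psi> \<phi>. (\<forall>j<r. \<psi> j \<in> characters T \<and> \<phi> j \<in> cocharacters T) \<and>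
        (\<forall>i<r. \<forall>j<r. \<forall>x. x \<noteq> 0 \<longrightarrow> \<psi> i (\<phi> j x) = (if i = j then x else 1)) \<and>
        (\<forall>t\<in>T. t = mat_prod (\<lambda>j. \<phi> j (\<psi> j t)) [0..<r]))"

definition maximal_torus :: "('a::field^'m::finite^'m) set \<Rightarrow> ('a^'m^'m) set \<Rightarrow> bool" where
  "maximal_torus G T \<longleftrightarrow> torus T \<and> T \<subseteq> G \<and> (\<forall>T'. torus T' \<and> T' \<subseteq> G \<and> T \<subseteq> T' \<longrightarrow> T' = T)"

text \<open>
  \<open>root_hom G T \<alpha> v\<close>: \<open>v\<close> is an isomorphism of the additive group onto a closed subgroup of \<open>G\<close>
  on which \<open>T\<close> acts through \<open>\<alpha>\<close>. The regular inverse \<open>f\<close> makes \<open>v\<close> an isomorphism onto its image,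
  which is then closed, being cut out of \<open>G\<close> by \<open>v (f g) = g\<close>.
\<close>

definition root_hom ::
  "('a::field^'m::finite^'m) set \<Rightarrow> ('a^'m^'m) set \<Rightarrow> ('a^'m^'m \<Rightarrow> 'a) \<Rightarrow> ('a \<Rightarrow> 'a^'m^'m) \<Rightarrow> bool"
  where
  "root_hom G T \<alpha> v \<longleftrightarrow>
     (\<forall>x. v x \<in> G) \<and> (\<forall>x y. v (x + y) = v x ** v y) \<and>
     (\<forall>i j. \<exists>p::'a poly. \<forall>x. v x $ i $ j = poly p x) \<and>
     (\<exists>f\<in>regular_fun. \<forall>x. f (v x) = x) \<and>
     (\<forall>t\<in>T. \<forall>x. t ** v x ** matrix_inv t = v (\<alpha> t * x))"

definition roots :: "('a::field^'m::finite^'m) set \<Rightarrow> ('a^'m^'m) set \<Rightarrow> ('a^'m^'m \<Rightarrow> 'a) set" where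
  "roots G T = {\<alpha> \<in> characters T. (\<exists>t\<in>T. \<alpha> t \<noteq> 1) \<and> (\<exists>v. root_hom G T \<alpha> v)}"

text \<open>In a reductive group all \<open>root_hom\<close>s of a given root have the same image, the root subgroup;
  the union makes this description independent of a choice.\<close>

definition root_subgroup ::
  "('a::field^'m::finite^'m) set \<Rightarrow> ('a^'m^'m) set \<Rightarrow> ('a^'m^'m \<Rightarrow> 'a) \<Rightarrow> ('a^'m^'m) set" where
  "root_subgroup G T \<alpha> = (\<Union>v \<in> {v. root_hom G T \<alpha> v}. range v)"


section \<open>Root data of type D and realizations\<close>

text \<open>The root system of type \<open>D\<^sub>n\<close>, with \<open>e\<^sub>1, \<dots>, e\<^sub>n\<close> the standard basis of the functions
  on \<open>{1..n}\<close>, extended by \<open>0\<close>.\<close>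

definition unit_vec :: "nat \<Rightarrow> nat \<Rightarrow> int" where
  "unit_vec i = (\<lambda>k. if k = i then 1 else 0)"

definition D_roots :: "nat \<Rightarrow> (nat \<Rightarrow> int) set" where
  "D_roots n = {(\<lambda>k. \<epsilon> * unit_vec i k + \<delta> * unit_vec j k) | i j \<epsilon> \<delta>.
                  1 \<le> i \<and> i < j \<and> j \<le> n \<and> \<epsilon> \<in> {1, -1} \<and> \<delta> \<in> {1, -1}}"

definition simple_root :: "nat \<Rightarrow> nat \<Rightarrow> nat \<Rightarrow> int" where
  "simple_root n i = (if i < n then (\<lambda>k. unit_vec i k - unit_vec (i + 1) k)
                      else (\<lambda>k. unit_vec (n - 1) k + unit_vec n k))"

definition neg_vec :: "(nat \<Rightarrow> int) \<Rightarrow> nat \<Rightarrow> int" where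
  "neg_vec v = (\<lambda>k. - v k)"

definition add_vec :: "(nat \<Rightarrow> int) \<Rightarrow> (nat \<Rightarrow> int) \<Rightarrow> nat \<Rightarrow> int" where
  "add_vec v w = (\<lambda>k. v k + w k)"

definition dot :: "nat \<Rightarrow> (nat \<Rightarrow> int) \<Rightarrow> (nat \<Rightarrow> int) \<Rightarrow> int" where
  "dot n v w = (\<Sum>k=1..n. v k * w k)"

text \<open>A group with a maximal torus and, for each vector \<open>v\<close> of the root system, the corresponding
  root \<open>\<alpha>\<close> (as a character), coroot \<open>\<alpha>\<^sup>\<or>\<close> and root homomorphism \<open>u\<^sub>\<alpha>\<close>.\<close>

record ('a, 'm::finite) group_realization =
  Grp :: "('a^'m^'m) set"
  Tor :: "('a^'m^'m) set"
  rt :: "(nat \<Rightarrow> int) \<Rightarrow> 'a^'m^'m \<Rightarrow> 'a"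
  crt :: "(nat \<Rightarrow> int) \<Rightarrow> 'a \<Rightarrow> 'a^'m^'m"
  uhom :: "(nat \<Rightarrow> int) \<Rightarrow> 'a \<Rightarrow> 'a^'m^'m"

definition tnormalizer :: "('a::field, 'm::finite) group_realization \<Rightarrow> ('a^'m^'m) set" where
  "tnormalizer R = {g \<in> Grp R. (\<lambda>t. g ** t ** matrix_inv g) ` Tor R = Tor R}"

definition weyl :: "('a::field, 'm::finite) group_realization \<Rightarrow> ('a^'m^'m) set monoid" where
  "weyl R = mat_group (tnormalizer R) Mod Tor R"

definition proj ::
  "('a::field, 'm::finite) group_realization \<Rightarrow> 'a^'m^'m \<Rightarrow> ('a^'m^'m) set" where
  "proj R g = Tor R #>\<^bsub>mat_group (tnormalizer R)\<^esub> g"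

definition sigma ::
  "('a::field, 'm::finite) group_realization \<Rightarrow> (nat \<Rightarrow> int) \<Rightarrow> 'a^'m^'m" where
  "sigma R v = uhom R v 1 ** uhom R (neg_vec v) (- 1) ** uhom R v 1"

text \<open>\<open>rt R\<close> is an isomorphism of the root system \<open>D\<^sub>n\<close> onto the roots of \<open>(G, T)\<close>, and \<open>crt R\<close> gives
  the coroots. All vectors of \<open>D\<^sub>n\<close> have square length 2, so the Cartan integer
  \<open>\<langle>v, w\<^sup>\<or>\<rangle>\<close> is the scalar product of \<open>v\<close> and \<open>w\<close>.\<close>

definition type_D :: "nat \<Rightarrow> ('a::field, 'm::finite) group_realization \<Rightarrow> bool" where
  "type_D n R \<longleftrightarrow>
     bij_betw (rt R) (D_roots n) (roots (Grp R) (Tor R)) \<and>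
     (\<forall>v\<in>D_roots n. \<forall>t\<in>Tor R. rt R (neg_vec v) t = inverse (rt R v t)) \<and>
     (\<forall>v\<in>D_roots n. \<forall>w\<in>D_roots n. add_vec v w \<in> D_roots n \<longrightarrow>
        (\<forall>t\<in>Tor R. rt R (add_vec v w) t = rt R v t * rt R w t)) \<and>
     (\<forall>v\<in>D_roots n. crt R v \<in> cocharacters (Tor R)) \<and>
     (\<forall>v\<in>D_roots n. \<forall>w\<in>D_roots n. \<forall>x. x \<noteq> 0 \<longrightarrow> rt R v (crt R w x) = x powi dot n v w)"

text \<open>The torus element with coordinates \<open>(x\<^sub>1, \<dots>, x\<^sub>n)\<close>.\<close>

definition tor_elt ::
  "nat \<Rightarrow> ('a::field, 'm::finite) group_realization \<Rightarrow> (nat \<Rightarrow> 'a) \<Rightarrow> 'a^'m^'m" where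
  "tor_elt n R x = mat_prod (\<lambda>k. crt R (simple_root n k) (x k)) [1..<Suc n]"

text \<open>Simply connected: the cocharacter group is the coroot lattice.\<close>

definition simply_connected_D :: "nat \<Rightarrow> ('a::field, 'm::finite) group_realization \<Rightarrow> bool" where
  "simply_connected_D n R \<longleftrightarrow>
     (\<forall>\<phi> \<in> cocharacters (Tor R). \<exists>c :: nat \<Rightarrow> int.
        \<forall>x. x \<noteq> 0 \<longrightarrow> \<phi> x = tor_elt n R (\<lambda>k. x powi c k))"

text \<open>The second conjunct says that \<open>\<sigma>\<^sub>\<alpha>\<close> maps to the reflection \<open>s\<^sub>\<alpha>\<close>, which acts on the torus
  by \<open>t \<mapsto> t \<alpha>\<^sup>\<or>(\<alpha>(t)\<^sup>-\<^sup>1)\<close>.\<close>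

definition realization :: "nat \<Rightarrow> ('a::field, 'm::finite) group_realization \<Rightarrow> bool" where
  "realization n R \<longleftrightarrow> (\<forall>v\<in>D_roots n.
     root_hom (Grp R) (Tor R) (rt R v) (uhom R v) \<and>
     range (uhom R v) = root_subgroup (Grp R) (Tor R) (rt R v) \<and>
     sigma R v \<in> tnormalizer R \<and>
     (\<forall>t\<in>Tor R. sigma R v ** t ** matrix_inv (sigma R v) = t ** crt R v (inverse (rt R v t))) \<and>
     (\<forall>x. x \<noteq> 0 \<longrightarrow>
        uhom R v x ** uhom R (neg_vec v) (- inverse x) ** uhom R v x = crt R v x ** sigma R v))"

abbreviation sigma_simple ::
  "nat \<Rightarrow> ('a::field, 'm::finite) group_realization \<Rightarrow> nat \<Rightarrow> 'a^'m^'m" where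
  "sigma_simple n R i \<equiv> sigma R (simple_root n i)"

definition simple_refl ::
  "nat \<Rightarrow> ('a::field, 'm::finite) group_realization \<Rightarrow> nat \<Rightarrow> ('a^'m^'m) set" where
  "simple_refl n R i = proj R (sigma_simple n R i)"

text \<open>The identification of \<open>N/T\<close> with the Weyl group of the root system: \<open>N/T\<close> is generated by the
  simple reflections. This holds for every connected reductive group, but its proof needs the
  structure theory of Borel subgroups.\<close>

definition weyl_generated :: "nat \<Rightarrow> ('a::field, 'm::finite) group_realization \<Rightarrow> bool" where
  "weyl_generated n R \<longleftrightarrow> carrier (weyl R) = generate (weyl R) (simple_refl n R ` {1..n})"


section \<open>Sections of the Weyl group\<close>

definition word_val ::
  "nat \<Rightarrow> ('a::field, 'm::finite) group_realization \<Rightarrow> nat list \<Rightarrow> ('a^'m^'m) set" where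
  "word_val n R is = foldr (\<lambda>i w. simple_refl n R i \<otimes>\<^bsub>weyl R\<^esub> w) is \<one>\<^bsub>weyl R\<^esub>"

definition reduced_word ::
  "nat \<Rightarrow> ('a::field, 'm::finite) group_realization \<Rightarrow> nat list \<Rightarrow> bool" where
  "reduced_word n R is \<longleftrightarrow> set is \<subseteq> {1..n} \<and>
     (\<forall>js. set js \<subseteq> {1..n} \<and> word_val n R js = word_val n R is \<longrightarrow> length is \<le> length js)"

text \<open>Only the values of \<open>S\<close> on \<open>W\<close> matter. The braid relations are expressed as
  multiplicativity along reduced expressions.\<close>

definition weyl_section ::
  "nat \<Rightarrow> ('a::field, 'm::finite) group_realization \<Rightarrow> (('a^'m^'m) set \<Rightarrow> 'a^'m^'m) \<Rightarrow> bool" where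
  "weyl_section n R S \<longleftrightarrow>
     (\<forall>w\<in>carrier (weyl R). S w \<in> tnormalizer R \<and> proj R (S w) = w) \<and>
     (\<forall>is. reduced_word n R is \<longrightarrow>
        S (word_val n R is) = mat_prod (\<lambda>i. S (simple_refl n R i)) is)"

definition tits_section ::
  "nat \<Rightarrow> ('a::field, 'm::finite) group_realization \<Rightarrow> (('a^'m^'m) set \<Rightarrow> 'a^'m^'m) \<Rightarrow> bool" where
  "tits_section n R S \<longleftrightarrow> weyl_section n R S \<and>
     (\<forall>i\<in>{1..n}. S (simple_refl n R i) = sigma_simple n R i)"

text \<open>\<open>group.ord\<close> is \<open>0\<close> for elements of infinite order.\<close>

definition elt_order :: "('a::field^'m::finite^'m) set \<Rightarrow> 'a^'m^'m \<Rightarrow> enat" where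
  "elt_order G g = (if group.ord (mat_group G) g = 0 then \<infinity> else enat (group.ord (mat_group G) g))"

definition order_profile ::
  "nat \<Rightarrow> ('a::field, 'm::finite) group_realization \<Rightarrow> (('a^'m^'m) set \<Rightarrow> 'a^'m^'m) \<Rightarrow> nat \<Rightarrow> enat"
  where
  "order_profile n R S = (\<lambda>i\<in>{1..n}. elt_order (Grp R) (S (simple_refl n R i)))"

definition order_profiles ::
  "nat \<Rightarrow> ('a::field, 'm::finite) group_realization \<Rightarrow> (nat \<Rightarrow> enat) set" where
  "order_profiles n R = {order_profile n R S | S. weyl_section n R S}"

text \<open>The order is reversed: larger orders of elements give a smaller profile.\<close>

definition profile_less :: "nat \<Rightarrow> (nat \<Rightarrow> enat) \<Rightarrow> (nat \<Rightarrow> enat) \<Rightarrow> bool" where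
  "profile_less n p q \<longleftrightarrow> (\<forall>i\<in>{1..n}. p i > q i)"

definition maximal_profile ::
  "nat \<Rightarrow> ('a::field, 'm::finite) group_realization \<Rightarrow> (nat \<Rightarrow> enat) \<Rightarrow> bool" where
  "maximal_profile n R p \<longleftrightarrow> p \<in> order_profiles n R \<and>
     (\<forall>q\<in>order_profiles n R. \<not> profile_less n p q)"

definition optimal_section ::
  "nat \<Rightarrow> ('a::field, 'm::finite) group_realization \<Rightarrow> (('a^'m^'m) set \<Rightarrow> 'a^'m^'m) \<Rightarrow> bool" where
  "optimal_section n R S \<longleftrightarrow> weyl_section n R S \<and>
     maximal_profile n R (order_profile n R S) \<and>
     (\<forall>p. maximal_profile n R p \<longrightarrow> p = order_profile n R S)"

definition T_conjugate ::
  "('a::field, 'm::finite) group_realization \<Rightarrow> (('a^'m^'m) set \<Rightarrow> 'a^'m^'m) \<Rightarrow>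
   (('a^'m^'m) set \<Rightarrow> 'a^'m^'m) \<Rightarrow> bool" where
  "T_conjugate R S S' \<longleftrightarrow>
     (\<exists>t\<in>Tor R. \<forall>w\<in>carrier (weyl R). t ** S w ** matrix_inv t = S' w)"

text \<open>\<open>S(s\<^sub>i) = t\<^sub>i \<sigma>\<^sub>i\<close>, where the \<open>i\<close>-th coordinate of \<open>t\<^sub>i\<close> is an arbitrary unit \<open>d\<close> (depending on
  \<open>i\<close>) and the \<open>k\<close>-th coordinate is \<open>x k\<close> for \<open>k \<noteq> i\<close>.\<close>

definition has_off_diagonal ::
  "nat \<Rightarrow> ('a::field, 'm::finite) group_realization \<Rightarrow> (('a^'m^'m) set \<Rightarrow> 'a^'m^'m) \<Rightarrow>
   (nat \<Rightarrow> 'a) \<Rightarrow> bool" where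
  "has_off_diagonal n R S x \<longleftrightarrow> (\<forall>i\<in>{1..n}. \<exists>d. d \<noteq> 0 \<and>
     S (simple_refl n R i) = tor_elt n R (\<lambda>k. if k = i then d else x k) ** sigma_simple n R i)"

definition has_params_even ::
  "nat \<Rightarrow> ('a::field, 'm::finite) group_realization \<Rightarrow> (('a^'m^'m) set \<Rightarrow> 'a^'m^'m) \<Rightarrow>
   'a \<Rightarrow> 'a \<Rightarrow> bool" where
  "has_params_even n R S a b \<longleftrightarrow> a ^ 2 = 1 \<and> b ^ 2 = 1 \<and>
     has_off_diagonal n R S
       (\<lambda>k. if k = n then b else if k = n - 1 then a else if odd k then a * b else 1)"

definition has_param_odd ::
  "nat \<Rightarrow> ('a::field, 'm::finite) group_realization \<Rightarrow> (('a^'m^'m) set \<Rightarrow> 'a^'m^'m) \<Rightarrow>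
   'a \<Rightarrow> bool" where
  "has_param_odd n R S c \<longleftrightarrow> c ^ 4 = 1 \<and>
     has_off_diagonal n R S
       (\<lambda>k. if k = n then c else if k = n - 1 then inverse c else if odd k then c ^ 2 else 1)"

end

theory Submission
  imports Defs
begin

text \<open>
  The theorem reduces to one structural fact: writing a section as \<open>S(s\<^sub>i) = t\<^sub>i \<sigma>\<^sub>i\<close> with
  \<open>t\<^sub>i \<in> T\<close>, there are a single \<open>z \<in> T\<close> on which all roots are trivial and scalars \<open>d\<^sub>i\<close> with
  \<open>t\<^sub>i = z \<alpha>\<^sub>i\<^sup>\<or>(d\<^sub>i)\<close> (\<open>braid_lift_central\<close>). Since \<open>z\<close> commutes with \<open>\<sigma>\<^sub>i\<close>, since
  \<open>\<sigma>\<^sub>i\<close> inverts \<open>\<alpha>\<^sub>i\<^sup>\<or>(d\<^sub>i)\<close>, and since \<open>\<sigma>\<^sub>i\<^sup>2 = \<alpha>\<^sub>i\<^sup>\<or>(-1)\<close>, the square of \<open>S(s\<^sub>i)\<close> is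
  \<open>z\<^sup>2 \<alpha>\<^sub>i\<^sup>\<or>(-1)\<close>. In coordinates (\<open>central_coordinates\<close>) \<open>z\<^sup>2\<close> is trivial or the product of
  \<open>\<alpha>\<^sub>n\<^sub>-\<^sub>1\<^sup>\<or>(-1)\<close> and \<open>\<alpha>\<^sub>n\<^sup>\<or>(-1)\<close>. So in characteristic other than 2 the square is a
  nontrivial involution and the order is 4; in characteristic 2 it is trivial and the order is 2.
  Either way the order profile is the same for all sections. Conjugation by \<open>t \<in> T\<close> multiplies
  \<open>t\<^sub>i\<close> by \<open>\<alpha>\<^sub>i\<^sup>\<or>(\<alpha>\<^sub>i(t))\<close>; it keeps \<open>z\<close> and, the simple roots being independent characters over
  an algebraically closed field, changes the \<open>d\<^sub>i\<close> arbitrarily (\<open>simple_root_values\<close>). Hence \<open>z\<close>, or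
  the parameters \<open>a\<close> and \<open>b\<close> or \<open>c\<close> that describe it, classifies sections up to conjugacy.

  The structural fact is a computation in the torus once the \<open>\<sigma>\<^sub>i\<close> satisfy the braid relations. The
  torus is made explicit by \<open>torus_coordinates\<close>: for a simply connected group the simple coroots are a
  basis of the cocharacters, so \<open>(x\<^sub>1, \<dots>, x\<^sub>n)\<close> are coordinates. The braid relations
  (\<open>sigma_braid\<close>) come without commutator formulas from the observation that an element \<open>w\<close> of the
  normalizer taking a root \<open>\<beta>\<close> to \<open>\<gamma>\<close> conjugates \<open>\<sigma>\<^sub>\<beta>\<close> to \<open>\<gamma>\<^sup>\<or>(c) \<sigma>\<^sub>\<gamma>\<close> for some
  scalar \<open>c\<close>. With \<open>w = \<sigma>\<^sub>i\<close> or \<open>w = \<sigma>\<^sub>i \<sigma>\<^sub>j\<close> this gives each relation up to an element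
  \<open>\<alpha>\<^sub>j\<^sup>\<or>(c)\<close>, by symmetry also up to an element \<open>\<alpha>\<^sub>i\<^sup>\<or>(d)\<close>, and independence of the coroots
  forces \<open>c = d = 1\<close>.

  Sections are multiplicative along reduced words in \<open>N/T\<close>, so these have to be understood.
  Matsumoto's theorem, proved for words acting on the root vectors, together with
  \<open>\<sigma>\<^sub>i\<^sup>2 \<in> T\<close> shows that two words have the same value in \<open>N/T\<close> exactly if they act in the same way
  on the roots (\<open>word_val_eq_iff\<close>). It also gives the existence of the Tits section.
\<close>

section \<open>Reflections and words in type D\<close>

definition reflection :: "nat \<Rightarrow> (nat \<Rightarrow> int) \<Rightarrow> (nat \<Rightarrow> int) \<Rightarrow> nat \<Rightarrow> int" where
  "reflection n \<alpha> v = (\<lambda>k. v k - dot n v \<alpha> * \<alpha> k)"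

definition act :: "nat \<Rightarrow> nat list \<Rightarrow> (nat \<Rightarrow> int) \<Rightarrow> nat \<Rightarrow> int" where
  "act n is v = foldr (\<lambda>i. reflection n (simple_root n i)) is v"

text \<open>The pairing with \<open>(n - 1, \<dots>, 1, 0)\<close>, half the sum of the positive roots: simple roots have
  height 1, and the sign of the height tells positive from negative roots.\<close>

definition height :: "nat \<Rightarrow> (nat \<Rightarrow> int) \<Rightarrow> int" where
  "height n v = dot n v (\<lambda>k. int n - int k)"

lemma dot_commute: "dot n v w = dot n w v"
  by (simp add: dot_def mult.commute)

lemma dot_diff_left: "dot n (\<lambda>k. v k - w k) u = dot n v u - dot n w u"
  by (simp add: dot_def left_diff_distrib sum_subtractf)

lemma dot_scale_left: "dot n (\<lambda>k. c * v k) u = c * dot n v u"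
  by (simp add: dot_def sum_distrib_left mult.assoc)

lemma dot_uminus_left: "dot n (\<lambda>k. - v k) u = - dot n v u"
  by (simp add: dot_def sum_negf)

lemma dot_add_left: "dot n (\<lambda>k. v k + w k) u = dot n v u + dot n w u"
  by (simp add: dot_def distrib_right sum.distrib)

lemma reflection_apply: "reflection n \<alpha> v k = v k - dot n v \<alpha> * \<alpha> k"
  by (simp add: reflection_def)

lemma dot_reflection_left: "dot n (reflection n \<alpha> v) w = dot n v w - dot n v \<alpha> * dot n \<alpha> w"
  by (simp add: reflection_def dot_diff_left dot_scale_left)

lemma dot_reflection_right: "dot n w (reflection n \<alpha> v) = dot n w v - dot n v \<alpha> * dot n \<alpha> w"
  by (simp add: dot_commute [of n w] dot_reflection_left)

lemma height_reflection: "height n (reflection n \<alpha> v) = height n v - dot n v \<alpha> * height n \<alpha>"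
  by (simp add: height_def dot_reflection_left)

lemma height_uminus: "height n (\<lambda>k. - v k) = - height n v"
  by (simp add: height_def dot_uminus_left)

lemma height_add: "height n (\<lambda>k. v k + w k) = height n v + height n w"
  by (simp add: height_def dot_add_left)

lemma reflection_self: "dot n \<alpha> \<alpha> = 2 \<Longrightarrow> reflection n \<alpha> \<alpha> = (\<lambda>k. - \<alpha> k)"
  by (simp add: reflection_def)

lemma reflection_reflection: "dot n \<alpha> \<alpha> = 2 \<Longrightarrow> reflection n \<alpha> (reflection n \<alpha> v) = v"
  by (rule ext) (simp add: reflection_def [of n \<alpha> "reflection n \<alpha> v"] dot_reflection_left, simp add: reflection_def algebra_simps)

lemma reflection_uminus: "reflection n \<alpha> (\<lambda>k. - v k) = (\<lambda>k. - reflection n \<alpha> v k)"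
  by (simp add: reflection_def dot_uminus_left fun_eq_iff)

lemma reflection_add: "reflection n \<alpha> (\<lambda>k. v k + w k) = (\<lambda>k. reflection n \<alpha> v k + reflection n \<alpha> w k)"
  by (simp add: reflection_def dot_add_left fun_eq_iff algebra_simps)

lemma act_Nil [simp]: "act n [] v = v"
  by (simp add: act_def)

lemma act_Cons [simp]: "act n (i # is) v = reflection n (simple_root n i) (act n is v)"
  by (simp add: act_def)

lemma act_append: "act n (is @ js) v = act n is (act n js v)"
  by (simp add: act_def)

lemma act_uminus: "act n is (\<lambda>k. - v k) = (\<lambda>k. - act n is v k)"
  by (induction "is") (simp_all add: reflection_uminus)

lemma act_add: "act n is (\<lambda>k. v k + w k) = (\<lambda>k. act n is v k + act n is w k)"
  by (induction "is") (simp_all add: reflection_add)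

lemma dot_eq_sum_support:
  "S \<subseteq> {1..n} \<Longrightarrow> (\<And>k. k \<in> {1..n} \<Longrightarrow> k \<notin> S \<Longrightarrow> v k * w k = 0) \<Longrightarrow> dot n v w = (\<Sum>k\<in>S. v k * w k)"
  unfolding dot_def by (rule sum.mono_neutral_right) auto

lemma dot_unit_vec_right:
  assumes "i \<in> {1..n}" shows "dot n v (unit_vec i) = v i"
proof -
  have "dot n v (unit_vec i) = (\<Sum>k\<in>{i}. v k * unit_vec i k)"
    by (rule dot_eq_sum_support) (use assms in \<open>auto simp: unit_vec_def\<close>)
  then show ?thesis by (simp add: unit_vec_def)
qed

lemma dot_simple_root_right:
  assumes "2 \<le> n" "i \<in> {1..n}"
  shows "dot n v (simple_root n i) = (if i < n then v i - v (i + 1) else v (n - 1) + v n)"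
proof -
  have "dot n (\<lambda>k. unit_vec i k - unit_vec (i + 1) k) v = v i - v (i + 1)" if "i < n"
    using that assms by (simp only: dot_diff_left dot_commute [of _ _ v] dot_unit_vec_right atLeastAtMost_iff) (simp add: dot_unit_vec_right)
  moreover have "dot n (\<lambda>k. unit_vec (n - 1) k + unit_vec n k) v = v (n - 1) + v n"
    using assms by (subst dot_add_left) (simp add: dot_commute [of _ _ v] dot_unit_vec_right)
  ultimately show ?thesis
    by (auto simp: simple_root_def dot_commute [of n v])
qed

lemma simple_root_in_D_roots:
  assumes "2 \<le> n" "i \<in> {1..n}" shows "simple_root n i \<in> D_roots n"
proof (cases "i < n")
  case True
  have "simple_root n i = (\<lambda>k. 1 * unit_vec i k + (-1) * unit_vec (i + 1) k)"
    using True by (simp add: simple_root_def)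
  moreover have "1 \<le> i" "i < i + 1" "i + 1 \<le> n" using True assms by auto
  ultimately show ?thesis unfolding D_roots_def by blast
next
  case False
  then have "simple_root n i = (\<lambda>k. 1 * unit_vec (n - 1) k + 1 * unit_vec n k)"
    by (simp add: simple_root_def)
  moreover have "1 \<le> n - 1" "n - 1 < n" "n \<le> n" using assms by auto
  ultimately show ?thesis unfolding D_roots_def by blast
qed

text \<open>Integer vectors of square length 2 have exactly two nonzero entries, both of them units. This
  description of the roots makes their stability under reflections evident.\<close>

lemma D_roots_iff: "v \<in> D_roots n \<longleftrightarrow> (\<forall>k. k \<notin> {1..n} \<longrightarrow> v k = 0) \<and> dot n v v = 2"
proof
  assume "v \<in> D_roots n"
  then obtain i j \<epsilon> \<delta> where v: "v = (\<lambda>k. \<epsilon> * unit_vec i k + \<delta> * unit_vec j k)"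
    and ij: "1 \<le> i" "i < j" "j \<le> n" and e: "\<epsilon> \<in> {1, -1}" "\<delta> \<in> {1, -1}"
    unfolding D_roots_def by blast
  have "dot n v v = (\<Sum>k\<in>{i,j}. v k * v k)"
    by (rule dot_eq_sum_support) (use ij in \<open>auto simp: v unit_vec_def\<close>)
  also have "\<dots> = 2" using ij e by (auto simp: v unit_vec_def)
  finally show "(\<forall>k. k \<notin> {1..n} \<longrightarrow> v k = 0) \<and> dot n v v = 2"
    using ij by (auto simp: v unit_vec_def)
next
  assume v: "(\<forall>k. k \<notin> {1..n} \<longrightarrow> v k = 0) \<and> dot n v v = 2"
  define Z where "Z = {k\<in>{1..n}. v k \<noteq> 0}"
  have fin: "finite Z" by (simp add: Z_def)
  have "dot n v v = (\<Sum>k\<in>Z. v k * v k)"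
    by (rule dot_eq_sum_support) (auto simp: Z_def)
  with v have sum: "(\<Sum>k\<in>Z. v k * v k) = 2" by simp
  have ge1: "1 \<le> v k * v k" if "k \<in> Z" for k
    using that by (simp add: Z_def) (metis int_one_le_iff_zero_less less_le mult_eq_0_iff zero_le_square)
  have "int (card Z) = (\<Sum>k\<in>Z. 1)" by simp
  also have "\<dots> \<le> (\<Sum>k\<in>Z. v k * v k)" by (rule sum_mono) (use ge1 in simp)
  finally have le2: "card Z \<le> 2" using sum by simp
  have "card Z \<noteq> 0" using sum fin by auto
  moreover have "card Z \<noteq> 1"
  proof
    assume "card Z = 1"
    then obtain a where "Z = {a}" by (auto simp: card_1_singleton_iff)
    with sum have a: "\<bar>v a\<bar> * \<bar>v a\<bar> = 2" by simp
    have "\<bar>v a\<bar> \<le> 1 \<or> \<bar>v a\<bar> \<ge> 2" by linarith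
    then show False
    proof
      assume "\<bar>v a\<bar> \<le> 1"
      then have "\<bar>v a\<bar> * \<bar>v a\<bar> \<le> 1 * 1" by (intro mult_mono) auto
      with a show False by simp
    next
      assume "\<bar>v a\<bar> \<ge> 2"
      then have "2 * 2 \<le> \<bar>v a\<bar> * \<bar>v a\<bar>" by (intro mult_mono) auto
      with a show False by simp
    qed
  qed
  ultimately have "card Z = 2" using le2 by linarith
  then obtain a b where Zab: "Z = {a, b}" "a < b"
    by (metis card_2_iff insert_commute nat_neq_iff)
  have one: "v a * v a = 1" "v b * v b = 1"
    using ge1 [of a] ge1 [of b] sum Zab by auto
  have pm: "v a \<in> {1, -1}" "v b \<in> {1, -1}"
    using one by (auto simp: zmult_eq_1_iff)
  have "v = (\<lambda>k. v a * unit_vec a k + v b * unit_vec b k)"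
  proof
    fix k show "v k = v a * unit_vec a k + v b * unit_vec b k"
      using Zab v by (cases "k \<in> Z") (auto simp: unit_vec_def Z_def)
  qed
  moreover have "1 \<le> a" "b \<le> n" using Zab by (auto simp: Z_def)
  ultimately show "v \<in> D_roots n" unfolding D_roots_def using Zab pm by blast
qed

lemma D_roots_norm: "v \<in> D_roots n \<Longrightarrow> dot n v v = 2"
  by (simp add: D_roots_iff)

lemma reflection_D_roots:
  assumes "\<alpha> \<in> D_roots n" "v \<in> D_roots n" shows "reflection n \<alpha> v \<in> D_roots n"
proof -
  have "dot n (reflection n \<alpha> v) (reflection n \<alpha> v) = 2"
    using assms by (simp add: D_roots_iff dot_reflection_left dot_reflection_right dot_commute [of n v \<alpha>] algebra_simps)
  then show ?thesis using assms by (auto simp: D_roots_iff reflection_def)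
qed

lemma neg_D_roots: "v \<in> D_roots n \<Longrightarrow> (\<lambda>k. - v k) \<in> D_roots n"
  by (auto simp: D_roots_iff dot_def)

text \<open>Equality case of the Cauchy-Schwarz inequality: the square length of \<open>v - w\<close> is at most 0.\<close>

lemma D_roots_dot_ge_2:
  assumes "v \<in> D_roots n" "w \<in> D_roots n" "dot n v w \<ge> 2" shows "v = w"
proof -
  have "(\<Sum>k=1..n. (v k - w k)^2) = dot n v v - 2 * dot n v w + dot n w w"
    by (simp add: dot_def power2_eq_square algebra_simps sum.distrib sum_subtractf sum_distrib_left)
  also have "\<dots> \<le> 0" using assms by (simp add: D_roots_norm)
  finally have "(\<Sum>k=1..n. (v k - w k)^2) = 0"
    by (simp add: order.antisym sum_nonneg)
  then have "\<forall>k\<in>{1..n}. v k = w k"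
    by (subst (asm) sum_nonneg_eq_0_iff) auto
  then show ?thesis using assms unfolding D_roots_iff by (metis ext)
qed

lemma height_nonzero:
  assumes "v \<in> D_roots n" shows "height n v \<noteq> 0"
proof -
  obtain i j \<epsilon> \<delta> where v: "v = (\<lambda>k. \<epsilon> * unit_vec i k + \<delta> * unit_vec j k)"
    and ij: "1 \<le> i" "i < j" "j \<le> n" and e: "\<epsilon> \<in> {1, -1}" "\<delta> \<in> {1, -1}"
    using assms unfolding D_roots_def by blast
  have "height n v = (\<Sum>k\<in>{i,j}. v k * (int n - int k))"
    unfolding height_def by (rule dot_eq_sum_support) (use ij in \<open>auto simp: v unit_vec_def\<close>)
  also have "\<dots> = \<epsilon> * (int n - int i) + \<delta> * (int n - int j)"
    using ij by (simp add: v unit_vec_def)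
  finally show ?thesis using ij e by auto
qed

lemma mat_prod_Nil [simp]: "mat_prod f [] = mat 1"
  by (simp add: mat_prod_def)

lemma mat_prod_Cons [simp]: "mat_prod f (i # is) = f i ** mat_prod f is"
  by (simp add: mat_prod_def)

lemma mat_prod_append: "mat_prod f (xs @ ys) = mat_prod f xs ** mat_prod f ys"
  by (induction xs) (simp_all add: matrix_mul_assoc)

lemma mat_prod_cong: "(\<And>k. k \<in> set ks \<Longrightarrow> f k = g k) \<Longrightarrow> mat_prod f ks = mat_prod g ks"
  by (induction ks) simp_all

locale type_D_system =
  fixes n :: nat
  assumes n_ge: "4 \<le> n"
begin

abbreviation \<alpha> :: "nat \<Rightarrow> nat \<Rightarrow> int" where "\<alpha> i \<equiv> simple_root n i"

lemma simple_root_root: "i \<in> {1..n} \<Longrightarrow> \<alpha> i \<in> D_roots n"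
  using n_ge by (intro simple_root_in_D_roots) auto

lemma simple_root_norm: "i \<in> {1..n} \<Longrightarrow> dot n (\<alpha> i) (\<alpha> i) = 2"
  by (simp add: D_roots_norm simple_root_root)

lemma cartan_cases:
  assumes "i \<in> {1..n}" "j \<in> {1..n}" "i \<noteq> j"
  shows "dot n (\<alpha> i) (\<alpha> j) = 0 \<or> dot n (\<alpha> i) (\<alpha> j) = -1"
  using assms n_ge
  by (subst (1 2) dot_simple_root_right) (auto simp: simple_root_def unit_vec_def)

lemma height_simple_root: "i \<in> {1..n} \<Longrightarrow> height n (\<alpha> i) = 1"
  unfolding height_def using n_ge
  by (subst dot_commute, subst dot_simple_root_right) auto

lemma act_D_roots: "set is \<subseteq> {1..n} \<Longrightarrow> v \<in> D_roots n \<Longrightarrow> act n is v \<in> D_roots n"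
  by (induction "is") (auto simp: reflection_D_roots simple_root_root)

lemma act_rev_act: "set is \<subseteq> {1..n} \<Longrightarrow> act n (rev is) (act n is v) = v"
  by (induction "is" arbitrary: v) (auto simp: act_append reflection_reflection simple_root_norm)

lemma act_act_rev: "set is \<subseteq> {1..n} \<Longrightarrow> act n is (act n (rev is) v) = v"
  using act_rev_act [of "rev is" v] by simp

text \<open>A simple reflection permutes the positive roots other than its own: a height is lowered by at
  most 1 unless the root is the simple root itself, and no root has height 0.\<close>

lemma reflection_positive:
  assumes "i \<in> {1..n}" "v \<in> D_roots n" "height n v > 0" "v \<noteq> \<alpha> i"
  shows "height n (reflection n (\<alpha> i) v) > 0"
proof -
  have "dot n v (\<alpha> i) \<le> 1"
    using D_roots_dot_ge_2 [of v n "\<alpha> i"] assms simple_root_root by force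
  moreover have "height n (reflection n (\<alpha> i) v) \<noteq> 0"
    using assms by (simp add: height_nonzero reflection_D_roots simple_root_root)
  ultimately show ?thesis using assms by (simp add: height_reflection height_simple_root)
qed

text \<open>Words are compared by their action on the roots, because this is what the action of \<open>N\<close> on the torus
  gives directly.\<close>

definition same_act :: "nat list \<Rightarrow> nat list \<Rightarrow> bool" where
  "same_act is js \<longleftrightarrow> (\<forall>v\<in>D_roots n. act n is v = act n js v)"

definition act_reduced :: "nat list \<Rightarrow> bool" where
  "act_reduced is \<longleftrightarrow> set is \<subseteq> {1..n} \<and>
     (\<forall>js. set js \<subseteq> {1..n} \<longrightarrow> same_act is js \<longrightarrow> length is \<le> length js)"

lemma same_act_refl [simp]: "same_act is is"
  by (simp add: same_act_def)

lemma same_act_sym: "same_act is js \<Longrightarrow> same_act js is"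
  by (simp add: same_act_def)

lemma same_act_trans [trans]: "same_act is js \<Longrightarrow> same_act js ks \<Longrightarrow> same_act is ks"
  by (simp add: same_act_def)

lemma same_act_Cons: "same_act is js \<Longrightarrow> same_act (i # is) (i # js)"
  by (simp add: same_act_def)

lemma same_act_Cons_Cons: "i \<in> {1..n} \<Longrightarrow> same_act (i # i # is) is"
  by (simp add: same_act_def reflection_reflection simple_root_norm)

lemma same_act_Cons_cancel: "i \<in> {1..n} \<Longrightarrow> same_act (i # is) (i # js) \<Longrightarrow> same_act is js"
  by (meson same_act_Cons same_act_Cons_Cons same_act_sym same_act_trans)

lemma same_act_rev:
  assumes "same_act is js" "set is \<subseteq> {1..n}" "set js \<subseteq> {1..n}"
  shows "same_act (rev is) (rev js)"
  unfolding same_act_def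
proof
  fix v assume v: "v \<in> D_roots n"
  then have "act n (rev is) v \<in> D_roots n" using assms act_D_roots by simp
  then have "act n (rev js) (act n js (act n (rev is) v)) = act n (rev js) (act n is (act n (rev is) v))"
    using assms(1) by (simp add: same_act_def)
  then show "act n (rev is) v = act n (rev js) v"
    using assms by (simp add: act_rev_act act_act_rev)
qed

lemma same_act_commute:
  assumes "i \<in> {1..n}" "j \<in> {1..n}" "dot n (\<alpha> i) (\<alpha> j) = 0"
  shows "same_act (i # j # is) (j # i # is)"
  using assms unfolding same_act_def
  by (simp add: fun_eq_iff reflection_apply dot_reflection_left dot_commute [of n "\<alpha> j" "\<alpha> i"])

lemma same_act_braid:
  assumes "i \<in> {1..n}" "j \<in> {1..n}" "dot n (\<alpha> i) (\<alpha> j) = -1"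
  shows "same_act (i # j # i # is) (j # i # j # is)"
  using assms unfolding same_act_def
  by (simp add: fun_eq_iff reflection_apply dot_reflection_left dot_commute [of n "\<alpha> j" "\<alpha> i"]
    simple_root_norm algebra_simps)

text \<open>The exchange condition, for the reflection in an arbitrary positive root \<open>\<beta>\<close>: follow \<open>\<beta>\<close>
  along the word until it becomes negative. A simple reflection makes no positive root negative
  except its own, and the letter where this happens may be deleted.\<close>

lemma exchange:
  assumes "set is \<subseteq> {1..n}" "\<beta> \<in> D_roots n" "height n \<beta> > 0" "height n (act n (rev is) \<beta>) < 0"
  shows "\<exists>js. set js \<subseteq> {1..n} \<and> length is = Suc (length js) \<and> (\<forall>v. act n is v = reflection n \<beta> (act n js v))"
  using assms
proof (induction "is" arbitrary: \<beta>)
  case Nil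
  then show ?case by simp
next
  case (Cons j "is")
  then have j: "j \<in> {1..n}" by simp
  show ?case
  proof (cases "\<beta> = \<alpha> j")
    case True
    then show ?thesis using Cons.prems by (intro exI [of _ "is"]) simp
  next
    case False
    define \<gamma> where "\<gamma> = reflection n (\<alpha> j) \<beta>"
    have \<gamma>: "\<gamma> \<in> D_roots n" "height n \<gamma> > 0"
      using Cons.prems j False by (simp_all add: \<gamma>_def reflection_D_roots reflection_positive simple_root_root)
    have "height n (act n (rev is) \<gamma>) < 0"
      using Cons.prems by (simp add: act_append \<gamma>_def)
    then obtain js where js: "set js \<subseteq> {1..n}" "length is = Suc (length js)"
      "\<And>v. act n is v = reflection n \<gamma> (act n js v)"
      using Cons.IH [of \<gamma>] Cons.prems \<gamma> by auto
    have "reflection n (\<alpha> j) (reflection n \<gamma> v) = reflection n \<beta> (reflection n (\<alpha> j) v)" for v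
    proof -
      have "dot n v \<gamma> = dot n (reflection n (\<alpha> j) v) \<beta>"
        by (simp add: \<gamma>_def dot_reflection_left dot_reflection_right dot_commute [of n \<beta>]
            dot_commute [of n "\<alpha> j" v] mult.commute)
      moreover have "reflection n (\<alpha> j) \<gamma> = \<beta>"
        using j by (simp add: \<gamma>_def reflection_reflection simple_root_norm)
      moreover have "reflection n (\<alpha> j) (\<lambda>k. v k - c * \<gamma> k) =
        (\<lambda>k. reflection n (\<alpha> j) v k - c * reflection n (\<alpha> j) \<gamma> k)" for c
        by (simp add: reflection_def dot_diff_left dot_scale_left fun_eq_iff algebra_simps)
      ultimately show ?thesis
        unfolding reflection_def [of n \<gamma>] reflection_def [of n \<beta>] by simp
    qed
    then have "\<forall>v. act n (j # is) v = reflection n \<beta> (act n (j # js) v)"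
      by (simp add: js(3))
    then show ?thesis using js(1,2) j by (intro exI [of _ "j # js"]) simp
  qed
qed

lemma act_reduced_Cons_D:
  assumes "act_reduced (i # is)" shows "act_reduced is"
  unfolding act_reduced_def
proof (intro conjI allI impI)
  fix js assume "set js \<subseteq> {1..n}" "same_act is js"
  then have "length (i # is) \<le> length (i # js)"
    using assms same_act_Cons [of "is" js i] unfolding act_reduced_def by (metis insert_subset list.simps(15))
  then show "length is \<le> length js" by simp
qed (use assms in \<open>auto simp: act_reduced_def\<close>)

lemma act_reduced_cong:
  assumes "act_reduced is" "same_act is js" "length js = length is" "set js \<subseteq> {1..n}"
  shows "act_reduced js"
  unfolding act_reduced_def
proof (intro conjI allI impI)
  fix ks assume "set ks \<subseteq> {1..n}" "same_act js ks"
  then have "length is \<le> length ks"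
    using assms(1) same_act_trans [OF assms(2)] unfolding act_reduced_def by blast
  then show "length js \<le> length ks" using assms(3) by simp
qed (fact assms(4))

lemma act_reduced_length_eq:
  assumes "act_reduced is" "act_reduced js" "same_act is js" shows "length is = length js"
  using assms same_act_sym [OF assms(3)] unfolding act_reduced_def by (intro order.antisym) auto

text \<open>Any descent of an element is the first letter of some reduced word: put \<open>i\<close> in front of the
  shortened word that the exchange condition provides.\<close>

lemma descent_word:
  assumes "act_reduced is" "i \<in> {1..n}" "height n (act n (rev is) (\<alpha> i)) < 0"
  shows "\<exists>js. act_reduced (i # js) \<and> same_act is (i # js)"
proof -
  have "set is \<subseteq> {1..n}" using assms by (simp add: act_reduced_def)
  then obtain js where js: "set js \<subseteq> {1..n}" "length is = Suc (length js)"
    "\<And>v. act n is v = reflection n (\<alpha> i) (act n js v)"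
    using exchange [of "is" "\<alpha> i"] assms by (auto simp: height_simple_root simple_root_root)
  have "same_act is (i # js)" using js by (simp add: same_act_def)
  then show ?thesis using act_reduced_cong [OF assms(1), of "i # js"] js assms by auto
qed

text \<open>A shorter word for \<open>i # is\<close> would have \<open>i\<close> as a descent; deleting a letter by exchange would give a
  word for \<open>is\<close> shorter than \<open>is\<close>.\<close>

lemma act_reduced_ConsI:
  assumes "act_reduced is" "i \<in> {1..n}" "height n (act n (rev is) (\<alpha> i)) > 0"
  shows "act_reduced (i # is)"
  unfolding act_reduced_def
proof (intro conjI allI impI)
  have is_sub: "set is \<subseteq> {1..n}" using assms by (simp add: act_reduced_def)
  then show "set (i # is) \<subseteq> {1..n}" using assms by simp
  fix ks assume ks: "set ks \<subseteq> {1..n}" "same_act (i # is) ks"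
  have "act n (rev ks) (\<alpha> i) = act n (rev (i # is)) (\<alpha> i)"
    using same_act_rev [OF ks(2)] ks(1) is_sub assms(2) simple_root_root by (simp add: same_act_def)
  also have "\<dots> = (\<lambda>k. - act n (rev is) (\<alpha> i) k)"
    using assms by (simp add: act_append reflection_self simple_root_norm act_uminus)
  finally have "height n (act n (rev ks) (\<alpha> i)) < 0"
    using assms by (simp add: height_uminus)
  then obtain js where js: "set js \<subseteq> {1..n}" "length ks = Suc (length js)"
    "\<And>v. act n ks v = reflection n (\<alpha> i) (act n js v)"
    using exchange [of ks "\<alpha> i"] assms ks by (auto simp: height_simple_root simple_root_root)
  have "same_act (i # is) (i # js)" using js ks by (simp add: same_act_def)
  then have "same_act is js" using assms(2) same_act_Cons_cancel by blast
  then have "length is \<le> length js" using assms(1) js(1) by (simp add: act_reduced_def)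
  then show "length (i # is) \<le> length ks" using js by simp
qed

text \<open>Otherwise \<open>i\<close> is a descent of \<open>is\<close>, and the letter \<open>i\<close> cancels against the first letter of a
  reduced word of \<open>is\<close>.\<close>

lemma act_reduced_Cons_height:
  assumes "act_reduced (i # is)" shows "height n (act n (rev is) (\<alpha> i)) > 0"
proof (rule ccontr)
  assume *: "\<not> height n (act n (rev is) (\<alpha> i)) > 0"
  have i: "i \<in> {1..n}" and is_sub: "set is \<subseteq> {1..n}"
    using assms by (auto simp: act_reduced_def)
  have "height n (act n (rev is) (\<alpha> i)) \<noteq> 0"
    using i is_sub by (intro height_nonzero act_D_roots simple_root_root) auto
  with * have "height n (act n (rev is) (\<alpha> i)) < 0" by simp
  then obtain js where js: "act_reduced (i # js)" "same_act is (i # js)"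
    using descent_word act_reduced_Cons_D [OF assms] i by blast
  have "length is = Suc (length js)"
    using act_reduced_length_eq [OF act_reduced_Cons_D [OF assms] js(1) js(2)] by simp
  moreover have "same_act (i # is) js"
    using js(2) i same_act_Cons same_act_Cons_Cons same_act_trans by blast
  then have "length (i # is) \<le> length js"
    using assms js(1) by (auto simp: act_reduced_def)
  ultimately show False by simp
qed

definition braid_relations :: "(nat \<Rightarrow> 'a::field^'m::finite^'m) \<Rightarrow> bool" where
  "braid_relations f \<longleftrightarrow> (\<forall>i\<in>{1..n}. \<forall>j\<in>{1..n}.
     (dot n (\<alpha> i) (\<alpha> j) = 0 \<longrightarrow> f i ** f j = f j ** f i) \<and>
     (dot n (\<alpha> i) (\<alpha> j) = -1 \<longrightarrow> f i ** f j ** f i = f j ** f i ** f j))"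

text \<open>Matsumoto's theorem: two different first letters \<open>i\<close> and \<open>j\<close> of reduced words of the same
  element are both descents, so that the element also has reduced words starting with the two sides of
  the braid relation of \<open>i\<close> and \<open>j\<close>.\<close>

theorem matsumoto:
  assumes f: "braid_relations f"
  shows "act_reduced is \<Longrightarrow> act_reduced js \<Longrightarrow> same_act is js \<Longrightarrow> mat_prod f is = mat_prod f js"
proof (induction "length is" arbitrary: "is" js)
  case 0
  then show ?case using act_reduced_length_eq [of "is" js] by simp
next
  case (Suc m)
  have len: "length js = Suc m" using Suc.hyps Suc.prems act_reduced_length_eq by metis
  obtain i u where iu: "is = i # u" using Suc.hyps by (cases "is") auto
  obtain j v where jv: "js = j # v" using len by (cases js) auto
  have sets: "set is \<subseteq> {1..n}" "set js \<subseteq> {1..n}"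
    using Suc.prems by (simp_all add: act_reduced_def)
  then have i: "i \<in> {1..n}" and j: "j \<in> {1..n}" and sub: "set u \<subseteq> {1..n}" "set v \<subseteq> {1..n}"
    by (simp_all add: iu jv)
  have u: "act_reduced u" "length u = m" and v: "act_reduced v" "length v = m"
    using Suc.hyps(2) Suc.prems(1,2) act_reduced_Cons_D len by (simp_all add: iu jv)
  note IH = Suc.hyps(1)
  show ?case
  proof (cases "i = j")
    case True
    then have "same_act u v" using Suc.prems(3) i same_act_Cons_cancel by (simp add: iu jv)
    then have "mat_prod f u = mat_prod f v" using IH u v by blast
    then show ?thesis by (simp add: iu jv True)
  next
    case False
    have "act n (rev is) (\<alpha> j) = act n (rev js) (\<alpha> j)"
      using same_act_rev [OF Suc.prems(3) sets] simple_root_root [OF j] by (simp add: same_act_def)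
    also have "\<dots> = (\<lambda>k. - act n (rev v) (\<alpha> j) k)"
      using j by (simp add: jv act_append reflection_self simple_root_norm act_uminus)
    finally have desc: "height n (act n (rev u) (reflection n (\<alpha> i) (\<alpha> j))) < 0"
      using act_reduced_Cons_height [of j v] Suc.prems
      by (simp add: iu jv act_append height_uminus)
    show ?thesis
    proof (cases "dot n (\<alpha> i) (\<alpha> j) = 0")
      \<comment> \<open>the element has the reduced words \<open>i j x\<close> and \<open>j i x\<close>, and each agrees with one of the
        given words in its first letter\<close>
      case True
      then have "reflection n (\<alpha> i) (\<alpha> j) = \<alpha> j" by (simp add: reflection_def dot_commute [of n "\<alpha> j"])
      with desc obtain x where x: "act_reduced (j # x)" "same_act u (j # x)"
        using descent_word u(1) j by auto
      have sx: "set x \<subseteq> {1..n}" using x by (simp add: act_reduced_def)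
      have pu: "mat_prod f u = mat_prod f (j # x)" using IH [of u "j # x"] u x by simp
      have "same_act (j # v) (j # i # x)"
        using Suc.prems(3) x(2) same_act_commute [OF i j True] same_act_Cons [OF x(2), of i]
        unfolding iu jv by (meson same_act_sym same_act_trans)
      then have vx: "same_act v (i # x)" using same_act_Cons_cancel j by blast
      moreover have "length (i # x) = length v"
        using act_reduced_length_eq [OF u(1) x(1) x(2)] u v by simp
      ultimately have "act_reduced (i # x)"
        using act_reduced_cong [OF v(1)] i sx by simp
      then have pv: "mat_prod f v = mat_prod f (i # x)" using IH [of v "i # x"] v vx by simp
      have "f i ** f j = f j ** f i" using f i j True unfolding braid_relations_def by blast
      then show ?thesis by (simp add: iu jv pu pv matrix_mul_assoc)
    next
      \<comment> \<open>likewise with \<open>i j i y\<close> and \<open>j i j y\<close>\<close>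
      case nonorth: False
      then have m1: "dot n (\<alpha> i) (\<alpha> j) = -1" using cartan_cases i j False by blast
      then have rij: "reflection n (\<alpha> i) (\<alpha> j) = (\<lambda>k. \<alpha> j k + \<alpha> i k)"
        by (simp add: reflection_def dot_commute [of n "\<alpha> j"])
      have "height n (act n (rev u) (\<alpha> i)) > 0"
        using act_reduced_Cons_height Suc.prems(1) by (simp add: iu)
      then have "height n (act n (rev u) (\<alpha> j)) < 0"
        using desc by (simp add: rij act_add height_add)
      then obtain x where x: "act_reduced (j # x)" "same_act u (j # x)"
        using descent_word u(1) j by auto
      have sx: "set x \<subseteq> {1..n}" using x by (simp add: act_reduced_def)
      have "reflection n (\<alpha> j) (\<lambda>k. \<alpha> j k + \<alpha> i k) = \<alpha> i"
        using j m1 by (simp add: reflection_def dot_add_left simple_root_norm)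
      moreover have "act n (rev u) (reflection n (\<alpha> i) (\<alpha> j)) = act n (rev (j # x)) (reflection n (\<alpha> i) (\<alpha> j))"
        using same_act_rev [OF x(2) sub(1)] sx i j
        by (simp add: same_act_def reflection_D_roots simple_root_root)
      ultimately have "height n (act n (rev x) (\<alpha> i)) < 0"
        using desc by (simp add: rij act_append)
      then obtain y where y: "act_reduced (i # y)" "same_act x (i # y)"
        using descent_word act_reduced_Cons_D x(1) i by blast
      have sy: "set y \<subseteq> {1..n}" using y by (simp add: act_reduced_def)
      have uy: "same_act u (j # i # y)" using x(2) y(2) same_act_Cons same_act_trans by blast
      have leny: "length (j # i # y) = length u"
        using act_reduced_length_eq [OF u(1) x(1) x(2)]
          act_reduced_length_eq [OF act_reduced_Cons_D [OF x(1)] y(1) y(2)] by simp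
      have "act_reduced (j # i # y)"
        using act_reduced_cong [OF u(1) uy leny] i j sy by simp
      then have pu: "mat_prod f u = mat_prod f (j # i # y)" using IH [of u "j # i # y"] u uy by simp
      have "same_act (j # v) (j # i # j # y)"
        using Suc.prems(3) same_act_Cons [OF uy, of i] same_act_braid [OF i j m1, of y]
        unfolding iu jv by (meson same_act_sym same_act_trans)
      then have vy: "same_act v (i # j # y)" using same_act_Cons_cancel j by blast
      have "act_reduced (i # j # y)"
        using act_reduced_cong [OF v(1) vy] i j sy leny u v by simp
      then have pv: "mat_prod f v = mat_prod f (i # j # y)" using IH [of v "i # j # y"] v vy by simp
      have "f i ** f j ** f i = f j ** f i ** f j"
        using f i j m1 unfolding braid_relations_def by blast
      then show ?thesis by (simp add: iu jv pu pv matrix_mul_assoc)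
    qed
  qed
qed

end

section \<open>Invertible matrices\<close>

lemma mat_group_simps [simp]:
  "carrier (mat_group H) = H" "x \<otimes>\<^bsub>mat_group H\<^esub> y = x ** y" "\<one>\<^bsub>mat_group H\<^esub> = mat 1"
  by (simp_all add: mat_group_def)

lemma
  assumes "g \<in> GL"
  shows GL_inv_right: "g ** matrix_inv g = mat 1" and GL_inv_left: "matrix_inv g ** g = mat 1"
proof -
  have "\<exists>h. g ** h = mat 1 \<and> h ** g = mat 1"
    using assms by (simp add: GL_def invertible_def)
  from someI_ex [OF this] show "g ** matrix_inv g = mat 1" "matrix_inv g ** g = mat 1"
    by (simp_all add: matrix_inv_def)
qed

lemma GL_inv_closed: "g \<in> GL \<Longrightarrow> matrix_inv g \<in> GL"
  using GL_inv_left GL_inv_right by (auto simp: GL_def invertible_def)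

lemma GL_mult_closed: "g \<in> GL \<Longrightarrow> h \<in> GL \<Longrightarrow> g ** h \<in> GL"
  by (simp add: GL_def invertible_mult)

lemma GL_cancel_left: "g \<in> GL \<Longrightarrow> matrix_inv g ** (g ** x) = x" "g \<in> GL \<Longrightarrow> g ** (matrix_inv g ** x) = x"
  by (simp_all add: matrix_mul_assoc GL_inv_left GL_inv_right)

lemma GL_cancel_right: "g \<in> GL \<Longrightarrow> x ** g ** matrix_inv g = x" "g \<in> GL \<Longrightarrow> x ** matrix_inv g ** g = x"
  by (simp_all add: matrix_mul_assoc [symmetric] GL_inv_left GL_inv_right)

lemma GL_one: "mat 1 \<in> GL"
  unfolding GL_def invertible_def by (auto intro: exI [of _ "mat 1"])

lemma group_GL: "group (mat_group GL)"
proof (rule groupI)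
  fix x :: "'a^'b^'b" assume "x \<in> carrier (mat_group GL)"
  then show "\<exists>y\<in>carrier (mat_group GL). y \<otimes>\<^bsub>mat_group GL\<^esub> x = \<one>\<^bsub>mat_group GL\<^esub>"
    by (auto intro: bexI [of _ "matrix_inv x"] simp: GL_inv_closed GL_inv_left)
qed (simp_all add: GL_mult_closed GL_one matrix_mul_assoc)

lemma matrix_inv_eqI:
  fixes g h :: "'a::field^'m::finite^'m"
  assumes "h ** g = mat 1" "g ** h = mat 1" shows "matrix_inv g = h"
proof -
  have g: "g \<in> GL" using assms by (auto simp: GL_def invertible_def)
  have "h ** g ** matrix_inv g = matrix_inv g" by (simp add: assms)
  then show ?thesis using g by (simp add: GL_cancel_right)
qed

lemma matrix_inv_one: "matrix_inv (mat 1 :: 'a::field^'m::finite^'m) = mat 1"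
  by (rule matrix_inv_eqI) simp_all

lemma matrix_inv_inv: "g \<in> GL \<Longrightarrow> matrix_inv (matrix_inv g) = g"
  by (rule matrix_inv_eqI) (simp_all add: GL_inv_left GL_inv_right)

lemma matrix_inv_mult:
  assumes "g \<in> GL" "h \<in> GL" shows "matrix_inv (g ** h) = matrix_inv h ** matrix_inv g"
proof (rule matrix_inv_eqI)
  show "matrix_inv h ** matrix_inv g ** (g ** h) = mat 1"
    using assms by (simp add: matrix_mul_assoc [symmetric] GL_cancel_left GL_inv_left)
  show "g ** h ** (matrix_inv h ** matrix_inv g) = mat 1"
    using assms by (simp add: matrix_mul_assoc [symmetric] GL_cancel_left GL_inv_right)
qed

lemma
  assumes "subgroup H (mat_group GL)"
  shows subgroup_GL_sub: "H \<subseteq> GL"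
    and subgroup_GL_mult: "\<And>g h. g \<in> H \<Longrightarrow> h \<in> H \<Longrightarrow> g ** h \<in> H"
    and subgroup_GL_one: "mat 1 \<in> H"
    and subgroup_GL_inv: "\<And>g. g \<in> H \<Longrightarrow> matrix_inv g \<in> H"
    and subgroup_GL_group: "group (mat_group H)"
    and subgroup_GL_m_inv: "\<And>g. g \<in> H \<Longrightarrow> inv\<^bsub>mat_group H\<^esub> g = matrix_inv g"
proof -
  interpret subgroup H "mat_group GL" by (rule assms)
  show sub: "H \<subseteq> GL" using subset by simp
  show m: "g ** h \<in> H" if "g \<in> H" "h \<in> H" for g h using m_closed [OF that] by simp
  show o: "mat 1 \<in> H" using one_closed by simp
  have inv_GL: "inv\<^bsub>mat_group GL\<^esub> g = matrix_inv g" if "g \<in> GL" for g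
    using group.inv_equality [OF group_GL, of "matrix_inv g" g] that
    by (simp add: GL_inv_left GL_inv_closed)
  show i: "matrix_inv g \<in> H" if "g \<in> H" for g
  proof -
    have "g \<in> GL" using that sub by auto
    from inv_GL [OF this] m_inv_closed [OF that] show ?thesis by simp
  qed
  show g: "group (mat_group H)"
    using subgroup_is_group [OF group_GL] by (simp add: mat_group_def)
  show "inv\<^bsub>mat_group H\<^esub> g = matrix_inv g" if "g \<in> H" for g
  proof -
    have "g \<in> GL" using that sub by auto
    then show ?thesis
      using group.inv_equality [OF g, of "matrix_inv g" g] that i [OF that] by (simp add: GL_inv_left)
  qed
qed


section \<open>Regular functions along one-parameter subgroups\<close>

lemma regular_sum:
  "(\<And>k. k \<in> A \<Longrightarrow> f k \<in> regular_fun) \<Longrightarrow> (\<lambda>g. \<Sum>k\<in>A. f k g) \<in> regular_fun"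
proof (induction A rule: infinite_finite_induct)
  case (insert k A)
  have "(\<lambda>g. f k g + (\<Sum>k\<in>A. f k g)) \<in> regular_fun"
    by (intro regular_fun.add insert) (simp_all add: insert)
  then show ?case using insert by simp
qed (simp_all add: regular_fun.const)

text \<open>This carries the regular inverse of a root homomorphism over to its conjugates.\<close>

lemma regular_fun_conj:
  assumes "f \<in> regular_fun" "w \<in> GL"
  shows "(\<lambda>g. f (matrix_inv w ** g ** w)) \<in> regular_fun"
  using assms(1)
proof induction
  case (entry i j)
  have "(\<lambda>g. (matrix_inv w ** g ** w) $ i $ j) =
     (\<lambda>g. \<Sum>k\<in>UNIV. (\<Sum>l\<in>UNIV. matrix_inv w $ i $ l * g $ l $ k) * w $ k $ j)"
    by (simp add: matrix_matrix_mult_def)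
  then show ?case 
    by (simp only:) (intro regular_sum regular_fun.mult regular_fun.const regular_fun.entry)
next
  case inv_det
  have "det (matrix_inv w) * det w = 1"
    using assms(2) by (simp flip: det_mul add: GL_inv_left)
  then have "det (matrix_inv w ** g ** w) = det g" for g
    by (simp add: det_mul mult.commute mult.left_commute)
  then show ?case by (simp add: regular_fun.inv_det)
qed (rule regular_fun.const regular_fun.add regular_fun.mult; assumption)+

definition laurent :: "('a::field \<Rightarrow> 'a) \<Rightarrow> bool" where
  "laurent h \<longleftrightarrow> (\<exists>p (k::nat). \<forall>x. x \<noteq> 0 \<longrightarrow> h x = poly p x / x ^ k)"

lemma laurent_const: "laurent (\<lambda>_. c)"
  unfolding laurent_def by (rule exI [of _ "[:c:]"], rule exI [of _ 0]) simp

lemma laurent_add: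
  assumes "laurent f" "laurent g" shows "laurent (\<lambda>x. f x + g x)"
proof -
  from assms(1) obtain p k where f: "\<forall>x. x \<noteq> 0 \<longrightarrow> f x = poly p x / x ^ k"
    unfolding laurent_def by (elim exE)
  from assms(2) obtain q l where g: "\<forall>x. x \<noteq> 0 \<longrightarrow> g x = poly q x / x ^ l"
    unfolding laurent_def by (elim exE)
  have "\<forall>x. x \<noteq> 0 \<longrightarrow> f x + g x = poly (p * Polynomial.monom 1 l + q * Polynomial.monom 1 k) x / x ^ (k + l)"
    using f g by (simp add: poly_monom field_simps power_add)
  then show ?thesis unfolding laurent_def by (intro exI)
qed

lemma laurent_mult:
  assumes "laurent f" "laurent g" shows "laurent (\<lambda>x. f x * g x)"
proof -
  from assms(1) obtain p k where f: "\<forall>x. x \<noteq> 0 \<longrightarrow> f x = poly p x / x ^ k"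
    unfolding laurent_def by (elim exE)
  from assms(2) obtain q l where g: "\<forall>x. x \<noteq> 0 \<longrightarrow> g x = poly q x / x ^ l"
    unfolding laurent_def by (elim exE)
  have "\<forall>x. x \<noteq> 0 \<longrightarrow> f x * g x = poly (p * q) x / x ^ (k + l)"
    using f g by (simp add: power_add)
  then show ?thesis unfolding laurent_def by (intro exI)
qed

lemma laurent_sum: "(\<And>k. k \<in> A \<Longrightarrow> laurent (f k)) \<Longrightarrow> laurent (\<lambda>x. \<Sum>k\<in>A. f k x)"
  by (induction A rule: infinite_finite_induct) (auto intro: laurent_const laurent_add)

lemma laurent_prod: "(\<And>k. k \<in> A \<Longrightarrow> laurent (f k)) \<Longrightarrow> laurent (\<lambda>x. \<Prod>k\<in>A. f k x)"
  by (induction A rule: infinite_finite_induct) (auto intro: laurent_const laurent_mult)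

lemma laurent_inverse_arg:
  assumes "laurent f" shows "laurent (\<lambda>x. f (inverse x))"
proof -
  from assms obtain p k where p: "\<forall>x. x \<noteq> 0 \<longrightarrow> f x = poly p x / x ^ k"
    unfolding laurent_def by (elim exE)
  have "\<forall>x. x \<noteq> 0 \<longrightarrow> f (inverse x) = poly (reflect_poly p * Polynomial.monom 1 k) x / x ^ degree p"
    using p by (simp add: poly_reflect_poly_nz poly_monom power_inverse divide_inverse_commute [of _ "inverse _"])
  then show ?thesis unfolding laurent_def by (intro exI)
qed

lemma laurent_cong: "(\<And>x. x \<noteq> 0 \<Longrightarrow> f x = g x) \<Longrightarrow> laurent f = laurent g"
  by (simp add: laurent_def)

lemma laurent_det:
  assumes "\<And>i j. laurent (\<lambda>x. A x $ i $ j)" shows "laurent (\<lambda>x. det (A x))"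
  unfolding det_def by (intro laurent_sum laurent_mult laurent_prod laurent_const assms)

text \<open>On a cocharacter the inverse of the determinant is again a Laurent polynomial, being the
  determinant at the inverse argument.\<close>

lemma laurent_regular_cocharacter:
  assumes f: "f \<in> regular_fun" and \<phi>: "\<phi> \<in> cocharacters T" and T: "T \<subseteq> GL"
  shows "laurent (\<lambda>x. f (\<phi> x))"
proof -
  have entry: "laurent (\<lambda>x. \<phi> x $ i $ j)" for i j
    using \<phi> by (simp add: cocharacters_def laurent_def)
  have hom: "\<phi> (x * y) = \<phi> x ** \<phi> y" if "x \<noteq> 0" "y \<noteq> 0" for x y
    using \<phi> that by (simp add: cocharacters_def)
  have GL: "\<phi> x \<in> GL" if "x \<noteq> 0" for x
    using \<phi> that T by (auto simp: cocharacters_def)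
  have one: "\<phi> 1 = mat 1"
  proof -
    have "\<phi> 1 = \<phi> 1 ** \<phi> 1" using hom [of 1 1] by simp
    then have "matrix_inv (\<phi> 1) ** \<phi> 1 = matrix_inv (\<phi> 1) ** (\<phi> 1 ** \<phi> 1)" by simp
    then show ?thesis using GL [of 1] by (simp add: GL_inv_left GL_cancel_left)
  qed
  from f show ?thesis
  proof induction
    case inv_det
    have "inverse (det (\<phi> x)) = det (\<phi> (inverse x))" if "x \<noteq> 0" for x
    proof -
      have "det (\<phi> x) * det (\<phi> (inverse x)) = det (\<phi> (x * inverse x))"
        using that by (subst hom) (simp_all add: det_mul)
      also have "\<dots> = 1" using that one by simp
      finally show ?thesis by (rule inverse_unique)
    qed
    moreover have "laurent (\<lambda>x. det (\<phi> (inverse x)))"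
      by (rule laurent_inverse_arg [OF laurent_det]) (rule entry)
    ultimately show ?case using laurent_cong by (metis (lifting))
  qed (auto intro: laurent_const laurent_add laurent_mult entry)
qed

text \<open>If the field were finite, one plus the product of all \<open>X - a\<close> would have no root.\<close>

lemma infinite_alg_closed: "infinite (UNIV :: 'a::alg_closed_field set)"
proof
  assume fin: "finite (UNIV :: 'a set)"
  define p :: "'a poly" where "p = (\<Prod>a\<in>UNIV. [:- a, 1:])"
  have "poly p x = 0" for x using fin by (auto simp: p_def poly_prod intro!: prod_zero)
  moreover have "p \<noteq> 0" using fin by (simp add: p_def)
  moreover have "degree p = card (UNIV :: 'a set)"
    by (simp add: p_def degree_prod_sum_eq)
  then have "degree p > 0" using fin by (simp add: card_gt_0_iff)
  then have "degree (p + 1) > 0" by (simp add: degree_add_eq_left)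
  then obtain x where "poly (p + 1) x = 0" using alg_closed_imp_poly_has_root by blast
  ultimately show False by simp
qed

lemma poly_eq_of_nonzero_args:
  fixes p q :: "'a::alg_closed_field poly"
  assumes "\<And>x. x \<noteq> 0 \<Longrightarrow> poly p x = poly q x" shows "p = q"
proof (rule ccontr)
  assume "p \<noteq> q"
  then have "finite {x. poly (p - q) x = 0}" by (intro poly_roots_finite) simp
  moreover have "UNIV - {0} \<subseteq> {x. poly (p - q) x = 0}" using assms by auto
  ultimately have "finite (UNIV - {0::'a})" by (rule rev_finite_subset)
  then show False using infinite_alg_closed [where ?'a = 'a] by simp
qed

lemma power_int_exponent_unique:
  assumes "\<And>x::'a::alg_closed_field. x \<noteq> 0 \<Longrightarrow> x powi a = x powi b" shows "a = b"
proof -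
  have *: "m = 0" if m: "\<And>x::'a. x \<noteq> 0 \<Longrightarrow> x ^ m = 1" for m :: nat
  proof -
    have "Polynomial.monom 1 m = (1 :: 'a poly)"
      by (rule poly_eq_of_nonzero_args) (simp add: poly_monom m)
    then show ?thesis by (metis degree_1 degree_monom_eq one_neq_zero)
  qed
  have 1: "x powi (a - b) = 1" "x powi (b - a) = 1" if "x \<noteq> 0" for x :: 'a
    using assms [OF that] that by (simp_all add: power_int_diff)
  show ?thesis
  proof (cases "a \<ge> b")
    case True
    have "nat (a - b) = 0"
      by (rule *) (use 1(1) True in \<open>simp add: power_int_nonneg_exp\<close>)
    with True show ?thesis by simp
  next
    case False
    have "nat (b - a) = 0"
      by (rule *) (use 1(2) False in \<open>simp add: power_int_nonneg_exp\<close>)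
    with False show ?thesis by simp
  qed
qed

text \<open>A nowhere vanishing Laurent polynomial over an algebraically closed field is a monomial, and the
  coefficient of a multiplicative one is 1.\<close>

lemma laurent_hom_is_power:
  fixes h :: "'a::alg_closed_field \<Rightarrow> 'a"
  assumes l: "laurent h" and nz: "\<And>x. x \<noteq> 0 \<Longrightarrow> h x \<noteq> 0"
    and hom: "\<And>x y. x \<noteq> 0 \<Longrightarrow> y \<noteq> 0 \<Longrightarrow> h (x * y) = h x * h y"
  shows "\<exists>d. \<forall>x. x \<noteq> 0 \<longrightarrow> h x = x powi d"
proof -
  from l obtain p k where "\<forall>x. x \<noteq> 0 \<longrightarrow> h x = poly p x / x ^ k"
    unfolding laurent_def by (elim exE)
  then have p: "\<And>x. x \<noteq> 0 \<Longrightarrow> h x = poly p x / x ^ k" by blast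
  have pnz: "poly p x \<noteq> 0" if "x \<noteq> 0" for x 
  proof
    assume "poly p x = 0"
    then have "h x = 0" using p that by simp
    with nz that show False by simp
  qed
  have "p \<noteq> 0" using pnz [of 1] by auto
  obtain q where q: "p = [:-0, 1:] ^ Polynomial.order 0 p * q" "\<not> [:-0, 1:] dvd q"
    using order_decomp [OF \<open>p \<noteq> 0\<close>, of 0] by blast
  have "poly q x \<noteq> 0" for x
  proof (cases "x = 0")
    case True then show ?thesis using q(2) by (simp add: dvd_iff_poly_eq_0)
  next
    case False
    then show ?thesis using pnz [OF False] by (subst (asm) q(1)) simp
  qed
  then have "degree q = 0" using alg_closed_imp_poly_has_root by blast
  then obtain c where c: "q = [:c:]" by (rule degree_eq_zeroE)
  define m where "m = Polynomial.order 0 p"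
  have hx: "h x = c * x powi (int m - int k)" if "x \<noteq> 0" for x
    using that by (subst p [OF that], subst q(1)) (simp add: c power_int_diff m_def)
  have "h 1 = h 1 * h 1" using hom [of 1 1] by simp
  then have "h 1 = 1" using nz [of 1] by simp
  then have "c = 1" using hx [of 1] by simp
  then show ?thesis using hx by auto
qed

text \<open>Multiplying by \<open>x\<close> to the degree of \<open>q\<close> turns the right hand side into a polynomial of at most that
  degree, which leaves no room for \<open>p\<close> to have positive degree.\<close>

lemma laurent_poly_both_ways_const:
  fixes p q :: "'a::alg_closed_field poly"
  assumes "\<And>x. x \<noteq> 0 \<Longrightarrow> poly p x = poly q (inverse x)" shows "poly p x = poly p y"
proof -
  have "p * Polynomial.monom 1 (degree q) = reflect_poly q"
    by (rule poly_eq_of_nonzero_args) (simp add: assms poly_reflect_poly_nz poly_monom)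
  then have "degree (p * Polynomial.monom 1 (degree q)) \<le> degree q"
    using degree_reflect_poly_le [of q] by simp
  then have "degree p = 0 \<or> p = 0"
    by (cases "p = 0") (auto simp: degree_mult_eq degree_monom_eq)
  then have "degree p = 0" by auto
  then obtain c where "p = [:c:]" by (rule degree_eq_zeroE)
  then show ?thesis by simp
qed

section \<open>Coordinates on the maximal torus\<close>

lemma power_int_prod: "(\<Prod>k\<in>A. f k) powi c = (\<Prod>k\<in>A. f k powi c)" for f :: "'b \<Rightarrow> 'a::field"
  by (induction A rule: infinite_finite_induct) (simp_all add: power_int_mult_distrib)

lemma power_int_sum: "x \<noteq> 0 \<Longrightarrow> (\<Prod>k\<in>A. x powi f k) = x powi (\<Sum>k\<in>A. f k)" for x :: "'a::field"
  by (induction A rule: infinite_finite_induct) (simp_all add: power_int_add)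

lemma dot_sum_right: "dot n v (\<lambda>j. \<Sum>k\<in>A. m k * w k j) = (\<Sum>k\<in>A. m k * dot n v (w k))"
  unfolding dot_def sum_distrib_left by (subst sum.swap) (simp add: mult.left_commute)

context type_D_system
begin

text \<open>A linear combination of simple roots orthogonal to all roots has square length 0, hence is 0; its
  coefficients are then read off by pairing with (multiples of) the fundamental weights.\<close>

lemma simple_roots_independent:
  assumes orth: "\<And>v. v \<in> D_roots n \<Longrightarrow> (\<Sum>k=1..n. m k * dot n v (\<alpha> k)) = 0" and i: "i \<in> {1..n}"
  shows "m i = 0"
proof -
  define u where "u = (\<lambda>j. \<Sum>k=1..n. m k * \<alpha> k j)"
  have "dot n (\<alpha> k) u = 0" if "k \<in> {1..n}" for k
    using orth [OF simple_root_root [OF that]] by (simp add: u_def dot_sum_right)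
  then have "dot n u u = 0"
    by (subst (2) u_def) (simp add: dot_sum_right dot_commute [of n u])
  then have "\<forall>k\<in>{1..n}. u k = 0"
    unfolding dot_def by (subst (asm) sum_nonneg_eq_0_iff) auto
  define \<omega> where "\<omega> = (\<lambda>k. if i \<le> n - 2 then if k \<le> i then 1 else 0
     else if i = n - 1 \<and> k = n then - 1 else (1::int))"
  have pair: "dot n \<omega> (\<alpha> k) = (if k = i then if i \<le> n - 2 then 1 else 2 else 0)" if "k \<in> {1..n}" for k
    using that i n_ge by (subst dot_simple_root_right) (auto simp: \<omega>_def)
  have "0 = dot n \<omega> u" using \<open>\<forall>k\<in>{1..n}. u k = 0\<close> by (simp add: dot_def)
  also have "\<dots> = (\<Sum>k=1..n. m k * dot n \<omega> (\<alpha> k))" by (simp add: u_def dot_sum_right)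
  also have "\<dots> = (\<Sum>k=1..n. if k = i then m i * (if i \<le> n - 2 then 1 else 2) else 0)"
    by (rule sum.cong) (auto simp: pair)
  also have "\<dots> = m i * (if i \<le> n - 2 then 1 else 2)" using i by simp
  finally show ?thesis by (cases "i \<le> n - 2") auto
qed

end

locale D_group = type_D_system +
  fixes R :: "('a::alg_closed_field, 'm::finite) group_realization"
  assumes G_alg: "algebraic_group (Grp R)"
    and T_torus: "torus (Tor R)" and T_sub_G: "Tor R \<subseteq> Grp R"
    and typ_D: "type_D n R" and sc: "simply_connected_D n R" and realiz: "realization n R"
begin

abbreviation "G \<equiv> Grp R"
abbreviation "T \<equiv> Tor R"
abbreviation "N \<equiv> tnormalizer R"
abbreviation "\<tau> \<equiv> tor_elt n R"
abbreviation "\<sigma> i \<equiv> sigma R (\<alpha> i)"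
abbreviation "h i \<equiv> crt R (\<alpha> i)"

lemma G_subgroup: "subgroup G (mat_group GL)" using G_alg by (simp add: algebraic_group_def)
lemma T_subgroup: "subgroup T (mat_group GL)" using T_torus by (simp add: torus_def algebraic_group_def)

lemma T_GL: "t \<in> T \<Longrightarrow> t \<in> GL" and G_GL: "g \<in> G \<Longrightarrow> g \<in> GL"
  using subgroup_GL_sub [OF G_subgroup] subgroup_GL_sub [OF T_subgroup] by auto

lemmas T_mult = subgroup_GL_mult [OF T_subgroup]
  and T_one = subgroup_GL_one [OF T_subgroup]
  and T_inv = subgroup_GL_inv [OF T_subgroup]
  and G_mult = subgroup_GL_mult [OF G_subgroup]
  and G_one = subgroup_GL_one [OF G_subgroup]
  and G_inv = subgroup_GL_inv [OF G_subgroup]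

text \<open>The characters of the torus separate its elements and take the same value on \<open>st\<close> and \<open>ts\<close>.\<close>

lemma T_commute: assumes "s \<in> T" "t \<in> T" shows "s ** t = t ** s"
proof -
  obtain r \<psi> \<phi> where *: "(\<forall>j<r. \<psi> j \<in> characters T \<and> \<phi> j \<in> cocharacters T) \<and>
      (\<forall>i<r. \<forall>j<r. \<forall>x. x \<noteq> 0 \<longrightarrow> \<psi> i (\<phi> j x) = (if i = j then x else 1)) \<and>
      (\<forall>t\<in>T. t = mat_prod (\<lambda>j. \<phi> j (\<psi> j t)) [0..<r])"
    using T_torus [unfolded torus_def, THEN conjunct2] by (elim exE)
  then have \<psi>: "\<forall>j<r. \<psi> j \<in> characters T" by simp
  note dec = * [THEN conjunct2, THEN conjunct2]
  have "\<psi> j (s ** t) = \<psi> j (t ** s)" if "j < r" for j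
    using \<psi> that assms by (simp add: characters_def mult.commute)
  then have eq: "mat_prod (\<lambda>j. \<phi> j (\<psi> j (s ** t))) [0..<r] = mat_prod (\<lambda>j. \<phi> j (\<psi> j (t ** s))) [0..<r]"
    by (intro mat_prod_cong) simp
  show ?thesis
    by (rule trans [OF dec [rule_format, OF T_mult [OF assms]]
          trans [OF eq dec [rule_format, OF T_mult [OF assms(2,1)], symmetric]]])
qed

lemma T_left_commute: "s \<in> T \<Longrightarrow> t \<in> T \<Longrightarrow> s ** (t ** x) = t ** (s ** x)"
  by (simp add: matrix_mul_assoc T_commute)

lemma mat_prod_T: "(\<And>k. k \<in> set ks \<Longrightarrow> f k \<in> T) \<Longrightarrow> mat_prod f ks \<in> T"
  by (induction ks) (simp_all add: T_one T_mult)

lemma mat_prod_mult_T: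
  "(\<And>k. k \<in> set ks \<Longrightarrow> f k \<in> T \<and> g k \<in> T) \<Longrightarrow>
     mat_prod (\<lambda>k. f k ** g k) ks = mat_prod f ks ** mat_prod g ks"
proof (induction ks)
  case (Cons k ks)
  then have "g k ** (mat_prod f ks ** mat_prod g ks) = mat_prod f ks ** (g k ** mat_prod g ks)"
    by (intro T_left_commute mat_prod_T) auto
  with Cons show ?case by (simp add: matrix_mul_assoc [symmetric])
qed simp

lemma
  assumes "\<kappa> \<in> characters T"
  shows character_mult: "s \<in> T \<Longrightarrow> t \<in> T \<Longrightarrow> \<kappa> (s ** t) = \<kappa> s * \<kappa> t"
    and character_nonzero: "t \<in> T \<Longrightarrow> \<kappa> t \<noteq> 0"
    and character_one: "\<kappa> (mat 1) = 1"
    and character_mat_prod: "(\<And>k. k \<in> set ks \<Longrightarrow> f k \<in> T) \<Longrightarrow>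
      \<kappa> (mat_prod f ks) = (\<Prod>k\<leftarrow>ks. \<kappa> (f k))"
proof -
  show m: "\<kappa> (s ** t) = \<kappa> s * \<kappa> t" if "s \<in> T" "t \<in> T" for s t
    using assms that by (simp add: characters_def)
  show nz: "\<kappa> t \<noteq> 0" if "t \<in> T" for t using assms that by (simp add: characters_def)
  show o: "\<kappa> (mat 1) = 1" using m [OF T_one T_one] nz [OF T_one] by simp
  show "(\<And>k. k \<in> set ks \<Longrightarrow> f k \<in> T) \<Longrightarrow> \<kappa> (mat_prod f ks) = (\<Prod>k\<leftarrow>ks. \<kappa> (f k))"
    by (induction ks) (simp_all add: o m mat_prod_T)
qed

lemma
  assumes "\<phi> \<in> cocharacters T"
  shows cocharacter_in: "x \<noteq> 0 \<Longrightarrow> \<phi> x \<in> T"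
    and cocharacter_mult: "x \<noteq> 0 \<Longrightarrow> y \<noteq> 0 \<Longrightarrow> \<phi> (x * y) = \<phi> x ** \<phi> y"
    and cocharacter_one: "\<phi> 1 = mat 1"
proof -
  show i: "\<phi> x \<in> T" if "x \<noteq> 0" for x using assms that by (simp add: cocharacters_def)
  show m: "\<phi> (x * y) = \<phi> x ** \<phi> y" if "x \<noteq> 0" "y \<noteq> 0" for x y
    using assms that by (simp add: cocharacters_def)
  have "\<phi> 1 = \<phi> 1 ** \<phi> 1" using m [of 1 1] by simp
  then have "matrix_inv (\<phi> 1) ** \<phi> 1 = matrix_inv (\<phi> 1) ** (\<phi> 1 ** \<phi> 1)" by simp
  then show "\<phi> 1 = mat 1" using T_GL [OF i [of 1]] by (simp add: GL_inv_left GL_cancel_left)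
qed

lemma root_character: "v \<in> D_roots n \<Longrightarrow> rt R v \<in> characters T"
  using bij_betwE [OF typ_D [unfolded type_D_def, THEN conjunct1]] by (simp add: roots_def)

lemma coroot_cocharacter: "v \<in> D_roots n \<Longrightarrow> crt R v \<in> cocharacters T"
  using typ_D by (simp add: type_D_def)

lemma root_coroot:
  "v \<in> D_roots n \<Longrightarrow> w \<in> D_roots n \<Longrightarrow> x \<noteq> 0 \<Longrightarrow> rt R v (crt R w x) = x powi dot n v w"
  using typ_D by (simp add: type_D_def)

lemmas root_mult = character_mult [OF root_character]
  and root_nonzero = character_nonzero [OF root_character]
  and root_one = character_one [OF root_character]
  and coroot_in = cocharacter_in [OF coroot_cocharacter]
  and coroot_mult = cocharacter_mult [OF coroot_cocharacter]
  and coroot_one = cocharacter_one [OF coroot_cocharacter]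

lemma tau_in: "(\<And>k. x k \<noteq> 0) \<Longrightarrow> \<tau> x \<in> T"
  unfolding tor_elt_def by (rule mat_prod_T) (auto simp: coroot_in simple_root_root)

lemma tau_mult:
  assumes "\<And>k. x k \<noteq> 0" "\<And>k. y k \<noteq> 0" shows "\<tau> (\<lambda>k. x k * y k) = \<tau> x ** \<tau> y"
proof -
  have "\<tau> (\<lambda>k. x k * y k) = mat_prod (\<lambda>k. h k (x k) ** h k (y k)) [1..<Suc n]"
    unfolding tor_elt_def
    by (rule mat_prod_cong) (use assms in \<open>auto simp: coroot_mult simple_root_root\<close>)
  also have "\<dots> = \<tau> x ** \<tau> y"
    unfolding tor_elt_def
    by (rule mat_prod_mult_T) (use assms in \<open>auto simp: coroot_in simple_root_root\<close>)
  finally show ?thesis .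
qed

lemma tau_cong: "(\<And>k. k \<in> {1..n} \<Longrightarrow> x k = y k) \<Longrightarrow> \<tau> x = \<tau> y"
  unfolding tor_elt_def by (rule mat_prod_cong) auto

lemma tau_one: "\<tau> (\<lambda>_. 1) = mat 1"
proof -
  have "set ks \<subseteq> {1..n} \<Longrightarrow> mat_prod (\<lambda>k. h k 1) ks = mat 1" for ks
    by (induction ks) (simp_all add: coroot_one simple_root_root)
  moreover have "set [1..<Suc n] \<subseteq> {1..n}" by auto
  ultimately show ?thesis unfolding tor_elt_def by blast
qed

lemma character_tau:
  assumes "\<kappa> \<in> characters T" "\<And>k. x k \<noteq> 0"
  shows "\<kappa> (\<tau> x) = (\<Prod>k=1..n. \<kappa> (h k (x k)))"
proof -
  have "\<kappa> (\<tau> x) = (\<Prod>k\<leftarrow>[1..<Suc n]. \<kappa> (h k (x k)))"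
    unfolding tor_elt_def
    by (rule character_mat_prod) (use assms in \<open>auto simp: coroot_in simple_root_root\<close>)
  also have "\<dots> = (\<Prod>k\<in>set [1..<Suc n]. \<kappa> (h k (x k)))"
    by (rule prod.distinct_set_conv_list [symmetric]) simp
  also have "set [1..<Suc n] = {1..n}" by auto
  finally show ?thesis .
qed

lemma root_tau:
  assumes "v \<in> D_roots n" "\<And>k. x k \<noteq> 0"
  shows "rt R v (\<tau> x) = (\<Prod>k=1..n. x k powi dot n v (\<alpha> k))"
  by (subst character_tau [OF root_character [OF assms(1)]])
    (auto simp: assms root_coroot simple_root_root intro!: prod.cong)

lemma tau_list_prod:
  "(\<And>j k. j \<in> set js \<Longrightarrow> x j k \<noteq> 0) \<Longrightarrow> mat_prod (\<lambda>j. \<tau> (x j)) js = \<tau> (\<lambda>k. \<Prod>j\<leftarrow>js. x j k)"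
proof (induction js)
  case Nil then show ?case by (simp add: tau_one)
next
  case (Cons j js)
  have "(\<Prod>i\<leftarrow>js. x i k) \<noteq> 0" for k using Cons.prems by (auto simp: prod_list_zero_iff)
  then show ?case using Cons by (simp add: tau_mult)
qed

lemma h_tau:
  assumes "i \<in> {1..n}" shows "h i y = \<tau> (\<lambda>k. if k = i then y else 1)"
proof -
  define f where "f = (\<lambda>k. h k (if k = i then y else 1))"
  have one: "mat_prod f ks = mat 1" if "set ks \<subseteq> {1..n} - {i}" for ks
    using that by (induction ks) (auto simp: f_def coroot_one simple_root_root)
  have "[1..<Suc n] = [1..<i] @ i # [Suc i..<Suc n]"
    using assms upt_add_eq_append [of 1 i "Suc n - i"] upt_conv_Cons [of i "Suc n"] by simp
  moreover have "mat_prod f [1..<i] = mat 1" "mat_prod f [Suc i..<Suc n] = mat 1"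
    using assms by (auto intro!: one)
  ultimately have "mat_prod f [1..<Suc n] = f i" by (simp only: mat_prod_append mat_prod_Cons) simp
  then show ?thesis by (simp add: tor_elt_def f_def)
qed

text \<open>Since the simple coroots generate the cocharacter lattice and are independent, they are a basis of
  it, dual to a basis of the characters; these characters are the coordinates.\<close>

theorem torus_coordinates:
  obtains \<xi> where "\<And>t k. t \<in> T \<Longrightarrow> \<xi> t k \<noteq> 0" "\<And>t. t \<in> T \<Longrightarrow> \<tau> (\<xi> t) = t"
    "\<And>x k. (\<And>k. x k \<noteq> 0) \<Longrightarrow> k \<in> {1..n} \<Longrightarrow> \<xi> (\<tau> x) k = x k"
proof -
  obtain r \<psi> \<phi> where *: "(\<forall>j<r. \<psi> j \<in> characters T \<and> \<phi> j \<in> cocharacters T) \<and>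
      (\<forall>i<r. \<forall>j<r. \<forall>x. x \<noteq> 0 \<longrightarrow> \<psi> i (\<phi> j x) = (if i = j then x else 1)) \<and>
      (\<forall>t\<in>T. t = mat_prod (\<lambda>j. \<phi> j (\<psi> j t)) [0..<r])"
    using T_torus [unfolded torus_def, THEN conjunct2] by (elim exE)
  have \<psi>: "\<psi> j \<in> characters T" and \<phi>: "\<phi> j \<in> cocharacters T" if "j < r" for j
    using * that by simp_all
  note dec = * [THEN conjunct2, THEN conjunct2, rule_format]
  have "\<exists>c. \<forall>x. x \<noteq> 0 \<longrightarrow> \<phi> j x = \<tau> (\<lambda>k. x powi c k)" if "j < r" for j
    using sc \<phi> [OF that] by (simp add: simply_connected_D_def)
  then obtain c where c: "\<And>j x. j < r \<Longrightarrow> x \<noteq> 0 \<Longrightarrow> \<phi> j x = \<tau> (\<lambda>k. x powi c j k)" by metis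
  have "\<exists>d. \<forall>x. x \<noteq> 0 \<longrightarrow> \<psi> j (h l x) = x powi d" if jl: "j < r" "l \<in> {1..n}" for j l
  proof (rule laurent_hom_is_power)
    have h: "h l \<in> cocharacters T" using jl by (simp add: coroot_cocharacter simple_root_root)
    obtain f where f: "f \<in> regular_fun" "\<And>t. t \<in> T \<Longrightarrow> \<psi> j t = f t"
      using \<psi> [OF jl(1)] unfolding characters_def by blast
    have "laurent (\<lambda>x. f (h l x))"
      using laurent_regular_cocharacter [OF f(1) h] T_GL by blast
    then show "laurent (\<lambda>x. \<psi> j (h l x))"
      by (subst laurent_cong [where g = "\<lambda>x. f (h l x)"]) (simp_all add: f(2) cocharacter_in [OF h])
    show "\<psi> j (h l x) \<noteq> 0" if "x \<noteq> 0" for x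
      using that \<open>j < r\<close> by (simp add: character_nonzero [OF \<psi>] cocharacter_in [OF h])
    show "\<psi> j (h l (x * y)) = \<psi> j (h l x) * \<psi> j (h l y)" if "x \<noteq> 0" "y \<noteq> 0" for x y
      using that \<open>j < r\<close> by (simp add: character_mult [OF \<psi>] cocharacter_in [OF h] cocharacter_mult [OF h])
  qed
  then obtain d where d: "\<And>j l x. j < r \<Longrightarrow> l \<in> {1..n} \<Longrightarrow> x \<noteq> 0 \<Longrightarrow> \<psi> j (h l x) = x powi d j l"
    by metis
  define \<xi> where "\<xi> = (\<lambda>t k. \<Prod>j<r. \<psi> j t powi c j k)"
  have nz: "\<xi> t k \<noteq> 0" if "t \<in> T" for t k
    using that by (auto simp: \<xi>_def character_nonzero [OF \<psi>])
  have surj: "\<tau> (\<xi> t) = t" if "t \<in> T" for t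
  proof -
    have "t = mat_prod (\<lambda>j. \<phi> j (\<psi> j t)) [0..<r]" by (rule dec [OF that])
    also have "\<dots> = mat_prod (\<lambda>j. \<tau> (\<lambda>k. \<psi> j t powi c j k)) [0..<r]"
      by (rule mat_prod_cong) (use that in \<open>auto simp: c character_nonzero [OF \<psi>]\<close>)
    also have "\<dots> = \<tau> (\<lambda>k. \<Prod>j\<leftarrow>[0..<r]. \<psi> j t powi c j k)"
      by (rule tau_list_prod) (use that in \<open>auto simp: character_nonzero [OF \<psi>]\<close>)
    also have "(\<lambda>k. \<Prod>j\<leftarrow>[0..<r]. \<psi> j t powi c j k) = \<xi> t"
      by (simp add: \<xi>_def fun_eq_iff prod.distinct_set_conv_list [symmetric] atLeast0LessThan)
    finally show ?thesis by simp
  qed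
  define e where "e l k = (\<Sum>j<r. d j l * c j k)" for l k
  have e: "e l k = (if k = l then 1 else 0)" if l: "l \<in> {1..n}" and k: "k \<in> {1..n}" for l k
  proof -
    have "(\<Sum>i=1..n. (e l i - (if i = l then 1 else 0)) * dot n v (\<alpha> i)) = 0" if v: "v \<in> D_roots n" for v
    proof -
      have "y powi dot n v (\<alpha> l) = y powi (\<Sum>i=1..n. e l i * dot n v (\<alpha> i))" if "y \<noteq> 0" for y :: 'a
      proof -
        have hT: "h l y \<in> T" using l that by (simp add: coroot_in simple_root_root)
        have \<xi>h: "\<xi> (h l y) = (\<lambda>i. y powi e l i)"
          using l that by (simp add: \<xi>_def e_def d power_int_mult [symmetric] power_int_sum fun_eq_iff)
        have "y powi dot n v (\<alpha> l) = rt R v (\<tau> (\<xi> (h l y)))"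
          using v l that by (simp add: surj [OF hT] root_coroot simple_root_root)
        also have "\<dots> = (\<Prod>i=1..n. (y powi e l i) powi dot n v (\<alpha> i))"
          unfolding \<xi>h by (rule root_tau) (use that v in auto)
        also have "\<dots> = y powi (\<Sum>i=1..n. e l i * dot n v (\<alpha> i))"
          using that by (simp add: power_int_mult [symmetric] power_int_sum)
        finally show ?thesis .
      qed
      then have eq: "dot n v (\<alpha> l) = (\<Sum>i=1..n. e l i * dot n v (\<alpha> i))"
        by (rule power_int_exponent_unique)
      have "(\<Sum>i=1..n. (e l i - (if i = l then 1 else 0)) * dot n v (\<alpha> i)) =
        (\<Sum>i=1..n. e l i * dot n v (\<alpha> i)) - (\<Sum>i=1..n. if i = l then dot n v (\<alpha> i) else 0)"
        by (subst sum_subtractf [symmetric]) (rule sum.cong, auto simp: left_diff_distrib)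
      also have "\<dots> = 0" using l eq by simp
      finally show ?thesis .
    qed
    from simple_roots_independent [OF this k] show ?thesis by simp
  qed
  have inj: "\<xi> (\<tau> x) k = x k" if x: "\<And>k. x k \<noteq> 0" and k: "k \<in> {1..n}" for x k
  proof -
    have "\<xi> (\<tau> x) k = (\<Prod>j<r. \<Prod>l=1..n. x l powi (d j l * c j k))"
      unfolding \<xi>_def
      by (rule prod.cong)
        (auto simp: character_tau [OF \<psi> x] power_int_prod power_int_mult d x intro!: prod.cong)
    also have "\<dots> = (\<Prod>l=1..n. x l powi e l k)"
      by (subst prod.swap) (simp add: power_int_sum x e_def)
    also have "\<dots> = (\<Prod>l=1..n. if l = k then x l else 1)"
      by (rule prod.cong) (use k in \<open>auto simp: e\<close>)
    also have "\<dots> = x k" using k by simp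
    finally show ?thesis .
  qed
  show thesis by (rule that [OF nz surj inj])
qed

lemma tau_surj: assumes "t \<in> T" obtains x where "\<And>k. x k \<noteq> 0" "t = \<tau> x"
  using torus_coordinates assms by metis

lemma tau_inj:
  assumes "\<tau> x = \<tau> y" "\<And>k. x k \<noteq> 0" "\<And>k. y k \<noteq> 0" "k \<in> {1..n}" shows "x k = y k"
  using torus_coordinates assms by metis

end

section \<open>The braid relations of the elements \<open>\<sigma>\<^sub>i\<close>\<close>

context D_group
begin

lemma conj_mult:
  "g \<in> GL \<Longrightarrow> g ** (a ** b) ** matrix_inv g = (g ** a ** matrix_inv g) ** (g ** b ** matrix_inv g)"
  by (simp add: matrix_mul_assoc [symmetric] GL_cancel_left)

lemma conj_conj:
  "g \<in> GL \<Longrightarrow> g' \<in> GL \<Longrightarrow> (g ** g') ** t ** matrix_inv (g ** g') =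
     g ** (g' ** t ** matrix_inv g') ** matrix_inv g"
  by (simp add: matrix_mul_assoc matrix_inv_mult)

lemma N_G: "g \<in> N \<Longrightarrow> g \<in> G" by (simp add: tnormalizer_def)

lemma N_GL: "g \<in> N \<Longrightarrow> g \<in> GL" by (simp add: N_G G_GL)

lemma N_conj: "g \<in> N \<Longrightarrow> t \<in> T \<Longrightarrow> g ** t ** matrix_inv g \<in> T"
  unfolding tnormalizer_def by blast

lemma N_inv_conj:
  assumes "g \<in> N" "t \<in> T" shows "matrix_inv g ** t ** g \<in> T"
proof -
  have "t \<in> (\<lambda>t. g ** t ** matrix_inv g) ` T" using assms by (simp add: tnormalizer_def)
  then obtain s where s: "s \<in> T" "t = g ** s ** matrix_inv g" by blast
  then have "matrix_inv g ** t ** g = s"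
    using N_GL [OF assms(1)] by (simp add: matrix_mul_assoc [symmetric] GL_cancel_left GL_inv_left)
  then show ?thesis using s by simp
qed

lemma N_I:
  assumes "g \<in> G" "\<And>t. t \<in> T \<Longrightarrow> g ** t ** matrix_inv g \<in> T" "\<And>t. t \<in> T \<Longrightarrow> matrix_inv g ** t ** g \<in> T"
  shows "g \<in> N"
proof -
  have "t \<in> (\<lambda>t. g ** t ** matrix_inv g) ` T" if "t \<in> T" for t
  proof
    show "t = g ** (matrix_inv g ** t ** g) ** matrix_inv g"
      using G_GL [OF assms(1)] by (simp add: matrix_mul_assoc [symmetric] GL_cancel_left GL_inv_right)
  qed (rule assms(3) [OF that])
  then show ?thesis using assms unfolding tnormalizer_def by blast
qed

lemma N_mult: assumes "g \<in> N" "g' \<in> N" shows "g ** g' \<in> N"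
proof (rule N_I)
  show "g ** g' \<in> G" using assms by (simp add: N_G G_mult)
  show "g ** g' ** t ** matrix_inv (g ** g') \<in> T" if "t \<in> T" for t
    using assms that by (simp add: conj_conj N_GL N_conj)
  have "matrix_inv g' ** (matrix_inv g ** t ** g) ** g' \<in> T" if "t \<in> T" for t
    using assms that by (simp add: N_inv_conj)
  then show "matrix_inv (g ** g') ** t ** (g ** g') \<in> T" if "t \<in> T" for t
    using assms that by (simp add: matrix_inv_mult N_GL matrix_mul_assoc)
qed

lemma N_inv: assumes "g \<in> N" shows "matrix_inv g \<in> N"
  by (rule N_I) (use assms in \<open>simp_all add: G_inv N_G N_inv_conj N_conj matrix_inv_inv N_GL\<close>)

lemma T_N: assumes "t \<in> T" shows "t \<in> N"
  by (rule N_I) (use assms T_sub_G in \<open>auto simp: T_mult T_inv\<close>)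

lemma N_subgroup: "subgroup N (mat_group GL)"
proof (rule group.subgroupI [OF group_GL])
  show "N \<subseteq> carrier (mat_group GL)" using N_GL by auto
  show "N \<noteq> {}" using T_N [OF T_one] by auto
  show "inv\<^bsub>mat_group GL\<^esub> a \<in> N" if "a \<in> N" for a
    using N_inv [OF that] N_GL [OF that]
      group.inv_equality [OF group_GL, of "matrix_inv a" a]
    by (simp add: GL_inv_left GL_inv_closed)
qed (simp add: N_mult)

lemma neg_vec_D: "v \<in> D_roots n \<Longrightarrow> neg_vec v \<in> D_roots n"
  by (simp add: neg_vec_def neg_D_roots)

lemma root_neg: "v \<in> D_roots n \<Longrightarrow> t \<in> T \<Longrightarrow> rt R (neg_vec v) t = inverse (rt R v t)"
  using typ_D by (simp add: type_D_def)

lemma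
  assumes "v \<in> D_roots n"
  shows u_root_hom: "root_hom G T (rt R v) (uhom R v)"
    and u_range: "range (uhom R v) = root_subgroup G T (rt R v)"
    and sigma_N: "sigma R v \<in> N"
    and sigma_conj: "\<And>t. t \<in> T \<Longrightarrow>
      sigma R v ** t ** matrix_inv (sigma R v) = t ** crt R v (inverse (rt R v t))"
    and u_sigma: "\<And>x. x \<noteq> 0 \<Longrightarrow>
      uhom R v x ** uhom R (neg_vec v) (- inverse x) ** uhom R v x = crt R v x ** sigma R v"
  using realiz assms by (simp_all add: realization_def)

lemma
  assumes "root_hom G T a v"
  shows root_hom_G: "v x \<in> G"
    and root_hom_add: "v (x + y) = v x ** v y"
    and root_hom_poly: "\<exists>p. \<forall>x. v x $ i $ j = poly p x"
    and root_hom_inj: "v x = v y \<Longrightarrow> x = y"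
    and root_hom_T: "t \<in> T \<Longrightarrow> t ** v x ** matrix_inv t = v (a t * x)"
    and root_hom_zero: "v 0 = mat 1"
    and root_hom_minus: "matrix_inv (v x) = v (- x)"
proof -
  show G: "v x \<in> G" for x using assms by (simp add: root_hom_def)
  show add: "v (x + y) = v x ** v y" for x y using assms by (simp add: root_hom_def)
  show "\<exists>p. \<forall>x. v x $ i $ j = poly p x" using assms by (simp add: root_hom_def)
  show "v x = v y \<Longrightarrow> x = y" using assms unfolding root_hom_def by metis
  show "t \<in> T \<Longrightarrow> t ** v x ** matrix_inv t = v (a t * x)" using assms by (simp add: root_hom_def)
  have "v 0 = v 0 ** v 0" using add [of 0 0] by simp
  then have "matrix_inv (v 0) ** v 0 = matrix_inv (v 0) ** (v 0 ** v 0)" by simp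
  then show z: "v 0 = mat 1" using G_GL [OF G] by (simp add: GL_inv_left GL_cancel_left)
  show "matrix_inv (v x) = v (- x)"
    by (rule matrix_inv_eqI) (simp_all add: add [symmetric] z)
qed

lemma root_surj:
  assumes "v \<in> D_roots n" "s \<noteq> 0" obtains t where "t \<in> T" "rt R v t = s"
proof -
  obtain y where y: "y ^ 2 = s" using nth_root_exists [of 2 s] by auto
  then have "y \<noteq> 0" using assms by auto
  then have "crt R v y \<in> T" "rt R v (crt R v y) = s"
    using assms y by (simp_all add: coroot_in root_coroot D_roots_norm)
  then show thesis by (rule that)
qed

lemma mat_triple_entry:
  "(a ** b ** c) $ i $ j = (\<Sum>k\<in>UNIV. (\<Sum>l\<in>UNIV. a $ i $ l * b $ l $ k) * c $ k $ j)"
  for a b c :: "'a^'m^'m"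
  by (simp add: matrix_matrix_mult_def)

text \<open>The torus acts on the conjugate of a root subgroup by \<open>w\<close> through the root composed with conjugation
  by \<open>w\<close> inverse.\<close>

lemma root_hom_conj:
  assumes v: "root_hom G T b v" and w: "w \<in> N"
    and eq: "\<And>t. t \<in> T \<Longrightarrow> a (w ** t ** matrix_inv w) = b t"
  shows "root_hom G T a (\<lambda>x. w ** v x ** matrix_inv w)"
  unfolding root_hom_def
proof (intro conjI allI ballI)
  have wGL: "w \<in> GL" by (rule N_GL [OF w])
  show "w ** v x ** matrix_inv w \<in> G" for x
    by (intro G_mult G_inv N_G w root_hom_G [OF v])
  show "w ** v (x + y) ** matrix_inv w = w ** v x ** matrix_inv w ** (w ** v y ** matrix_inv w)" for x y
    using wGL by (simp add: root_hom_add [OF v] conj_mult)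
  show "\<exists>p. \<forall>x. (w ** v x ** matrix_inv w) $ i $ j = poly p x" for i j
  proof -
    obtain p where p: "\<And>l k x. v x $ l $ k = poly (p l k) x"
      using root_hom_poly [OF v] by metis
    show ?thesis
      by (rule exI [of _ "\<Sum>k\<in>UNIV. (\<Sum>l\<in>UNIV. [:w $ i $ l:] * p l k) * [:matrix_inv w $ k $ j:]"])
        (simp add: mat_triple_entry p poly_sum mult.commute)
  qed
  obtain f where f: "f \<in> regular_fun" "\<And>x. f (v x) = x" using v unfolding root_hom_def by blast
  show "\<exists>f\<in>regular_fun. \<forall>x. f (w ** v x ** matrix_inv w) = x"
  proof (rule bexI [OF _ regular_fun_conj [OF f(1) wGL]])
    have "matrix_inv w ** (w ** v x ** matrix_inv w) ** w = v x" for x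
      using wGL by (simp add: matrix_mul_assoc [symmetric] GL_cancel_left GL_inv_left)
    then show "\<forall>x. f (matrix_inv w ** (w ** v x ** matrix_inv w) ** w) = x" by (simp add: f)
  qed
  fix t x assume t: "t \<in> T"
  define s where "s = matrix_inv w ** t ** w"
  have s: "s \<in> T" using N_inv_conj [OF w t] by (simp add: s_def)
  have ws: "w ** s ** matrix_inv w = t"
    using wGL by (simp add: s_def matrix_mul_assoc [symmetric] GL_cancel_left GL_inv_right)
  have tw: "t ** w = w ** s"
    using wGL by (simp add: s_def matrix_mul_assoc [symmetric] GL_cancel_left)
  have "t ** (w ** v x ** matrix_inv w) ** matrix_inv t =
     (t ** w) ** v x ** matrix_inv (t ** w)"
    using wGL T_GL [OF t] by (simp add: matrix_inv_mult matrix_mul_assoc)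
  also have "\<dots> = w ** (s ** v x ** matrix_inv s) ** matrix_inv w"
    using wGL T_GL [OF s] unfolding tw by (rule conj_conj)
  also have "\<dots> = w ** v (a t * x) ** matrix_inv w"
    using eq [OF s] by (simp add: root_hom_T [OF v s] ws)
  finally show "t ** (w ** v x ** matrix_inv w) ** matrix_inv t = w ** v (a t * x) ** matrix_inv w" .
qed

text \<open>A root homomorphism takes values in the root subgroup, and \<open>T\<close> acts on the latter through all
  of \<open>F\<^sup>\<times>\<close>; so it differs from the given one by a scalar.\<close>

lemma root_hom_scalar:
  assumes v: "v \<in> D_roots n" and f: "root_hom G T (rt R v) f"
  obtains c where "c \<noteq> 0" "\<And>x. f x = uhom R v (c * x)"
proof -
  note u = u_root_hom [OF v]
  have "f x \<in> range (uhom R v)" for x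
    unfolding u_range [OF v] root_subgroup_def using f by blast
  then have ex: "\<exists>y. f x = uhom R v y" for x by (rule rangeE) (rule exI)
  define g where "g x = (SOME y. f x = uhom R v y)" for x
  have g: "f x = uhom R v (g x)" for x unfolding g_def by (rule someI_ex [OF ex])
  have scale: "g (s * x) = s * g x" if s: "s \<noteq> 0" for s x
  proof -
    obtain t where t: "t \<in> T" "rt R v t = s" using root_surj [OF v s] by blast
    have "uhom R v (g (s * x)) = t ** f x ** matrix_inv t"
      using root_hom_T [OF f t(1)] t(2) by (simp add: g)
    also have "\<dots> = uhom R v (s * g x)"
      using root_hom_T [OF u t(1)] t(2) by (simp add: g)
    finally show ?thesis by (rule root_hom_inj [OF u])
  qed
  have "g 0 = 0"
    by (rule root_hom_inj [OF u]) (simp add: g [symmetric] root_hom_zero [OF f] root_hom_zero [OF u])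
  then have lin: "g x = g 1 * x" for x using scale [of x 1] by (cases "x = 0") simp_all
  have nz: "g 1 \<noteq> 0"
  proof
    assume "g 1 = 0"
    then have "f 1 = f 0" by (simp add: g \<open>g 0 = 0\<close>)
    then show False using root_hom_inj [OF f] by fastforce
  qed
  have "f x = uhom R v (g 1 * x)" for x by (simp only: g [of x] lin [of x])
  with nz show thesis by (rule that)
qed

text \<open>Let \<open>u\<close> and \<open>u\<^sub>-\<close> be the root homomorphisms of \<open>v\<close> and \<open>-v\<close>. The quotient of \<open>g\<close> by the element of
  the realization has the form \<open>u(c) u\<^sub>-(e') u(-c)\<close> and commutes with the torus. This is possible
  only if \<open>e' = 0\<close>: conjugating by \<open>t\<close> with \<open>v(t) = s\<close> expresses \<open>u\<^sub>-(e' / s)\<close>, a polynomial in \<open>1 / s\<close>, as a polynomial in \<open>s\<close>, so it is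
  constant.\<close>

lemma reflection_element_unique:
  assumes v: "v \<in> D_roots n" and c: "c \<noteq> 0"
    and g: "g = uhom R v c ** uhom R (neg_vec v) e ** uhom R v c"
    and conj: "\<And>t. t \<in> T \<Longrightarrow> g ** t ** matrix_inv g = t ** crt R v (inverse (rt R v t))"
  shows "g = crt R v c ** sigma R v"
proof -
  note u = u_root_hom [OF v] and u' = u_root_hom [OF neg_vec_D [OF v]]
  have uGL [simp]: "uhom R v x \<in> GL" "uhom R (neg_vec v) x \<in> GL" for x
    using root_hom_G [OF u] root_hom_G [OF u'] G_GL by auto
  define g1 where "g1 = uhom R v c ** uhom R (neg_vec v) (- inverse c) ** uhom R v c"
  have g1: "g1 = crt R v c ** sigma R v" unfolding g1_def by (rule u_sigma [OF v c])
  have cT: "crt R v c \<in> T" by (rule coroot_in [OF v c])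
  have g1_conj: "g1 ** t ** matrix_inv g1 = t ** crt R v (inverse (rt R v t))" if t: "t \<in> T" for t
  proof -
    have s: "t ** crt R v (inverse (rt R v t)) \<in> T"
      using t v by (simp add: T_mult coroot_in root_nonzero)
    have "g1 ** t ** matrix_inv g1 = crt R v c ** (t ** crt R v (inverse (rt R v t))) ** matrix_inv (crt R v c)"
      unfolding g1 by (subst conj_conj) (simp_all add: T_GL cT N_GL sigma_N v sigma_conj t)
    also have "\<dots> = t ** crt R v (inverse (rt R v t))"
      using s cT by (simp add: T_commute [OF cT s] GL_cancel_right T_GL)
    finally show ?thesis .
  qed
  define e' where "e' = e + inverse c"
  define m where "m = uhom R v c ** uhom R (neg_vec v) e' ** uhom R v (- c)"
  have gGL: "g \<in> GL" "g1 \<in> GL" by (simp_all add: g g1_def GL_mult_closed)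
  have m1: "m ** g1 = g"
  proof -
    have "m ** g1 = uhom R v c ** uhom R (neg_vec v) e' ** (uhom R v (- c) ** uhom R v c) **
      uhom R (neg_vec v) (- inverse c) ** uhom R v c"
      by (simp add: m_def g1_def matrix_mul_assoc)
    also have "\<dots> = uhom R v c ** (uhom R (neg_vec v) e' ** uhom R (neg_vec v) (- inverse c)) ** uhom R v c"
      by (simp add: root_hom_add [OF u, symmetric] root_hom_zero [OF u] matrix_mul_assoc)
    also have "\<dots> = g" by (simp add: g e'_def root_hom_add [OF u', symmetric])
    finally show ?thesis .
  qed
  have mGL: "m \<in> GL" by (simp add: m_def GL_mult_closed)
  have m_comm: "t ** m ** matrix_inv t = m" if t: "t \<in> T" for t
  proof -
    obtain x where x: "x \<in> T" "g1 ** x ** matrix_inv g1 = t"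
    proof
      have g1N: "g1 \<in> N" unfolding g1 by (intro N_mult T_N cT sigma_N v)
      show "matrix_inv g1 ** t ** g1 \<in> T" by (rule N_inv_conj [OF g1N t])
      show "g1 ** (matrix_inv g1 ** t ** g1) ** matrix_inv g1 = t"
        using gGL by (simp add: matrix_mul_assoc [symmetric] GL_cancel_left GL_inv_right)
    qed
    have "m ** t ** matrix_inv m = t"
      using conj [OF x(1)] g1_conj [OF x(1)] conj_conj [OF mGL gGL(2), of x] by (simp add: m1 x(2))
    then have "m ** t = t ** m" using mGL by (metis GL_cancel_right(2))
    then show ?thesis using T_GL [OF t] by (metis GL_cancel_right(1))
  qed
  have key: "uhom R (neg_vec v) (e' * inverse s) =
      uhom R v (c - s * c) ** uhom R (neg_vec v) e' ** uhom R v (s * c - c)" if s: "s \<noteq> 0" for s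
  proof -
    obtain t where t: "t \<in> T" "rt R v t = s" using root_surj [OF v s] by blast
    have "m = t ** m ** matrix_inv t" by (simp add: m_comm t)
    also have "\<dots> = (t ** uhom R v c ** matrix_inv t) ** (t ** uhom R (neg_vec v) e' ** matrix_inv t) **
        (t ** uhom R v (- c) ** matrix_inv t)"
      unfolding m_def by (simp add: conj_mult T_GL t)
    also have "\<dots> = uhom R v (s * c) ** uhom R (neg_vec v) (e' * inverse s) ** uhom R v (- (s * c))"
      using t by (simp add: root_hom_T [OF u] root_hom_T [OF u'] root_neg v mult.commute)
    finally have "uhom R v (- (s * c)) ** m ** uhom R v (s * c) =
        (uhom R v (- (s * c)) ** uhom R v (s * c)) ** uhom R (neg_vec v) (e' * inverse s) **
        (uhom R v (- (s * c)) ** uhom R v (s * c))" by (simp add: matrix_mul_assoc)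
    then have "uhom R (neg_vec v) (e' * inverse s) = uhom R v (- (s * c)) ** m ** uhom R v (s * c)"
      by (simp add: root_hom_add [OF u, symmetric] root_hom_zero [OF u])
    also have "\<dots> = (uhom R v (- (s * c)) ** uhom R v c) ** uhom R (neg_vec v) e' **
        (uhom R v (- c) ** uhom R v (s * c))"
      by (simp add: m_def matrix_mul_assoc)
    also have "\<dots> = uhom R v (c - s * c) ** uhom R (neg_vec v) e' ** uhom R v (s * c - c)"
      by (simp add: root_hom_add [OF u, symmetric])
    finally show ?thesis .
  qed
  have const: "uhom R (neg_vec v) (e' * inverse s) = uhom R (neg_vec v) e'" if s: "s \<noteq> 0" for s
  proof -
    have "uhom R (neg_vec v) (e' * inverse s) $ i $ j = uhom R (neg_vec v) e' $ i $ j" for i j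
    proof -
      obtain q where q: "\<And>x. uhom R (neg_vec v) x $ i $ j = poly q x"
        using root_hom_poly [OF u'] by metis
      obtain p where p: "\<And>l k x. uhom R v x $ l $ k = poly (p l k) x"
        using root_hom_poly [OF u] by metis
      define P where "P = (\<Sum>k\<in>UNIV. (\<Sum>l\<in>UNIV. pcompose (p i l) [:c, - c:] *
         [:uhom R (neg_vec v) e' $ l $ k:]) * pcompose (p k j) [:- c, c:])"
      define Q where "Q = pcompose q [:0, e':]"
      have PQ: "poly P y = poly Q (inverse y)" if "y \<noteq> 0" for y
      proof -
        have "poly P y = (uhom R v (c - y * c) ** uhom R (neg_vec v) e' ** uhom R v (y * c - c)) $ i $ j"
          by (simp add: mat_triple_entry P_def p poly_sum poly_pcompose algebra_simps)
        also have "\<dots> = poly Q (inverse y)"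
          unfolding key [OF that, symmetric] q by (simp add: Q_def poly_pcompose mult.commute)
        finally show ?thesis .
      qed
      have "poly Q (inverse s) = poly Q 1"
        using laurent_poly_both_ways_const [OF PQ, of s 1] PQ [OF s] PQ [of 1] by simp
      then show ?thesis by (simp add: q Q_def poly_pcompose mult.commute)
    qed
    then show ?thesis by (simp add: vec_eq_iff)
  qed
  have "e' = 0"
  proof -
    have "infinite (UNIV - {0, 1::'a})" using infinite_alg_closed [where ?'a = 'a] by simp
    then have "UNIV - {0, 1::'a} \<noteq> {}" by (metis finite.emptyI)
    then obtain s :: 'a where s: "s \<noteq> 0" "s \<noteq> 1" by blast
    have "e' * inverse s = e'" using const [OF s(1)] by (rule root_hom_inj [OF u'])
    then show ?thesis using s by (simp add: field_simps)
  qed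
  then have "m = mat 1"
    by (simp add: m_def root_hom_zero [OF u'] root_hom_add [OF u, symmetric] root_hom_zero [OF u])
  then show ?thesis using m1 g1 by simp
qed

text \<open>Conjugation by \<open>w\<close> takes the root subgroups of \<open>b\<close> and \<open>-b\<close> to those of \<open>c\<close> and \<open>-c\<close> up to
  scalars, and the reflection in \<open>b\<close> to the one in \<open>c\<close>; so \<open>reflection_element_unique\<close> applies to the
  conjugate of \<open>\<sigma>\<^sub>b\<close>.\<close>

lemma sigma_conj_sigma:
  assumes w: "w \<in> N" and b: "b \<in> D_roots n" and c: "c \<in> D_roots n"
    and rt: "\<And>t. t \<in> T \<Longrightarrow> rt R c (w ** t ** matrix_inv w) = rt R b t"
    and crt: "\<And>x. x \<noteq> 0 \<Longrightarrow> w ** crt R b x ** matrix_inv w = crt R c x"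
  obtains d where "d \<noteq> 0" "w ** sigma R b ** matrix_inv w = crt R c d ** sigma R c"
proof -
  have wGL: "w \<in> GL" by (rule N_GL [OF w])
  obtain d where d: "d \<noteq> 0" "\<And>x. w ** uhom R b x ** matrix_inv w = uhom R c (d * x)"
    using root_hom_scalar [OF c root_hom_conj [OF u_root_hom [OF b] w rt]] by blast
  have "rt R (neg_vec c) (w ** t ** matrix_inv w) = rt R (neg_vec b) t" if "t \<in> T" for t
    using that by (simp add: root_neg b c N_conj w rt)
  from root_hom_conj [OF u_root_hom [OF neg_vec_D [OF b]] w this]
  obtain e where e: "\<And>x. w ** uhom R (neg_vec b) x ** matrix_inv w = uhom R (neg_vec c) (e * x)"
    using root_hom_scalar [OF neg_vec_D [OF c]] by blast
  define g where "g = w ** sigma R b ** matrix_inv w"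
  have "g = uhom R c d ** uhom R (neg_vec c) (- e) ** uhom R c d"
    by (simp add: g_def sigma_def conj_mult wGL d(2) e)
  moreover have "g ** t ** matrix_inv g = t ** crt R c (inverse (rt R c t))" if t: "t \<in> T" for t
  proof -
    define s where "s = matrix_inv w ** t ** w"
    have s: "s \<in> T" using N_inv_conj [OF w t] by (simp add: s_def)
    have ws: "w ** s ** matrix_inv w = t"
      using wGL by (simp add: s_def matrix_mul_assoc [symmetric] GL_cancel_left GL_inv_right)
    have sGL: "sigma R b \<in> GL" by (rule N_GL [OF sigma_N [OF b]])
    have gw: "g ** w = w ** sigma R b" using wGL by (simp add: g_def GL_cancel_right)
    have gGL: "g \<in> GL" using wGL sGL by (simp add: g_def GL_mult_closed GL_inv_closed)
    have "g ** t ** matrix_inv g = (g ** w) ** s ** matrix_inv (g ** w)"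
      using gGL wGL by (simp add: conj_conj ws)
    also have "\<dots> = w ** (s ** crt R b (inverse (rt R b s))) ** matrix_inv w"
      unfolding gw using wGL sGL by (simp add: conj_conj sigma_conj b s)
    also have "\<dots> = t ** crt R c (inverse (rt R c t))"
      using rt [OF s] by (simp add: conj_mult wGL ws crt root_nonzero [OF b s])
    finally show ?thesis .
  qed
  ultimately have "g = crt R c d ** sigma R c"
    by (rule reflection_element_unique [OF c d(1)])
  then show thesis using that d(1) by (simp add: g_def)
qed

lemma h_in: "i \<in> {1..n} \<Longrightarrow> x \<noteq> 0 \<Longrightarrow> h i x \<in> T"
  by (simp add: coroot_in simple_root_root)

lemma root_h: "i \<in> {1..n} \<Longrightarrow> j \<in> {1..n} \<Longrightarrow> x \<noteq> 0 \<Longrightarrow> rt R (\<alpha> j) (h i x) = x powi dot n (\<alpha> j) (\<alpha> i)"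
  by (simp add: root_coroot simple_root_root)

lemma h_mult: "i \<in> {1..n} \<Longrightarrow> x \<noteq> 0 \<Longrightarrow> y \<noteq> 0 \<Longrightarrow> h i x ** h i y = h i (x * y)"
  by (simp add: coroot_mult simple_root_root)

lemma h_one: "i \<in> {1..n} \<Longrightarrow> h i 1 = mat 1"
  by (simp add: coroot_one simple_root_root)

lemma sigma_simple_N: "i \<in> {1..n} \<Longrightarrow> \<sigma> i \<in> N"
  by (simp add: sigma_N simple_root_root)

lemma sigma_simple_conj:
  "i \<in> {1..n} \<Longrightarrow> t \<in> T \<Longrightarrow> \<sigma> i ** t ** matrix_inv (\<sigma> i) = t ** h i (inverse (rt R (\<alpha> i) t))"
  by (simp add: sigma_conj simple_root_root)

lemma root_sigma_conj:
  assumes "v \<in> D_roots n" "i \<in> {1..n}" "t \<in> T"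
  shows "rt R v (\<sigma> i ** t ** matrix_inv (\<sigma> i)) = rt R v t * rt R (\<alpha> i) t powi (- dot n v (\<alpha> i))"
  using assms
  by (simp add: sigma_simple_conj root_mult coroot_in root_coroot simple_root_root root_nonzero
      power_int_minus power_int_inverse)

lemma h_tau_product:
  assumes "i \<in> {1..n}" "j \<in> {1..n}" "i \<noteq> j" "x \<noteq> 0" "y \<noteq> 0"
  shows "h i x ** h j y = \<tau> (\<lambda>k. if k = i then x else if k = j then y else 1)"
  using assms by (subst (1 2) h_tau) (auto simp flip: tau_mult intro!: tau_cong)

lemma h_independent:
  assumes ij: "i \<in> {1..n}" "j \<in> {1..n}" "i \<noteq> j" and "x \<noteq> 0" "y \<noteq> 0" and eq: "h i x ** h j y = mat 1"
  shows "x = 1" "y = 1"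
proof -
  have "\<tau> (\<lambda>k. if k = i then x else if k = j then y else 1) = \<tau> (\<lambda>_. 1)"
    using assms h_tau_product [of i j x y] tau_one by simp
  from tau_inj [OF this] have *: "(if k = i then x else if k = j then y else 1) = 1" if "k \<in> {1..n}" for k
    using assms that by simp
  show "x = 1" "y = 1" using * [of i] * [of j] ij by simp_all
qed

text \<open>Orthogonality lets \<open>sigma_conj_sigma\<close> apply with \<open>w = \<sigma>\<^sub>i\<close>, which fixes \<open>\<alpha>\<^sub>j\<close> and its coroot.\<close>

lemma sigma_almost_commute:
  assumes i: "i \<in> {1..n}" and j: "j \<in> {1..n}" and orth: "dot n (\<alpha> i) (\<alpha> j) = 0"
  obtains c where "c \<noteq> 0" "\<sigma> i ** \<sigma> j = h j c ** \<sigma> j ** \<sigma> i"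
proof -
  have orth': "dot n (\<alpha> j) (\<alpha> i) = 0" using orth by (simp add: dot_commute)
  obtain c where c: "c \<noteq> 0" "\<sigma> i ** \<sigma> j ** matrix_inv (\<sigma> i) = h j c ** \<sigma> j"
  proof (rule sigma_conj_sigma [of "\<sigma> i" "\<alpha> j" "\<alpha> j"])
    show "rt R (\<alpha> j) (\<sigma> i ** t ** matrix_inv (\<sigma> i)) = rt R (\<alpha> j) t" if "t \<in> T" for t
      using that i j by (simp add: root_sigma_conj simple_root_root orth')
    show "\<sigma> i ** h j x ** matrix_inv (\<sigma> i) = h j x" if "x \<noteq> 0" for x
      using that i j by (simp add: sigma_simple_conj h_in root_h orth h_one)
  qed (use i j in \<open>simp_all add: sigma_simple_N simple_root_root\<close>)
  then have "\<sigma> i ** \<sigma> j = h j c ** \<sigma> j ** \<sigma> i"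
    using N_GL [OF sigma_simple_N [OF i]] by (metis GL_cancel_right(2))
  then show thesis using that c(1) by blast
qed

text \<open>For adjacent nodes \<open>w = \<sigma>\<^sub>i \<sigma>\<^sub>j\<close> takes \<open>\<alpha>\<^sub>i\<close> to \<open>\<alpha>\<^sub>j\<close>, so it conjugates \<open>\<sigma>\<^sub>i\<close> to \<open>\<sigma>\<^sub>j\<close> up to the torus.\<close>

lemma sigma_almost_braid:
  assumes i: "i \<in> {1..n}" and j: "j \<in> {1..n}" and adj: "dot n (\<alpha> i) (\<alpha> j) = -1"
  obtains c where "c \<noteq> 0" "\<sigma> i ** \<sigma> j ** \<sigma> i = h j c ** (\<sigma> j ** \<sigma> i ** \<sigma> j)"
proof -
  have adj': "dot n (\<alpha> j) (\<alpha> i) = -1" using adj by (simp add: dot_commute)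
  have GL: "\<sigma> i \<in> GL" "\<sigma> j \<in> GL" using i j by (simp_all add: N_GL sigma_simple_N)
  have w: "\<sigma> i ** \<sigma> j \<in> N" using i j by (simp add: N_mult sigma_simple_N)
  obtain c where c: "c \<noteq> 0" "(\<sigma> i ** \<sigma> j) ** \<sigma> i ** matrix_inv (\<sigma> i ** \<sigma> j) = h j c ** \<sigma> j"
  proof (rule sigma_conj_sigma [of "\<sigma> i ** \<sigma> j" "\<alpha> i" "\<alpha> j"])
    fix t assume t: "t \<in> T"
    have t': "\<sigma> j ** t ** matrix_inv (\<sigma> j) \<in> T" using t j by (simp add: N_conj sigma_simple_N)
    have nz: "rt R (\<alpha> i) t \<noteq> 0" "rt R (\<alpha> j) t \<noteq> 0"
      using t i j by (simp_all add: root_nonzero simple_root_root)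
    show "rt R (\<alpha> j) (\<sigma> i ** \<sigma> j ** t ** matrix_inv (\<sigma> i ** \<sigma> j)) = rt R (\<alpha> i) t"
      unfolding conj_conj [OF GL] using t t' i j nz
      by (simp add: root_sigma_conj simple_root_root adj adj' simple_root_norm power_int_minus
          field_simps power2_eq_square)
  next
    fix x :: 'a assume x: "x \<noteq> 0"
    have 1: "\<sigma> j ** h i x ** matrix_inv (\<sigma> j) = h i x ** h j x"
      using x i j by (simp add: sigma_simple_conj h_in root_h adj' power_int_minus)
    have 2: "\<sigma> i ** h i x ** matrix_inv (\<sigma> i) = h i (inverse x)"
      using x i by (simp add: sigma_simple_conj h_in root_h simple_root_norm h_mult)
        (simp add: power2_eq_square field_simps)
    have 3: "\<sigma> i ** h j x ** matrix_inv (\<sigma> i) = h j x ** h i x"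
      using x i j by (simp add: sigma_simple_conj h_in root_h adj power_int_minus)
    have "\<sigma> i ** \<sigma> j ** h i x ** matrix_inv (\<sigma> i ** \<sigma> j) = h i (inverse x) ** (h j x ** h i x)"
      unfolding conj_conj [OF GL] 1 conj_mult [OF GL(1)] 2 3 ..
    also have "\<dots> = h i (inverse x) ** (h i x ** h j x)"
      using x i j by (simp add: T_commute h_in)
    also have "\<dots> = h j x" using x i by (simp add: matrix_mul_assoc h_mult h_one)
    finally show "\<sigma> i ** \<sigma> j ** h i x ** matrix_inv (\<sigma> i ** \<sigma> j) = h j x" .
  qed (use i j w in \<open>simp_all add: simple_root_root\<close>)
  have "\<sigma> i ** \<sigma> j ** \<sigma> i = h j c ** \<sigma> j ** (\<sigma> i ** \<sigma> j)"
    using c(2) N_GL [OF w] by (metis GL_cancel_right(2))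
  then have "\<sigma> i ** \<sigma> j ** \<sigma> i = h j c ** (\<sigma> j ** \<sigma> i ** \<sigma> j)" by (simp add: matrix_mul_assoc)
  then show thesis using that c(1) by blast
qed

text \<open>Each braid relation holds up to an element \<open>\<alpha>\<^sub>j\<^sup>\<or>(c)\<close>, and with \<open>i\<close> and \<open>j\<close> exchanged up to some
  \<open>\<alpha>\<^sub>i\<^sup>\<or>(d)\<close>. The two errors are inverse to each other, so independence of the coroots makes both
  trivial.\<close>

theorem sigma_braid: "braid_relations \<sigma>"
  unfolding braid_relations_def
proof (intro ballI conjI impI)
  fix i j assume i: "i \<in> {1..n}" and j: "j \<in> {1..n}"
  have GL: "\<sigma> i \<in> GL" "\<sigma> j \<in> GL" using i j by (simp_all add: N_GL sigma_simple_N)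
  have cancel: "c = 1" if c: "c \<noteq> 0" "d \<noteq> 0" "x \<in> GL" "x = h j c ** y" "y = h i d ** x" "i \<noteq> j" for c d x y
  proof -
    have "x = h j c ** h i d ** x" using c by (metis matrix_mul_assoc)
    then have "x ** matrix_inv x = h j c ** h i d ** x ** matrix_inv x" by simp
    then have "h j c ** h i d = mat 1" using c(3) by (simp add: GL_cancel_right GL_inv_right)
    then show "c = 1" using h_independent(1) [OF j i] c by blast
  qed
  show "\<sigma> i ** \<sigma> j = \<sigma> j ** \<sigma> i" if orth: "dot n (\<alpha> i) (\<alpha> j) = 0"
  proof -
    have ne: "i \<noteq> j" using orth i by (auto simp: simple_root_norm)
    obtain c where c: "c \<noteq> 0" "\<sigma> i ** \<sigma> j = h j c ** (\<sigma> j ** \<sigma> i)"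
      using sigma_almost_commute [OF i j orth] by (metis matrix_mul_assoc)
    obtain d where d: "d \<noteq> 0" "\<sigma> j ** \<sigma> i = h i d ** (\<sigma> i ** \<sigma> j)"
      using sigma_almost_commute [OF j i] orth by (metis dot_commute matrix_mul_assoc)
    have "c = 1" using cancel [OF c(1) d(1) _ c(2) d(2) ne] GL by (simp add: GL_mult_closed)
    then show ?thesis using c j by (simp add: h_one)
  qed
  show "\<sigma> i ** \<sigma> j ** \<sigma> i = \<sigma> j ** \<sigma> i ** \<sigma> j" if adj: "dot n (\<alpha> i) (\<alpha> j) = -1"
  proof -
    have ne: "i \<noteq> j" using adj i by (auto simp: simple_root_norm)
    obtain c where c: "c \<noteq> 0" "\<sigma> i ** \<sigma> j ** \<sigma> i = h j c ** (\<sigma> j ** \<sigma> i ** \<sigma> j)"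
      using sigma_almost_braid [OF i j adj] by blast
    obtain d where d: "d \<noteq> 0" "\<sigma> j ** \<sigma> i ** \<sigma> j = h i d ** (\<sigma> i ** \<sigma> j ** \<sigma> i)"
      using sigma_almost_braid [OF j i] adj by (metis dot_commute)
    have "c = 1" using cancel [OF c(1) d(1) _ c(2) d(2) ne] GL by (simp add: GL_mult_closed)
    then show ?thesis using c j by (simp add: h_one)
  qed
qed

text \<open>The relation of the realization at \<open>x = -1\<close> reads \<open>\<sigma>\<^sub>i\<^sup>-\<^sup>1 = \<alpha>\<^sub>i\<^sup>\<or>(-1) \<sigma>\<^sub>i\<close>.\<close>

lemma sigma_square:
  assumes i: "i \<in> {1..n}" shows "\<sigma> i ** \<sigma> i = h i (- 1)"
proof -
  note v = simple_root_root [OF i]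
  note u = u_root_hom [OF v] and u' = u_root_hom [OF neg_vec_D [OF v]]
  have GL: "\<sigma> i \<in> GL" using i by (simp add: N_GL sigma_simple_N)
  have uGL: "uhom R (\<alpha> i) x \<in> GL" "uhom R (neg_vec (\<alpha> i)) x \<in> GL" for x
    using root_hom_G [OF u] root_hom_G [OF u'] G_GL by auto
  have "matrix_inv (\<sigma> i) = uhom R (\<alpha> i) (- 1) ** uhom R (neg_vec (\<alpha> i)) 1 ** uhom R (\<alpha> i) (- 1)"
    by (simp add: sigma_def matrix_inv_mult uGL GL_mult_closed root_hom_minus [OF u] root_hom_minus [OF u']
        matrix_mul_assoc)
  also have "\<dots> = h i (- 1) ** \<sigma> i" using u_sigma [OF v, of "- 1"] by simp
  finally have "h i (- 1) ** \<sigma> i ** \<sigma> i = mat 1" using GL by (metis GL_inv_left)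
  then have "h i (- 1) ** (h i (- 1) ** (\<sigma> i ** \<sigma> i)) = h i (- 1)" by (simp add: matrix_mul_assoc)
  then show ?thesis using i by (simp add: matrix_mul_assoc h_mult h_one)
qed

end

section \<open>The quotient \<open>N/T\<close> as the Weyl group of type D\<close>

context type_D_system
begin

lemma act_reduced_Nil: "act_reduced []"
  by (simp add: act_reduced_def)

lemma act_reduced_1: "i \<in> {1..n} \<Longrightarrow> act_reduced [i]"
  by (rule act_reduced_ConsI) (simp_all add: act_reduced_Nil height_simple_root)

lemma act_reduced_2:
  assumes "i \<in> {1..n}" "j \<in> {1..n}" "i \<noteq> j" shows "act_reduced [i, j]"
proof (rule act_reduced_ConsI)
  show "height n (act n (rev [j]) (\<alpha> i)) > 0"
    using cartan_cases [OF assms] assms by (auto simp: height_reflection height_simple_root)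
qed (use assms act_reduced_1 in auto)

lemma act_reduced_3:
  assumes "i \<in> {1..n}" "j \<in> {1..n}" "dot n (\<alpha> i) (\<alpha> j) = -1" shows "act_reduced [i, j, i]"
proof (rule act_reduced_ConsI)
  have "i \<noteq> j" using assms by (auto simp: simple_root_norm)
  then show "act_reduced [j, i]" using act_reduced_2 assms by auto
  show "height n (act n (rev [j, i]) (\<alpha> i)) > 0"
    using assms by (simp add: height_reflection dot_reflection_left height_simple_root simple_root_norm dot_commute [of n "\<alpha> j"])
qed (use assms in auto)

end

context D_group
begin

lemma root_sigma_conj_reflection:
  assumes v: "v \<in> D_roots n" and i: "i \<in> {1..n}" and t: "t \<in> T"
  shows "rt R v (\<sigma> i ** t ** matrix_inv (\<sigma> i)) = rt R (reflection n (\<alpha> i) v) t"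
proof -
  obtain x where x: "\<And>k. x k \<noteq> 0" "t = \<tau> x" using tau_surj [OF t] by blast
  have "rt R v t * rt R (\<alpha> i) t powi (- dot n v (\<alpha> i)) =
     (\<Prod>k=1..n. x k powi dot n v (\<alpha> k) * (x k powi dot n (\<alpha> i) (\<alpha> k)) powi (- dot n v (\<alpha> i)))"
    using x v i by (simp add: root_tau simple_root_root power_int_prod prod.distrib)
  also have "\<dots> = (\<Prod>k=1..n. x k powi dot n (reflection n (\<alpha> i) v) (\<alpha> k))"
    by (rule prod.cong)
      (simp_all add: dot_reflection_left power_int_mult [symmetric] power_int_add [symmetric] x(1) mult.commute)
  also have "\<dots> = rt R (reflection n (\<alpha> i) v) t"
    unfolding x(2) by (rule root_tau [symmetric]) (use v i x(1) in \<open>simp_all add: reflection_D_roots simple_root_root\<close>)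
  finally show ?thesis by (simp only: root_sigma_conj [OF v i t])
qed

abbreviation "P \<equiv> mat_prod \<sigma>"

lemma P_N: "set is \<subseteq> {1..n} \<Longrightarrow> P is \<in> N"
  by (induction "is") (simp_all add: T_N T_one N_mult sigma_simple_N)

text \<open>The word is reversed because elements of the normalizer act on characters by composition from the
  right.\<close>

lemma root_P_conj:
  "set is \<subseteq> {1..n} \<Longrightarrow> v \<in> D_roots n \<Longrightarrow> t \<in> T \<Longrightarrow>
     rt R v (P is ** t ** matrix_inv (P is)) = rt R (act n (rev is) v) t"
proof (induction "is" arbitrary: v)
  case Nil
  then show ?case by (simp add: matrix_inv_one)
next
  case (Cons i "is")
  then have i: "i \<in> {1..n}" and sub: "set is \<subseteq> {1..n}" by simp_all
  have "rt R v (P (i # is) ** t ** matrix_inv (P (i # is))) =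
      rt R v (\<sigma> i ** (P is ** t ** matrix_inv (P is)) ** matrix_inv (\<sigma> i))"
    using i sub by (simp add: conj_conj N_GL sigma_simple_N P_N)
  also have "\<dots> = rt R (reflection n (\<alpha> i) v) (P is ** t ** matrix_inv (P is))"
    using Cons.prems i sub by (simp add: root_sigma_conj_reflection N_conj P_N)
  also have "\<dots> = rt R (act n (rev (i # is)) v) t"
    using Cons.prems i sub by (simp add: Cons.IH reflection_D_roots simple_root_root act_append)
  finally show ?case .
qed

lemma T_normal: "T \<lhd> mat_group N"
proof -
  have g: "group (mat_group N)" by (rule subgroup_GL_group [OF N_subgroup])
  have "subgroup T (mat_group N)"
    by (rule group.subgroupI [OF g])
      (use T_N T_one in \<open>auto simp: T_mult subgroup_GL_m_inv [OF N_subgroup] T_inv\<close>)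
  then show ?thesis
    by (simp add: group.normal_inv_iff [OF g] subgroup_GL_m_inv [OF N_subgroup] N_conj)
qed

lemma proj_def': "proj R g = {t ** g |t. t \<in> T}"
  by (auto simp: proj_def r_coset_def)

lemma proj_eq_iff: "proj R g = proj R g' \<longleftrightarrow> (\<exists>t\<in>T. g = t ** g')"
proof
  assume "proj R g = proj R g'"
  moreover have "g \<in> proj R g" unfolding proj_def' using T_one by force
  ultimately show "\<exists>t\<in>T. g = t ** g'" by (auto simp: proj_def')
next
  assume "\<exists>t\<in>T. g = t ** g'"
  then obtain s where s: "s \<in> T" "g = s ** g'" by blast
  have "t ** g \<in> proj R g'" if "t \<in> T" for t
    unfolding proj_def' using s T_mult [OF that s(1)] by (auto simp: matrix_mul_assoc)
  moreover have "t ** g' \<in> proj R g" if "t \<in> T" for t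
  proof -
    have "t ** g' = (t ** matrix_inv s) ** g"
      using s by (simp add: matrix_mul_assoc [symmetric] GL_cancel_left T_GL)
    then show ?thesis unfolding proj_def' using T_mult [OF that T_inv [OF s(1)]] by blast
  qed
  ultimately show "proj R g = proj R g'" by (auto simp: proj_def' [of g] proj_def' [of g'])
qed

lemma weyl_carrier: "carrier (weyl R) = proj R ` N"
  by (auto simp: weyl_def FactGroup_def RCOSETS_def proj_def)

lemma weyl_mult: "g \<in> N \<Longrightarrow> g' \<in> N \<Longrightarrow> proj R g \<otimes>\<^bsub>weyl R\<^esub> proj R g' = proj R (g ** g')"
  using normal.rcos_sum [OF T_normal, of g g'] by (simp add: weyl_def FactGroup_def proj_def)

lemma weyl_one: "\<one>\<^bsub>weyl R\<^esub> = proj R (mat 1)"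
  by (simp add: weyl_def FactGroup_def proj_def')

lemma weyl_group: "group (weyl R)"
  unfolding weyl_def by (rule normal.factorgroup_is_group [OF T_normal])

lemma word_val_P: "set is \<subseteq> {1..n} \<Longrightarrow> word_val n R is = proj R (P is)"
proof (induction "is")
  case Nil
  then show ?case by (simp add: word_val_def weyl_one)
next
  case (Cons i "is")
  have "word_val n R (i # is) = simple_refl n R i \<otimes>\<^bsub>weyl R\<^esub> word_val n R is" by (simp add: word_val_def)
  with Cons show ?case by (simp add: simple_refl_def weyl_mult sigma_simple_N P_N)
qed

lemma word_val_singleton: "i \<in> {1..n} \<Longrightarrow> word_val n R [i] = simple_refl n R i"
  by (simp add: word_val_P simple_refl_def)

text \<open>The torus is commutative, so a class in \<open>N/T\<close> acts on it, and distinct roots are distinct characters.\<close>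

lemma word_val_imp_same_act:
  assumes sub: "set is \<subseteq> {1..n}" "set js \<subseteq> {1..n}" and eq: "word_val n R is = word_val n R js"
  shows "same_act is js"
proof -
  obtain s where s: "s \<in> T" "P is = s ** P js"
    using eq sub by (auto simp: word_val_P proj_eq_iff)
  have "same_act (rev is) (rev js)"
    unfolding same_act_def
  proof
    fix v assume v: "v \<in> D_roots n"
    have D: "act n (rev is) v \<in> D_roots n" "act n (rev js) v \<in> D_roots n"
      using sub v by (simp_all add: act_D_roots)
    have "rt R (act n (rev is) v) t = rt R (act n (rev js) v) t" if t: "t \<in> T" for t
    proof -
      have T': "P js ** t ** matrix_inv (P js) \<in> T" using sub t by (simp add: N_conj P_N)
      have "P is ** t ** matrix_inv (P is) = s ** (P js ** t ** matrix_inv (P js)) ** matrix_inv s"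
        unfolding s(2) by (rule conj_conj) (use sub s(1) in \<open>simp_all add: T_GL N_GL P_N\<close>)
      also have "\<dots> = P js ** t ** matrix_inv (P js)"
        by (simp add: T_commute [OF s(1) T'] GL_cancel_right T_GL [OF s(1)])
      finally show ?thesis using root_P_conj [OF sub(1) v t] root_P_conj [OF sub(2) v t] by simp
    qed
    moreover have "rt R (act n (rev is) v) \<in> extensional T" "rt R (act n (rev js) v) \<in> extensional T"
      using root_character [OF D(1)] root_character [OF D(2)] by (simp_all add: characters_def)
    ultimately have "rt R (act n (rev is) v) = rt R (act n (rev js) v)"
      by (intro extensionalityI) auto
    then show "act n (rev is) v = act n (rev js) v"
      using bij_betw_imp_inj_on [OF typ_D [unfolded type_D_def, THEN conjunct1]] D by (simp add: inj_on_eq_iff)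
  qed
  from same_act_rev [OF this] sub show ?thesis by simp
qed

text \<open>Prepending a letter \<open>i\<close> to a reduced word either leaves it reduced, or the element has a reduced
  word \<open>i # u\<close>, with the same product by Matsumoto's theorem, and \<open>\<sigma>\<^sub>i\<^sup>2 \<in> T\<close> cancels.\<close>

lemma reduce_word:
  "set is \<subseteq> {1..n} \<Longrightarrow> \<exists>js. act_reduced js \<and> word_val n R is = word_val n R js"
proof (induction "is")
  case Nil
  then show ?case using act_reduced_Nil by blast
next
  case (Cons i "is")
  then have i: "i \<in> {1..n}" and sub: "set is \<subseteq> {1..n}" by simp_all
  from Cons obtain js where js: "act_reduced js" "word_val n R is = word_val n R js" by auto
  have sj: "set js \<subseteq> {1..n}" using js by (simp add: act_reduced_def)
  have eq: "word_val n R (i # is) = word_val n R (i # js)" using js by (simp add: word_val_def)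
  have "height n (act n (rev js) (\<alpha> i)) \<noteq> 0"
    using i sj by (intro height_nonzero act_D_roots simple_root_root) auto
  then consider "height n (act n (rev js) (\<alpha> i)) > 0" | "height n (act n (rev js) (\<alpha> i)) < 0" by linarith
  then show ?case
  proof cases
    case 1
    then show ?thesis using act_reduced_ConsI [OF js(1) i] eq by blast
  next
    case 2
    then obtain u where u: "act_reduced (i # u)" "same_act js (i # u)" using descent_word js(1) i by blast
    have su: "set u \<subseteq> {1..n}" using u by (simp add: act_reduced_def)
    have "P js = P (i # u)" using matsumoto [OF sigma_braid js(1) u(1) u(2)] .
    then have "P (i # js) = h i (- 1) ** P u"
      using i by (simp add: matrix_mul_assoc sigma_square)
    then have "word_val n R (i # js) = word_val n R u"
      using i sj su h_in [OF i, of "- 1"] by (auto simp: word_val_P proj_eq_iff simp del: mat_prod_Cons)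
    then show ?thesis using eq act_reduced_Cons_D [OF u(1)] by metis
  qed
qed

text \<open>Faithfulness of \<open>N/T\<close> on the roots: replace both words by reduced ones and use Matsumoto's theorem.
  Consequently the reduced words in \<open>N/T\<close> are those of the reflection group.\<close>

theorem word_val_eq_iff:
  assumes "set is \<subseteq> {1..n}" "set js \<subseteq> {1..n}"
  shows "word_val n R is = word_val n R js \<longleftrightarrow> same_act is js"
proof
  assume same: "same_act is js"
  obtain is' js' where r: "act_reduced is'" "word_val n R is = word_val n R is'"
     "act_reduced js'" "word_val n R js = word_val n R js'"
    using reduce_word assms by metis
  have sub: "set is' \<subseteq> {1..n}" "set js' \<subseteq> {1..n}" using r by (simp_all add: act_reduced_def)
  have "same_act is is'" "same_act js js'" using word_val_imp_same_act r assms sub by blast+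
  then have "same_act is' js'" using same by (meson same_act_sym same_act_trans)
  then have "P is' = P js'" using matsumoto [OF sigma_braid] r by blast
  then show "word_val n R is = word_val n R js" using r sub by (simp add: word_val_P)
qed (rule word_val_imp_same_act [OF assms])

lemma reduced_word_iff: "reduced_word n R is \<longleftrightarrow> act_reduced is"
proof
  assume r: "reduced_word n R is"
  then have s: "set is \<subseteq> {1..n}" by (simp add: reduced_word_def)
  show "act_reduced is"
    unfolding act_reduced_def
  proof (intro conjI allI impI s)
    fix js assume js: "set js \<subseteq> {1..n}" "same_act is js"
    then have "word_val n R js = word_val n R is" using word_val_eq_iff [OF s js(1)] by simp
    then show "length is \<le> length js" using r js(1) unfolding reduced_word_def by blast
  qed
next
  assume r: "act_reduced is"
  then have s: "set is \<subseteq> {1..n}" by (simp add: act_reduced_def)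
  show "reduced_word n R is"
    unfolding reduced_word_def
  proof (intro conjI allI impI s)
    fix js assume js: "set js \<subseteq> {1..n} \<and> word_val n R js = word_val n R is"
    then have "same_act is js" using word_val_imp_same_act s by metis
    then show "length is \<le> length js" using r js unfolding act_reduced_def by blast
  qed
qed

end

locale D_weyl = D_group +
  assumes wg: "weyl_generated n R"
begin

lemma weyl_element_word:
  assumes "w \<in> carrier (weyl R)" shows "\<exists>is. set is \<subseteq> {1..n} \<and> word_val n R is = w"
proof -
  have "w \<in> generate (weyl R) (simple_refl n R ` {1..n})" using assms wg by (simp add: weyl_generated_def)
  then show ?thesis
  proof induction
    case one
    then show ?case by (intro exI [of _ "[]"]) (simp add: word_val_def)
  next
    case (incl w)
    then obtain i where "i \<in> {1..n}" "w = simple_refl n R i" by blast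
    then show ?case by (intro exI [of _ "[i]"]) (simp add: word_val_singleton)
  next
    case (inv w)
    then obtain i where i: "i \<in> {1..n}" "w = simple_refl n R i" by blast
    have wc: "w \<in> carrier (weyl R)" using i by (simp add: simple_refl_def weyl_carrier sigma_simple_N)
    have "w \<otimes>\<^bsub>weyl R\<^esub> w = proj R (h i (- 1))"
      using i by (simp add: simple_refl_def weyl_mult sigma_simple_N sigma_square)
    also have "\<dots> = \<one>\<^bsub>weyl R\<^esub>" using h_in [OF i(1), of "- 1"] by (auto simp: weyl_one proj_eq_iff)
    finally have "inv\<^bsub>weyl R\<^esub> w = w" using group.inv_equality [OF weyl_group _ wc wc] by simp
    then show ?case using i by (intro exI [of _ "[i]"]) (simp add: word_val_singleton)
  next
    case (eng w w')
    then obtain u u' where u: "set u \<subseteq> {1..n}" "word_val n R u = w" "set u' \<subseteq> {1..n}" "word_val n R u' = w'"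
      by blast
    then have "word_val n R (u @ u') = w \<otimes>\<^bsub>weyl R\<^esub> w'"
      by (auto simp: word_val_P mat_prod_append weyl_mult P_N)
    then show ?case using u by (intro exI [of _ "u @ u'"]) simp
  qed
qed

lemma weyl_reduced_word:
  assumes "w \<in> carrier (weyl R)" shows "\<exists>is. act_reduced is \<and> word_val n R is = w"
  using weyl_element_word [OF assms] reduce_word by metis

lemma simple_refl_weyl: "i \<in> {1..n} \<Longrightarrow> simple_refl n R i \<in> carrier (weyl R)"
  by (simp add: simple_refl_def weyl_carrier sigma_simple_N)

section \<open>Sections of the Weyl group\<close>

text \<open>The existence of the Tits section: by Matsumoto's theorem the product of the \<open>\<sigma>\<^sub>i\<close> along a
  reduced word depends only on the Weyl group element.\<close>

theorem tits_section_exists: "\<exists>S. tits_section n R S"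
proof
  define rw where "rw w = (SOME is. act_reduced is \<and> word_val n R is = w)" for w
  have rw: "act_reduced (rw w)" "word_val n R (rw w) = w" if "w \<in> carrier (weyl R)" for w
    using someI_ex [OF weyl_reduced_word [OF that]] by (simp_all add: rw_def)
  define S where "S w = P (rw w)" for w
  have S: "S w \<in> N \<and> proj R (S w) = w" if "w \<in> carrier (weyl R)" for w
  proof -
    have sub: "set (rw w) \<subseteq> {1..n}" using rw [OF that] by (simp add: act_reduced_def)
    then show ?thesis using rw [OF that] by (simp add: S_def P_N word_val_P)
  qed
  have SP: "S (word_val n R is) = P is" if r: "act_reduced is" for "is"
  proof -
    have sub: "set is \<subseteq> {1..n}" using r by (simp add: act_reduced_def)
    have wc: "word_val n R is \<in> carrier (weyl R)" using sub by (simp add: word_val_P weyl_carrier P_N)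
    have "set (rw (word_val n R is)) \<subseteq> {1..n}" using rw [OF wc] by (simp add: act_reduced_def)
    then have "same_act (rw (word_val n R is)) is"
      using word_val_imp_same_act rw(2) [OF wc] sub by blast
    then show ?thesis unfolding S_def using matsumoto [OF sigma_braid rw(1) [OF wc] r] by blast
  qed
  have Si: "S (simple_refl n R i) = \<sigma> i" if "i \<in> {1..n}" for i
    using SP [OF act_reduced_1 [OF that]] that by (simp add: word_val_singleton)
  have "mat_prod (\<lambda>i. S (simple_refl n R i)) is = P is" if "act_reduced is" for "is"
    by (rule mat_prod_cong, rule Si) (use that in \<open>auto simp: act_reduced_def\<close>)
  then show "tits_section n R S"
    using S SP Si unfolding tits_section_def weyl_section_def reduced_word_iff by simp
qed

context
  fixes S
  assumes S: "weyl_section n R S"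
begin

abbreviation "s i \<equiv> S (simple_refl n R i)"

lemma section_simple_N: "i \<in> {1..n} \<Longrightarrow> s i \<in> N"
  using S simple_refl_weyl by (simp add: weyl_section_def)

lemma section_simple:
  assumes "i \<in> {1..n}" shows "\<exists>t\<in>T. s i = t ** \<sigma> i"
proof -
  have "proj R (s i) = proj R (\<sigma> i)"
    using S simple_refl_weyl [OF assms] by (simp add: weyl_section_def) (simp add: simple_refl_def)
  then show ?thesis by (simp add: proj_eq_iff)
qed

lemma section_word: "act_reduced is \<Longrightarrow> S (word_val n R is) = mat_prod s is"
  using S by (simp add: weyl_section_def reduced_word_iff)

text \<open>The two sides of a braid relation are reduced words of the same element.\<close>

lemma section_braid: "braid_relations s"
  unfolding braid_relations_def
proof (intro ballI conjI impI)
  fix i j assume i: "i \<in> {1..n}" and j: "j \<in> {1..n}"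
  show "s i ** s j = s j ** s i" if orth: "dot n (\<alpha> i) (\<alpha> j) = 0"
  proof -
    have ne: "i \<noteq> j" using orth i by (auto simp: simple_root_norm)
    have "word_val n R [i, j] = word_val n R [j, i]"
      using i j same_act_commute [OF i j orth] by (subst word_val_eq_iff) auto
    then have "mat_prod s [i, j] = mat_prod s [j, i]"
      using section_word [OF act_reduced_2 [OF i j ne]] section_word [OF act_reduced_2 [OF j i ne [symmetric]]] by simp
    then show ?thesis by simp
  qed
  show "s i ** s j ** s i = s j ** s i ** s j" if adj: "dot n (\<alpha> i) (\<alpha> j) = -1"
  proof -
    have adj': "dot n (\<alpha> j) (\<alpha> i) = -1" using adj by (simp add: dot_commute)
    have "word_val n R [i, j, i] = word_val n R [j, i, j]"
      using i j same_act_braid [OF i j adj] by (subst word_val_eq_iff) auto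
    then have "mat_prod s [i, j, i] = mat_prod s [j, i, j]"
      using section_word [OF act_reduced_3 [OF i j adj]] section_word [OF act_reduced_3 [OF j i adj']] by simp
    then show ?thesis by (simp add: matrix_mul_assoc)
  qed
qed

end

end

section \<open>Lifts of the simple reflections satisfying the braid relations\<close>

lemma power_involution:
  fixes a :: "'b::monoid_mult"
  assumes "a ^ 2 = 1" shows "a ^ k = (if odd k then a else 1)"
proof (cases "odd k")
  case True
  then obtain l where "k = 2 * l + 1" by (rule oddE)
  then show ?thesis using assms by (simp add: power_add power_mult)
next
  case False
  then obtain l where "k = 2 * l" by (auto elim: evenE)
  then show ?thesis using assms by (simp add: power_mult)
qed

context type_D_system
begin

text \<open>The edges of the Dynkin diagram, with the smaller node first.\<close>

definition linked :: "nat \<Rightarrow> nat \<Rightarrow> bool" where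
  "linked i j \<longleftrightarrow> (j = i + 1 \<and> j < n) \<or> (i = n - 2 \<and> j = n)"

lemma cartan_matrix:
  assumes "i \<in> {1..n}" "j \<in> {1..n}"
  shows "dot n (\<alpha> i) (\<alpha> j) = (if i = j then 2 else if linked i j \<or> linked j i then -1 else 0)"
  using assms n_ge
  by (cases "i < n"; cases "j < n"; subst dot_simple_root_right)
    (auto simp: linked_def simple_root_def unit_vec_def)

lemma linked_cartan:
  assumes "linked i j" "1 \<le> i" "j \<le> n"
  shows "i \<in> {1..n}" "j \<in> {1..n}" "dot n (\<alpha> i) (\<alpha> j) = -1" "dot n (\<alpha> j) (\<alpha> i) = -1"
proof -
  show ij: "i \<in> {1..n}" "j \<in> {1..n}" using assms n_ge by (auto simp: linked_def)
  have "i \<noteq> j" using assms n_ge by (auto simp: linked_def)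
  then show "dot n (\<alpha> i) (\<alpha> j) = -1" "dot n (\<alpha> j) (\<alpha> i) = -1"
    using cartan_matrix [OF ij] cartan_matrix [OF ij(2,1)] assms by auto
qed

end

context D_group
begin

lemma T_cancel_left: "s \<in> T \<Longrightarrow> s ** a = s ** b \<Longrightarrow> a = b"
  by (metis GL_cancel_left(1) T_GL)

lemma sigma_move:
  assumes "i \<in> {1..n}" "t \<in> T"
  shows "\<sigma> i ** t = t ** h i (inverse (rt R (\<alpha> i) t)) ** \<sigma> i"
proof -
  have "\<sigma> i ** t = \<sigma> i ** t ** matrix_inv (\<sigma> i) ** \<sigma> i"
    using assms by (simp add: GL_cancel_right N_GL sigma_simple_N)
  then show ?thesis by (simp only: sigma_simple_conj [OF assms])
qed

lemma h_eq_h: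
  assumes "i \<in> {1..n}" "j \<in> {1..n}" "i \<noteq> j" "x \<noteq> 0" "y \<noteq> 0" "h i x = h j y"
  shows "x = 1" "y = 1"
proof -
  have "h i x ** h j (inverse y) = mat 1" using assms by (simp add: h_mult h_one)
  from h_independent [OF assms(1-4) _ this] assms(5) show "x = 1" "y = 1" by simp_all
qed

context
  fixes t :: "nat \<Rightarrow> 'a^'m^'m"
  assumes braid: "braid_relations (\<lambda>i. t i ** \<sigma> i)"
    and t_T: "\<And>i. i \<in> {1..n} \<Longrightarrow> t i \<in> T"
begin

definition pairing :: "nat \<Rightarrow> nat \<Rightarrow> 'a" where "pairing i j = rt R (\<alpha> j) (t i)"

lemma pairing_nonzero: "i \<in> {1..n} \<Longrightarrow> j \<in> {1..n} \<Longrightarrow> pairing i j \<noteq> 0"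
  by (simp add: pairing_def root_nonzero simple_root_root t_T)

text \<open>Moving the torus parts to the left of \<open>\<sigma>\<^sub>i \<sigma>\<^sub>j\<close> turns the commutation of \<open>t\<^sub>i \<sigma>\<^sub>i\<close> and
  \<open>t\<^sub>j \<sigma>\<^sub>j\<close> into an equality between values of \<open>\<alpha>\<^sub>i\<^sup>\<or>\<close> and \<open>\<alpha>\<^sub>j\<^sup>\<or>\<close>, which are independent.\<close>

lemma pairing_orthogonal:
  assumes i: "i \<in> {1..n}" and j: "j \<in> {1..n}" and orth: "dot n (\<alpha> i) (\<alpha> j) = 0"
  shows "pairing i j = 1"
proof -
  have ne: "i \<noteq> j" using orth i by (auto simp: simple_root_norm)
  have nz: "pairing i j \<noteq> 0" "pairing j i \<noteq> 0" using i j by (simp_all add: pairing_nonzero)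
  have hT: "h i (inverse (pairing j i)) \<in> T" "h j (inverse (pairing i j)) \<in> T"
    using i j nz by (simp_all add: h_in)
  have move: "t k ** \<sigma> k ** (t l ** \<sigma> l) = t k ** (t l ** h k (inverse (pairing l k))) ** (\<sigma> k ** \<sigma> l)"
    if "k \<in> {1..n}" "l \<in> {1..n}" for k l
    using sigma_move [OF that(1) t_T [OF that(2)]] by (simp add: matrix_mul_assoc [symmetric] pairing_def)
      (simp add: matrix_mul_assoc)
  have comm: "\<sigma> i ** \<sigma> j = \<sigma> j ** \<sigma> i" using sigma_braid i j orth unfolding braid_relations_def by blast
  have "t i ** \<sigma> i ** (t j ** \<sigma> j) = t j ** \<sigma> j ** (t i ** \<sigma> i)"
    using braid i j orth unfolding braid_relations_def by blast
  then have "t i ** (t j ** h i (inverse (pairing j i))) ** (\<sigma> i ** \<sigma> j) =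
      t j ** (t i ** h j (inverse (pairing i j))) ** (\<sigma> i ** \<sigma> j)"
    unfolding move [OF i j] move [OF j i] comm .
  moreover have "\<sigma> i ** \<sigma> j \<in> GL" using i j by (simp add: GL_mult_closed N_GL sigma_simple_N)
  ultimately have "t i ** (t j ** h i (inverse (pairing j i))) = t j ** (t i ** h j (inverse (pairing i j)))"
    by (metis GL_cancel_right(1))
  also have "\<dots> = t i ** (t j ** h j (inverse (pairing i j)))"
    by (rule T_left_commute [OF t_T [OF j] t_T [OF i]])
  finally have "h i (inverse (pairing j i)) = h j (inverse (pairing i j))"
    using T_cancel_left t_T i j by metis
  from h_eq_h(2) [OF i j ne _ _ this] nz show ?thesis by simp
qed

text \<open>Again all torus parts are moved to the left of \<open>\<sigma>\<^sub>i \<sigma>\<^sub>j \<sigma>\<^sub>i\<close>; the factor \<open>c\<close> common to both sides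
  cancels. The lemmas \<open>pairing_edge\<close> and \<open>pairing_two_edges\<close> evaluate the result at \<open>\<alpha>\<^sub>i\<close> and at a further neighbour \<open>\<alpha>\<^sub>k\<close> of
  \<open>\<alpha>\<^sub>i\<close>.\<close>

lemma braid_torus_part:
  assumes i: "i \<in> {1..n}" and j: "j \<in> {1..n}" and adj: "dot n (\<alpha> i) (\<alpha> j) = -1"
  shows "t i ** h i (inverse (pairing i i * pairing i j)) = t j ** h j (inverse (pairing j j * pairing j i))"
proof -
  have adj': "dot n (\<alpha> j) (\<alpha> i) = -1" using adj by (simp add: dot_commute)
  have main: "t k ** \<sigma> k ** (t l ** \<sigma> l) ** (t k ** \<sigma> k) =
      (t k ** t l ** h k (inverse (pairing l k)) ** h l (inverse (pairing k l))) **
      (t k ** h k (inverse (pairing k k * pairing k l))) ** (\<sigma> k ** \<sigma> l ** \<sigma> k)"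
    if k: "k \<in> {1..n}" and l: "l \<in> {1..n}" and kl: "dot n (\<alpha> k) (\<alpha> l) = -1" for k l
  proof -
    have nz: "pairing k l \<noteq> 0" "pairing l k \<noteq> 0" "pairing k k \<noteq> 0" using k l by (simp_all add: pairing_nonzero)
    define s where "s = t k ** h l (inverse (pairing k l))"
    have sT: "s \<in> T" using k l nz by (simp add: s_def T_mult t_T h_in)
    have rs: "rt R (\<alpha> k) s = pairing k k * pairing k l"
      using k l nz kl by (simp add: s_def root_mult simple_root_root t_T h_in root_h pairing_def power_int_minus)
    have 1: "\<sigma> l ** t k = s ** \<sigma> l"
      using sigma_move [OF l t_T [OF k]] by (simp add: s_def pairing_def)
    have 2: "\<sigma> k ** s = s ** h k (inverse (pairing k k * pairing k l)) ** \<sigma> k"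
      using sigma_move [OF k sT] by (simp only: rs)
    have 3: "\<sigma> k ** t l = t l ** h k (inverse (pairing l k)) ** \<sigma> k"
      using sigma_move [OF k t_T [OF l]] by (simp add: pairing_def)
    have "t k ** \<sigma> k ** (t l ** \<sigma> l) ** (t k ** \<sigma> k) = t k ** (\<sigma> k ** t l) ** (\<sigma> l ** t k) ** \<sigma> k"
      by (simp add: matrix_mul_assoc)
    also have "\<dots> = t k ** (t l ** h k (inverse (pairing l k))) ** (\<sigma> k ** s) ** \<sigma> l ** \<sigma> k"
      by (simp add: 1 3 matrix_mul_assoc)
    also have "\<dots> = t k ** t l ** h k (inverse (pairing l k)) **
        (s ** h k (inverse (pairing k k * pairing k l))) ** (\<sigma> k ** \<sigma> l ** \<sigma> k)"
      by (simp add: 2 matrix_mul_assoc)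
    also have "s ** h k (inverse (pairing k k * pairing k l)) =
        h l (inverse (pairing k l)) ** (t k ** h k (inverse (pairing k k * pairing k l)))"
    proof -
      have "t k ** h l (inverse (pairing k l)) = h l (inverse (pairing k l)) ** t k"
        by (rule T_commute) (use k l nz in \<open>simp_all add: t_T h_in\<close>)
      then show ?thesis by (simp only: s_def matrix_mul_assoc)
    qed
    finally show ?thesis by (simp add: matrix_mul_assoc)
  qed
  have nz: "pairing i j \<noteq> 0" "pairing j i \<noteq> 0" using i j by (simp_all add: pairing_nonzero)
  define c where "c = t i ** t j ** h i (inverse (pairing j i)) ** h j (inverse (pairing i j))"
  have c: "c = t j ** t i ** h j (inverse (pairing i j)) ** h i (inverse (pairing j i))"
  proof -
    have "t i ** t j = t j ** t i" by (rule T_commute [OF t_T [OF i] t_T [OF j]])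
    moreover have "h i (inverse (pairing j i)) ** h j (inverse (pairing i j)) =
        h j (inverse (pairing i j)) ** h i (inverse (pairing j i))"
      by (rule T_commute) (use i j nz in \<open>simp_all add: h_in\<close>)
    ultimately show ?thesis unfolding c_def by (metis matrix_mul_assoc)
  qed
  have cT: "c \<in> T" using i j nz by (simp add: c_def T_mult t_T h_in)
  have comm: "\<sigma> j ** \<sigma> i ** \<sigma> j = \<sigma> i ** \<sigma> j ** \<sigma> i"
    using sigma_braid i j adj unfolding braid_relations_def by metis
  have "t i ** \<sigma> i ** (t j ** \<sigma> j) ** (t i ** \<sigma> i) = t j ** \<sigma> j ** (t i ** \<sigma> i) ** (t j ** \<sigma> j)"
    using braid i j adj unfolding braid_relations_def by blast
  then have "c ** (t i ** h i (inverse (pairing i i * pairing i j))) ** (\<sigma> i ** \<sigma> j ** \<sigma> i) =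
     c ** (t j ** h j (inverse (pairing j j * pairing j i))) ** (\<sigma> i ** \<sigma> j ** \<sigma> i)"
    unfolding main [OF i j adj] main [OF j i adj'] comm c_def [symmetric] c [symmetric] .
  moreover have "\<sigma> i ** \<sigma> j ** \<sigma> i \<in> GL" using i j by (simp add: GL_mult_closed N_GL sigma_simple_N)
  ultimately have "c ** (t i ** h i (inverse (pairing i i * pairing i j))) =
     c ** (t j ** h j (inverse (pairing j j * pairing j i)))" by (metis GL_cancel_right(1))
  then show ?thesis by (rule T_cancel_left [OF cT])
qed

lemma root_torus_h:
  assumes "i \<in> {1..n}" "k \<in> {1..n}" "x \<noteq> 0"
  shows "rt R (\<alpha> k) (t i ** h i x) = pairing i k * x powi dot n (\<alpha> k) (\<alpha> i)"
  using assms by (simp add: root_mult simple_root_root t_T h_in root_h pairing_def)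

lemma pairing_edge:
  assumes i: "i \<in> {1..n}" and j: "j \<in> {1..n}" and adj: "dot n (\<alpha> i) (\<alpha> j) = -1"
  shows "(pairing i i * pairing i j ^ 2) * (pairing j j * pairing j i ^ 2) = 1"
proof -
  have nz: "pairing i j \<noteq> 0" "pairing j i \<noteq> 0" "pairing i i \<noteq> 0" "pairing j j \<noteq> 0"
    using i j by (simp_all add: pairing_nonzero)
  have "rt R (\<alpha> i) (t i ** h i (inverse (pairing i i * pairing i j))) =
      rt R (\<alpha> i) (t j ** h j (inverse (pairing j j * pairing j i)))"
    by (simp only: braid_torus_part [OF i j adj])
  then have "pairing i i * inverse (pairing i i * pairing i j) ^ 2 = pairing j i * (pairing j j * pairing j i)"
    using i j nz by (subst (asm) (1 2) root_torus_h) (simp_all add: simple_root_norm adj power_int_minus)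
  then show ?thesis using nz by (simp add: field_simps power2_eq_square)
qed

lemma pairing_two_edges:
  assumes ijk: "i \<in> {1..n}" "j \<in> {1..n}" "k \<in> {1..n}"
    and adj: "dot n (\<alpha> i) (\<alpha> j) = -1" "dot n (\<alpha> i) (\<alpha> k) = -1" and orth: "dot n (\<alpha> j) (\<alpha> k) = 0"
  shows "pairing i k * pairing i i * pairing i j = 1"
proof -
  have nz: "pairing i j \<noteq> 0" "pairing j i \<noteq> 0" "pairing i i \<noteq> 0" "pairing j j \<noteq> 0"
    using ijk by (simp_all add: pairing_nonzero)
  have "rt R (\<alpha> k) (t i ** h i (inverse (pairing i i * pairing i j))) =
      rt R (\<alpha> k) (t j ** h j (inverse (pairing j j * pairing j i)))"
    by (simp only: braid_torus_part [OF ijk(1,2) adj(1)])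
  then show ?thesis
    using ijk nz pairing_orthogonal [OF ijk(2,3) orth]
    by (subst (asm) (1 2) root_torus_h)
      (simp_all add: dot_commute [of n "\<alpha> k"] adj orth power_int_minus mult.assoc)
qed

text \<open>Together with \<open>pairing_orthogonal\<close> this says that all simple roots are trivial on
  \<open>t\<^sub>i \<alpha>\<^sub>i\<^sup>\<or>(p)\<close>.\<close>

definition balanced :: "nat \<Rightarrow> 'a \<Rightarrow> bool" where
  "balanced i p \<longleftrightarrow> pairing i i * p ^ 2 = 1 \<and>
     (\<forall>j\<in>{1..n}. linked i j \<or> linked j i \<longrightarrow> pairing i j = p)"

text \<open>At the branch node any two of the three neighbours are related by \<open>pairing_two_edges\<close>, which forces
  the three values to agree. From there \<open>pairing_edge\<close> and \<open>pairing_two_edges\<close> propagate the property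
  along the diagram.\<close>

lemma balanced_branch: "balanced (n - 2) (pairing (n - 2) n)"
proof -
  have nodes: "n - 2 \<in> {1..n}" "n - 3 \<in> {1..n}" "n - 1 \<in> {1..n}" "n \<in> {1..n}" using n_ge by auto
  have edges: "dot n (\<alpha> (n - 2)) (\<alpha> (n - 3)) = -1" "dot n (\<alpha> (n - 2)) (\<alpha> (n - 1)) = -1"
    "dot n (\<alpha> (n - 2)) (\<alpha> n) = -1" "dot n (\<alpha> (n - 3)) (\<alpha> n) = 0" "dot n (\<alpha> (n - 1)) (\<alpha> n) = 0"
    "dot n (\<alpha> (n - 3)) (\<alpha> (n - 1)) = 0"
    using n_ge nodes by (subst cartan_matrix; force simp: linked_def)+
  define r a b c where "r = pairing (n - 2) (n - 2)" and "a = pairing (n - 2) (n - 3)"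
    and "b = pairing (n - 2) (n - 1)" and "c = pairing (n - 2) n"
  have e: "c * r * a = 1" "c * r * b = 1" "b * r * a = 1"
    unfolding r_def a_def b_def c_def by (rule pairing_two_edges; use nodes edges in simp)+
  then have nz: "c * r \<noteq> 0" "r * a \<noteq> 0" by auto
  have "(c * r) * a = (c * r) * b" using e by simp
  then have ab: "a = b" using nz by simp
  have "c * (r * a) = b * (r * a)" using e by (simp add: mult.assoc)
  then have bc: "b = c" using nz by simp
  have "j = n - 3 \<or> j = n - 1 \<or> j = n" if "linked (n - 2) j \<or> linked j (n - 2)" for j
    using that n_ge by (auto simp: linked_def)
  then have "pairing (n - 2) j = c" if "linked (n - 2) j \<or> linked j (n - 2)" for j
    using that ab bc a_def b_def c_def by metis
  moreover have "r * c ^ 2 = 1" using e(1) ab bc by (simp add: power2_eq_square mult_ac)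
  ultimately show ?thesis unfolding balanced_def r_def c_def by blast
qed

lemma balanced_end:
  assumes "i \<in> {n - 1, n}" shows "\<exists>p. balanced i p"
proof -
  have nodes: "n - 2 \<in> {1..n}" "i \<in> {1..n}" using n_ge assms by auto
  have adj: "dot n (\<alpha> i) (\<alpha> (n - 2)) = -1"
    using n_ge assms nodes by (subst cartan_matrix) (auto simp: linked_def)
  have "pairing (n - 2) i = pairing (n - 2) n"
  proof -
    have "linked (n - 2) i" using n_ge assms by (auto simp: linked_def)
    then show ?thesis using balanced_branch nodes unfolding balanced_def by blast
  qed
  then have "pairing i i * pairing i (n - 2) ^ 2 = 1"
    using pairing_edge [OF nodes(2,1) adj] balanced_branch by (simp add: balanced_def)
  moreover have "j = n - 2" if "linked i j \<or> linked j i" "j \<in> {1..n}" for j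
    using that assms n_ge by (auto simp: linked_def)
  ultimately have "balanced i (pairing i (n - 2))" unfolding balanced_def by blast
  then show ?thesis by blast
qed

lemma balanced_chain: "k \<le> n - 3 \<Longrightarrow> \<exists>p. balanced (n - 2 - k) p"
proof (induction k)
  case 0
  then show ?case using balanced_branch by auto
next
  case (Suc k)
  define i where "i = n - 2 - Suc k"
  have i: "i \<in> {1..n}" "i + 1 \<in> {1..n}" "n - 2 - k = i + 1" "i + 1 < n"
    using Suc.prems n_ge by (auto simp: i_def)
  have lk: "linked i (i + 1)" using i by (simp add: linked_def)
  note adj = linked_cartan(3) [OF lk]
  have "\<exists>q. balanced (n - 2 - k) q" by (rule Suc.IH) (use Suc.prems in simp)
  then obtain q where q: "balanced (i + 1) q" unfolding i(3) by blast
  then have "pairing (i + 1) (i + 1) * pairing (i + 1) i ^ 2 = 1"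
    using lk i by (auto simp: balanced_def)
  then have 1: "pairing i i * pairing i (i + 1) ^ 2 = 1"
    using pairing_edge [OF i(1,2)] adj i by simp
  have "pairing i j = pairing i (i + 1)" if j: "j \<in> {1..n}" "linked i j \<or> linked j i" for j
  proof (cases "j = i + 1")
    case False
    then have ji: "j + 1 = i" using that i Suc.prems n_ge by (auto simp: linked_def i_def)
    have "dot n (\<alpha> i) (\<alpha> j) = -1" "dot n (\<alpha> (i + 1)) (\<alpha> j) = 0"
      using j i ji Suc.prems n_ge by (subst cartan_matrix; force simp: linked_def i_def)+
    then have "pairing i j * pairing i i * pairing i (i + 1) = 1"
      using pairing_two_edges [OF i(1,2) j(1)] adj i by simp
    then have "pairing i j * (pairing i i * pairing i (i + 1)) = pairing i (i + 1) * (pairing i i * pairing i (i + 1))"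
      using 1 by (simp add: power2_eq_square mult_ac)
    then show ?thesis using pairing_nonzero i by simp
  qed simp
  then have "balanced i (pairing i (i + 1))" using 1 unfolding balanced_def by blast
  then show ?case unfolding i_def by blast
qed

lemma all_balanced:
  assumes "i \<in> {1..n}" shows "\<exists>p. balanced i p"
proof (cases "i \<in> {n - 1, n}")
  case False
  then have "n - 2 - i \<le> n - 3" "n - 2 - (n - 2 - i) = i" using assms n_ge by auto
  then show ?thesis using balanced_chain [of "n - 2 - i"] by simp
qed (rule balanced_end)

text \<open>Being balanced, \<open>t\<^sub>i \<alpha>\<^sub>i\<^sup>\<or>(p\<^sub>i)\<close> is killed by all roots, and it equals the torus element of
  \<open>braid_torus_part\<close> for every edge at \<open>i\<close>. So it is the same for neighbours, and the diagram is
  connected.\<close>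

theorem braid_lift_central:
  "\<exists>z\<in>T. (\<forall>j\<in>{1..n}. rt R (\<alpha> j) z = 1) \<and> (\<forall>i\<in>{1..n}. \<exists>d. d \<noteq> 0 \<and> t i = z ** h i d)"
proof -
  define p where "p i = (SOME p. balanced i p)" for i
  have p: "balanced i (p i)" if "i \<in> {1..n}" for i
    unfolding p_def by (rule someI_ex [OF all_balanced [OF that]])
  have pnz: "p i \<noteq> 0" if "i \<in> {1..n}" for i using p [OF that] by (auto simp: balanced_def)
  define z where "z i = t i ** h i (p i)" for i
  have central: "rt R (\<alpha> j) (z i) = 1" if i: "i \<in> {1..n}" and j: "j \<in> {1..n}" for i j
  proof -
    have eq: "rt R (\<alpha> j) (z i) = pairing i j * p i powi dot n (\<alpha> j) (\<alpha> i)"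
      unfolding z_def by (rule root_torus_h [OF i j pnz [OF i]])
    consider "i = j" | "i \<noteq> j" "linked i j \<or> linked j i" | "i \<noteq> j" "\<not> (linked i j \<or> linked j i)" by blast
    then show ?thesis
    proof cases
      case 1
      then show ?thesis using eq p [OF i] simple_root_norm [OF i] by (simp add: balanced_def)
    next
      case 2
      then have "dot n (\<alpha> j) (\<alpha> i) = -1" using cartan_matrix [OF j i] by auto
      moreover have "pairing i j = p i" using p [OF i] 2 j unfolding balanced_def by blast
      ultimately show ?thesis using eq pnz [OF i] by (simp add: power_int_minus)
    next
      case 3
      then have "dot n (\<alpha> j) (\<alpha> i) = 0" "dot n (\<alpha> i) (\<alpha> j) = 0"
        using cartan_matrix [OF j i] cartan_matrix [OF i j] by auto
      then show ?thesis using eq pairing_orthogonal [OF i j] by simp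
    qed
  qed
  have z_link: "z i = z j" if "linked i j" "1 \<le> i" "j \<le> n" for i j
  proof -
    note ij = linked_cartan [OF that]
    have *: "inverse (pairing k k * pairing k l) = p k" if k: "k \<in> {1..n}" and l: "l \<in> {1..n}"
      and kl: "linked k l \<or> linked l k" for k l
    proof -
      have "pairing k l = p k" "pairing k k * p k ^ 2 = 1" using p [OF k] l kl unfolding balanced_def by blast+
      then show ?thesis by (metis inverse_unique mult.assoc power2_eq_square)
    qed
    show ?thesis
      using braid_torus_part [OF ij(1,2,3)] * [OF ij(1,2)] * [OF ij(2,1)] that unfolding z_def by simp
  qed
  have chain: "z i = z 1" if "1 \<le> i" "i < n" for i
    using that
  proof (induction i rule: dec_induct)
    case (step i)
    then have "z i = z (Suc i)" by (intro z_link) (auto simp: linked_def)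
    with step show ?case by simp
  qed simp
  have zi: "z i = z 1" if "i \<in> {1..n}" for i
  proof (cases "i = n")
    case True
    have "z (n - 2) = z n" using n_ge by (intro z_link) (auto simp: linked_def)
    then show ?thesis using chain [of "n - 2"] n_ge True by simp
  next
    case False
    then have "1 \<le> i" "i < n" using that by auto
    then show ?thesis by (rule chain)
  qed
  have one: "1 \<in> {1..n}" using n_ge by auto
  show ?thesis
  proof (intro bexI [of _ "z 1"] conjI ballI)
    show "z 1 \<in> T" using one pnz by (simp add: z_def T_mult t_T h_in)
    show "rt R (\<alpha> j) (z 1) = 1" if "j \<in> {1..n}" for j using central [OF one that] .
    show "\<exists>d. d \<noteq> 0 \<and> t i = z 1 ** h i d" if i: "i \<in> {1..n}" for i
    proof (intro exI conjI)
      show "inverse (p i) \<noteq> 0" using pnz [OF i] by simp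
      have "z i ** h i (inverse (p i)) = t i ** (h i (p i) ** h i (inverse (p i)))"
        by (simp add: z_def matrix_mul_assoc)
      also have "\<dots> = t i" using i pnz [OF i] by (simp add: h_mult h_one)
      finally show "t i = z 1 ** h i (inverse (p i))" using zi [OF i] by simp
    qed
  qed
qed

end

section \<open>Central torus elements in coordinates\<close>

lemma root_tau_support:
  assumes "i \<in> {1..n}" "\<And>k. x k \<noteq> 0" "S \<subseteq> {1..n}"
    "\<And>k. k \<in> {1..n} \<Longrightarrow> k \<notin> S \<Longrightarrow> i \<noteq> k \<and> \<not> linked i k \<and> \<not> linked k i"
  shows "rt R (\<alpha> i) (\<tau> x) = (\<Prod>k\<in>S. x k powi (if i = k then 2 else if linked i k \<or> linked k i then -1 else 0))"
proof -
  have "rt R (\<alpha> i) (\<tau> x) = (\<Prod>k=1..n. x k powi dot n (\<alpha> i) (\<alpha> k))"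
    using assms by (simp add: root_tau simple_root_root)
  also have "\<dots> = (\<Prod>k\<in>S. x k powi (if i = k then 2 else if linked i k \<or> linked k i then -1 else 0))"
  proof (rule prod.mono_neutral_cong_right)
    show "\<forall>k\<in>{1..n} - S. x k powi dot n (\<alpha> i) (\<alpha> k) = 1"
      using assms(4) cartan_matrix [OF assms(1)] by auto
    show "x k powi dot n (\<alpha> i) (\<alpha> k) =
      x k powi (if i = k then 2 else if linked i k \<or> linked k i then -1 else 0)" if "k \<in> S" for k
      using cartan_matrix [OF assms(1), of k] assms(3) that by auto
  qed (use assms in auto)
  finally show ?thesis .
qed

text \<open>Triviality of \<open>\<alpha>\<^sub>1, \<dots>, \<alpha>\<^sub>n\<^sub>-\<^sub>3\<close> is the recursion for the powers of \<open>x\<^sub>1\<close> along the chain; the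
  remaining three simple roots then determine squares and product of the last two coordinates, and
  comparing these gives \<open>x\<^sub>1\<^sup>2 = 1\<close>.\<close>

lemma central_coordinates:
  assumes x: "\<And>k. x k \<noteq> 0" and *: "\<forall>j\<in>{1..n}. rt R (\<alpha> j) (\<tau> x) = 1"
  shows "x 1 ^ 2 = 1" "\<And>k. 1 \<le> k \<Longrightarrow> k \<le> n - 2 \<Longrightarrow> x k = (if odd k then x 1 else 1)"
    "x (n - 1) * x n = x 1 ^ (n - 1)" "x (n - 1) ^ 2 = x 1 ^ n" "x n ^ 2 = x 1 ^ n"
proof -
  have central: "rt R (\<alpha> j) (\<tau> x) = 1" if "j \<in> {1..n}" for j using * that by blast
  have first: "x 2 = x 1 ^ 2"
  proof -
    have "1 = (\<Prod>k\<in>{1,2}. x k powi (if 1 = k then 2 else if linked 1 k \<or> linked k 1 then -1 else 0))"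
      by (subst central [symmetric, of 1], use n_ge in simp, rule root_tau_support)
        (use x n_ge in \<open>auto simp: linked_def\<close>)
    also have "\<dots> = x 1 ^ 2 * inverse (x 2)" using n_ge by (simp add: linked_def power_int_minus)
    finally show ?thesis using x [of 2] by (simp add: field_simps)
  qed
  have middle: "x (j + 2) * x j = x (j + 1) ^ 2" if "1 \<le> j" "j + 4 \<le> n" for j
  proof -
    have "1 = (\<Prod>k\<in>{j, j + 1, j + 2}. x k powi
        (if j + 1 = k then 2 else if linked (j + 1) k \<or> linked k (j + 1) then -1 else 0))"
      by (subst central [symmetric, of "j + 1"], use that in simp, rule root_tau_support)
        (use x that in \<open>auto simp: linked_def\<close>)
    also have "\<dots> = inverse (x j) * (x (j + 1) ^ 2 * inverse (x (j + 2)))"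
      using that by (simp add: linked_def power_int_minus)
    finally show ?thesis using x [of j] x [of "j + 2"] by (simp add: field_simps)
  qed
  have branch: "x (n - 3) * x (n - 1) * x n = x (n - 2) ^ 2"
  proof -
    have d: "n - 3 \<noteq> n - 2" "n - 3 \<noteq> n - 1" "n - 3 \<noteq> n" "n - 2 \<noteq> n - 1" "n - 2 \<noteq> n" "n - 1 \<noteq> n"
      using n_ge by auto
    have l: "linked (n - 3) (n - 2)" "linked (n - 2) (n - 1)" "linked (n - 2) n"
      using n_ge by (auto simp: linked_def)
    have "1 = (\<Prod>k\<in>{n - 3, n - 2, n - 1, n}. x k powi
        (if n - 2 = k then 2 else if linked (n - 2) k \<or> linked k (n - 2) then -1 else 0))"
      by (subst central [symmetric, of "n - 2"], use n_ge in force, rule root_tau_support)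
        (use x n_ge in \<open>auto simp: linked_def\<close>)
    also have "\<dots> = inverse (x (n - 3)) * (x (n - 2) ^ 2 * (inverse (x (n - 1)) * inverse (x n)))"
      using d l by (simp add: power_int_minus)
    finally show ?thesis using x [of "n - 3"] x [of "n - 1"] x [of n] by (simp add: field_simps)
  qed
  have leaf: "x i ^ 2 = x (n - 2)" if i: "i \<in> {n - 1, n}" for i
  proof -
    have d: "n - 2 \<noteq> i" using n_ge i by auto
    have l: "linked (n - 2) i" using n_ge i by (auto simp: linked_def)
    have "1 = (\<Prod>k\<in>{n - 2, i}. x k powi
        (if i = k then 2 else if linked i k \<or> linked k i then -1 else 0))"
      by (subst central [symmetric, of i], use n_ge i in force, rule root_tau_support)
        (use x n_ge i in \<open>auto simp: linked_def\<close>)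
    also have "\<dots> = inverse (x (n - 2)) * x i ^ 2"
      using d l by (simp add: power_int_minus)
    finally show ?thesis using x [of "n - 2"] by (simp add: field_simps)
  qed
  have pw: "Suc k \<le> n - 2 \<longrightarrow> x (Suc k) = x 1 ^ Suc k" for k
  proof (induction k rule: less_induct)
    case (less k)
    show ?case
    proof (cases "k \<le> 1")
      case True
      then consider "k = 0" | "k = 1" by linarith
      then show ?thesis using first by cases (simp_all add: numeral_2_eq_2)
    next
      case False
      then have "k = Suc (Suc (k - 2))" by simp
      then obtain m where m: "k = Suc (Suc m)" by blast
      show ?thesis
      proof
        assume le: "Suc k \<le> n - 2"
        have "x (Suc k) * x (Suc m) = x (Suc (Suc m)) ^ 2"
          using middle [of "Suc m"] le n_ge by (simp add: m numeral_2_eq_2)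
        moreover have "x (Suc m) = x 1 ^ Suc m" "x (Suc (Suc m)) = x 1 ^ Suc (Suc m)"
          using less [of m] less [of "Suc m"] le by (simp_all add: m)
        ultimately have "x (Suc k) * x 1 ^ Suc m = x 1 ^ Suc k * x 1 ^ Suc m"
          by (simp add: m power_mult [symmetric] power_add [symmetric] algebra_simps)
            (simp add: power_mult power2_eq_square numeral_2_eq_2 mult_ac power_mult_distrib)
        then show "x (Suc k) = x 1 ^ Suc k" using x [of 1] by simp
      qed
    qed
  qed
  have power: "x k = x 1 ^ k" if "1 \<le> k" "k \<le> n - 2" for k
    using pw [of "k - 1"] that by simp
  obtain m where m: "n = m + 4" using le_Suc_ex [OF n_ge] by (auto simp: add.commute)
  have "x 1 ^ (m + 1) * (x (n - 1) * x n) = x 1 ^ (m + 1) * x 1 ^ (n - 1)"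
  proof -
    have "x (n - 3) = x 1 ^ (m + 1)" "x (n - 2) = x 1 ^ (m + 2)"
      using power [of "n - 3"] power [of "n - 2"] by (simp_all add: m)
    then have "x 1 ^ (m + 1) * (x (n - 1) * x n) = (x 1 ^ (m + 2)) ^ 2"
      using branch by (simp add: mult.assoc)
    also have "\<dots> = x 1 ^ (m + 1) * x 1 ^ (3 + m)"
      by (simp only: power_add power2_eq_square power3_eq_cube power_one_right mult_ac)
    finally show ?thesis by (simp add: m)
  qed
  then show prod: "x (n - 1) * x n = x 1 ^ (n - 1)" using x [of 1] by simp
  have sq: "x (n - 1) ^ 2 = x 1 ^ (n - 2)" "x n ^ 2 = x 1 ^ (n - 2)"
    using leaf power [of "n - 2"] n_ge by auto
  have "x 1 ^ (n - 2) * x 1 ^ (n - 2) = (x 1 ^ (n - 1)) ^ 2"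
    unfolding prod [symmetric] power_mult_distrib sq ..
  moreover have "n - 1 = Suc (n - 2)" using n_ge by simp
  then have "x 1 ^ (n - 1) = x 1 ^ (n - 2) * x 1" by (simp only: power_Suc mult.commute)
  ultimately have "x 1 ^ (n - 2) * x 1 ^ (n - 2) * 1 = x 1 ^ (n - 2) * x 1 ^ (n - 2) * x 1 ^ 2"
    by (simp add: power2_eq_square mult_ac)
  then show one: "x 1 ^ 2 = 1" using x [of 1] by simp
  have "n - 2 + 2 = n" using n_ge by simp
  then have "x 1 ^ n = x 1 ^ (n - 2) * x 1 ^ 2" by (metis power_add)
  then show "x (n - 1) ^ 2 = x 1 ^ n" "x n ^ 2 = x 1 ^ n" using sq one by simp_all
  show "x k = (if odd k then x 1 else 1)" if "1 \<le> k" "k \<le> n - 2" for k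
    using power [OF that] power_involution [OF one] by simp
qed

end

section \<open>Orders and conjugacy of sections\<close>

lemma dot_unit_vec_left: "i \<in> {1..n} \<Longrightarrow> dot n (unit_vec i) v = v i"
  by (simp add: dot_commute dot_unit_vec_right)

lemma unit_vec_sum_root:
  assumes "i \<in> {1..n}" "j \<in> {1..n}" "i \<noteq> j" and "e \<in> {1, - 1::int}"
  shows "(\<lambda>k. unit_vec i k + e * unit_vec j k) \<in> D_roots n"
proof -
  have "dot n (\<lambda>k. unit_vec i k + e * unit_vec j k) (\<lambda>k. unit_vec i k + e * unit_vec j k) = 1 + e * e"
    using assms by (simp add: dot_add_left dot_scale_left dot_unit_vec_left) (simp add: unit_vec_def)
  then show ?thesis using assms by (auto simp: D_roots_iff unit_vec_def)
qed

lemma elt_order_4: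
  assumes G: "subgroup H (mat_group GL)" and g: "g \<in> H"
    and "g ** g \<noteq> mat 1" "(g ** g) ** (g ** g) = mat 1"
  shows "elt_order H g = 4"
proof -
  interpret group "mat_group H" by (rule subgroup_GL_group [OF G])
  have p: "g [^]\<^bsub>mat_group H\<^esub> (2::nat) = g ** g" "g [^]\<^bsub>mat_group H\<^esub> (4::nat) = (g ** g) ** (g ** g)"
    by (simp_all add: numeral_eq_Suc nat_pow_Suc matrix_mul_assoc)
  have "ord g dvd 4" "\<not> ord g dvd 2"
    using pow_eq_id [of g 4] pow_eq_id [of g 2] g p assms by auto
  moreover have "ord g \<le> 4" using \<open>ord g dvd 4\<close> by (simp add: dvd_imp_le)
  moreover have "ord g \<noteq> 0" "ord g \<noteq> 3"
    by (rule notI, use \<open>ord g dvd 4\<close> in simp)+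
  moreover have "ord g \<noteq> 1" "ord g \<noteq> 2" using \<open>\<not> ord g dvd 2\<close> by auto
  ultimately have "ord g = 4" by linarith
  then show ?thesis by (simp add: elt_order_def numeral_eq_enat)
qed

lemma elt_order_2:
  assumes G: "subgroup H (mat_group GL)" and g: "g \<in> H"
    and "g \<noteq> mat 1" "g ** g = mat 1"
  shows "elt_order H g = 2"
proof -
  interpret group "mat_group H" by (rule subgroup_GL_group [OF G])
  have p: "g [^]\<^bsub>mat_group H\<^esub> (2::nat) = g ** g"
    by (simp add: numeral_eq_Suc nat_pow_Suc)
  have "ord g dvd 2" "ord g \<noteq> 1" using pow_eq_id [of g 2] ord_eq_1 [of g] g p assms by auto
  moreover have "ord g \<le> 2" using \<open>ord g dvd 2\<close> by (simp add: dvd_imp_le)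
  moreover have "ord g \<noteq> 0" by (rule notI, use \<open>ord g dvd 2\<close> in simp)
  ultimately have "ord g = 2" by linarith
  then show ?thesis by (simp add: elt_order_def numeral_eq_enat)
qed

context D_group
begin

text \<open>The simple roots take arbitrary prescribed values: the coroots of \<open>e\<^sub>k + e\<^sub>j\<close> and
  \<open>e\<^sub>k - e\<^sub>j\<close> multiply to a cocharacter pairing with every root as \<open>2 e\<^sub>k\<close> does, and square
  roots exist.\<close>

lemma simple_root_values:
  assumes y: "\<And>i. i \<in> {1..n} \<Longrightarrow> y i \<noteq> 0"
  shows "\<exists>t\<in>T. \<forall>i\<in>{1..n}. rt R (\<alpha> i) t = y i"
proof -
  obtain s where s: "s ^ 2 = y (n - 1) * y n" using nth_root_exists [of 2 "y (n - 1) * y n"] by auto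
  have snz: "s \<noteq> 0" using s y [of n] y [of "n - 1"] n_ge by auto
  \<comment> \<open>the values of \<open>e\<^sub>1, \<dots>, e\<^sub>n\<close> at the element to be found\<close>
  define E where "E k = (if k = n then y n / s else s * (\<Prod>j=k..<n - 1. y j))" for k
  have Enz: "E k \<noteq> 0" if "k \<in> {1..n}" for k
    using that snz y n_ge by (auto simp: E_def)
  have E_diff: "E i / E (i + 1) = y i" if "i \<in> {1..n}" "i < n" for i
  proof (cases "i = n - 1")
    case True
    then have "E i = s" "E (i + 1) = y n / s" using n_ge by (auto simp: E_def)
    then have "E i / E (i + 1) = s ^ 2 / y n" by (simp add: power2_eq_square)
    also have "\<dots> = y i" using True s y [of n] n_ge by simp
    finally show ?thesis .
  next
    case False
    then have "i < n - 1" using that by simp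
    then have "(\<Prod>j=i..<n - 1. y j) = y i * (\<Prod>j=i + 1..<n - 1. y j)"
      by (simp add: prod.atLeast_Suc_lessThan)
    then have "E i = y i * E (i + 1)" using \<open>i < n - 1\<close> by (auto simp: E_def)
    then show ?thesis using Enz [of "i + 1"] \<open>i < n - 1\<close> by simp
  qed
  have E_sum: "E (n - 1) * E n = y n" using snz n_ge by (auto simp: E_def)
  define r where "r k = (SOME r. r ^ 2 = E k)" for k
  have r: "r k ^ 2 = E k" for k unfolding r_def by (rule someI_ex) (rule nth_root_exists, simp)
  have rnz: "r k \<noteq> 0" if "k \<in> {1..n}" for k using r [of k] Enz [OF that] by auto
  define o' where "o' k = (if k = n then 1 else n)" for k
  define v where "v k e = (\<lambda>l. unit_vec k l + e * unit_vec (o' k) l)" for k and e :: int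
  have v: "v k e \<in> D_roots n" if "k \<in> {1..n}" "e \<in> {1, - 1}" for k e
    unfolding v_def by (rule unit_vec_sum_root) (use that n_ge in \<open>auto simp: o'_def\<close>)
  define t where "t = mat_prod (\<lambda>k. crt R (v k 1) (r k) ** crt R (v k (- 1)) (r k)) [1..<Suc n]"
  have inT: "crt R (v k 1) (r k) ** crt R (v k (- 1)) (r k) \<in> T" if "k \<in> {1..n}" for k
    using that v rnz by (simp add: T_mult coroot_in)
  have tT: "t \<in> T" unfolding t_def by (rule mat_prod_T, rule inT) auto
  have val: "rt R (\<alpha> i) t = (\<Prod>k=1..n. E k powi \<alpha> i k)" if i: "i \<in> {1..n}" for i
  proof -
    have "rt R (\<alpha> i) t = (\<Prod>k\<leftarrow>[1..<Suc n]. rt R (\<alpha> i) (crt R (v k 1) (r k) ** crt R (v k (- 1)) (r k)))"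
      unfolding t_def by (rule character_mat_prod [OF root_character [OF simple_root_root [OF i]]], rule inT) auto
    also have "\<dots> = (\<Prod>k\<in>set [1..<Suc n]. rt R (\<alpha> i) (crt R (v k 1) (r k) ** crt R (v k (- 1)) (r k)))"
      by (rule prod.distinct_set_conv_list [symmetric]) simp
    also have "\<dots> = (\<Prod>k=1..n. E k powi \<alpha> i k)"
    proof (rule prod.cong)
      fix k assume k: "k \<in> {1..n}"
      have "dot n (\<alpha> i) (v k 1) + dot n (\<alpha> i) (v k (- 1)) = 2 * \<alpha> i k"
        using k n_ge by (simp add: dot_commute [of n "\<alpha> i"] v_def dot_add_left dot_diff_left dot_unit_vec_left o'_def)
      then have "r k powi (dot n (\<alpha> i) (v k 1) + dot n (\<alpha> i) (v k (- 1))) = (r k ^ 2) powi \<alpha> i k"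
        by (simp add: power_int_mult)
      then show "rt R (\<alpha> i) (crt R (v k 1) (r k) ** crt R (v k (- 1)) (r k)) = E k powi \<alpha> i k"
        using i k v rnz by (simp add: root_mult simple_root_root coroot_in root_coroot power_int_add r)
    qed auto
    finally show ?thesis .
  qed
  have "rt R (\<alpha> i) t = y i" if i: "i \<in> {1..n}" for i
  proof (cases "i < n")
    case True
    have "(\<Prod>k=1..n. E k powi \<alpha> i k) = (\<Prod>k\<in>{i, i + 1}. E k powi \<alpha> i k)"
      by (rule prod.mono_neutral_right) (use True i in \<open>auto simp: simple_root_def unit_vec_def\<close>)
    also have "\<dots> = E i / E (i + 1)"
      using True by (simp add: simple_root_def unit_vec_def power_int_minus divide_inverse)
    finally show ?thesis using val [OF i] E_diff [OF i True] by simp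
  next
    case False
    then have [simp]: "i = n" using i by auto
    have "(\<Prod>k=1..n. E k powi \<alpha> i k) = (\<Prod>k\<in>{n - 1, n}. E k powi \<alpha> i k)"
      by (rule prod.mono_neutral_right) (use n_ge in \<open>auto simp: simple_root_def unit_vec_def\<close>)
    also have "\<dots> = E (n - 1) * E n"
      using n_ge by (auto simp: simple_root_def unit_vec_def)
    finally show ?thesis using val [OF i] E_sum by simp
  qed
  then show ?thesis using tT by blast
qed

text \<open>Conjugation by the torus changes only the coordinate of \<open>\<alpha>\<^sub>i\<^sup>\<or>\<close> in the torus part of a lift of
  \<open>s\<^sub>i\<close>.\<close>

lemma torus_conj_lift:
  assumes i: "i \<in> {1..n}" and t: "t \<in> T" and y: "y \<in> T"
  shows "t ** (y ** \<sigma> i) ** matrix_inv t = (y ** h i (rt R (\<alpha> i) t)) ** \<sigma> i"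
proof -
  have ti: "matrix_inv t \<in> T" by (rule T_inv [OF t])
  have "rt R (\<alpha> i) t * rt R (\<alpha> i) (matrix_inv t) = 1"
    using i t ti by (simp flip: root_mult [OF simple_root_root] add: GL_inv_right T_GL root_one simple_root_root)
  then have inv: "inverse (rt R (\<alpha> i) (matrix_inv t)) = rt R (\<alpha> i) t"
    by (metis inverse_unique mult.commute)
  have hT: "h i (rt R (\<alpha> i) t) \<in> T" using i t by (simp add: h_in root_nonzero simple_root_root)
  have "t ** (y ** \<sigma> i) ** matrix_inv t = t ** y ** (\<sigma> i ** matrix_inv t)"
    by (simp add: matrix_mul_assoc)
  also have "\<dots> = t ** y ** (matrix_inv t ** h i (rt R (\<alpha> i) t)) ** \<sigma> i"
    by (simp add: sigma_move [OF i ti] inv matrix_mul_assoc)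
  also have "t ** y ** (matrix_inv t ** h i (rt R (\<alpha> i) t)) = y ** h i (rt R (\<alpha> i) t)"
    by (simp add: T_commute [OF t y] matrix_mul_assoc GL_cancel_right T_GL [OF t])
  finally show ?thesis .
qed

lemma tau_h:
  assumes "i \<in> {1..n}" "\<And>k. x k \<noteq> 0" "d \<noteq> 0"
  shows "\<tau> x ** h i d = \<tau> (\<lambda>k. if k = i then x i * d else x k)"
proof -
  have "\<tau> x ** h i d = \<tau> (\<lambda>k. x k * (if k = i then d else 1))"
    using assms by (simp add: h_tau tau_mult)
  also have "\<dots> = \<tau> (\<lambda>k. if k = i then x i * d else x k)" by (rule tau_cong) simp
  finally show ?thesis .
qed

text \<open>A central \<open>z\<close> passes through \<open>\<sigma>\<^sub>i\<close>, and \<open>\<alpha>\<^sub>i\<^sup>\<or>(d)\<close> is inverted by it.\<close>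

lemma central_lift_square:
  assumes i: "i \<in> {1..n}" and z: "z \<in> T" and c: "rt R (\<alpha> i) z = 1" and d: "d \<noteq> 0"
  shows "(z ** h i d ** \<sigma> i) ** (z ** h i d ** \<sigma> i) = (z ** z) ** h i (- 1)"
proof -
  have hT: "h i d \<in> T" by (rule h_in [OF i d])
  have zh: "z ** h i d \<in> T" by (rule T_mult [OF z hT])
  have "rt R (\<alpha> i) (z ** h i d) = d ^ 2"
    using i z hT c d by (simp add: root_mult simple_root_root root_h simple_root_norm)
  then have "\<sigma> i ** (z ** h i d) = z ** h i d ** h i (inverse (d ^ 2)) ** \<sigma> i"
    using sigma_move [OF i zh] by simp
  then have "(z ** h i d ** \<sigma> i) ** (z ** h i d ** \<sigma> i) =
      z ** h i d ** (z ** h i d ** h i (inverse (d ^ 2)) ** \<sigma> i) ** \<sigma> i"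
    by (metis matrix_mul_assoc)
  also have "\<dots> = z ** h i d ** (z ** (h i d ** h i (inverse (d ^ 2)))) ** (\<sigma> i ** \<sigma> i)"
    by (simp add: matrix_mul_assoc)
  also have "\<dots> = (z ** z) ** (h i d ** (h i d ** h i (inverse (d ^ 2)))) ** h i (- 1)"
  proof -
    have "z ** h i d ** z = z ** z ** h i d" by (metis T_commute [OF hT z] matrix_mul_assoc)
    then show ?thesis by (simp add: sigma_square [OF i] matrix_mul_assoc)
  qed
  also have "h i d ** (h i d ** h i (inverse (d ^ 2))) = mat 1"
  proof -
    have "h i d ** h i (inverse (d ^ 2)) = h i (d * inverse (d ^ 2))"
      by (rule h_mult) (use i d in simp_all)
    moreover have "h i d ** h i (d * inverse (d ^ 2)) = h i (d * (d * inverse (d ^ 2)))"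
      by (rule h_mult) (use i d in simp_all)
    moreover have "d * (d * inverse (d ^ 2)) = 1" using d by (simp add: power2_eq_square field_simps)
    ultimately show ?thesis by (simp only: h_one [OF i])
  qed
  finally show ?thesis by simp
qed

end

context D_weyl
begin

text \<open>The coordinates of the central element of \<open>braid_lift_central\<close> are the off-diagonal coordinates of
  every \<open>t\<^sub>i\<close>, that is, the parameters of the section.\<close>

lemma section_form:
  assumes S: "weyl_section n R S"
  obtains x where "\<And>k. x k \<noteq> 0" "\<forall>j\<in>{1..n}. rt R (\<alpha> j) (\<tau> x) = 1"
    "\<And>i. i \<in> {1..n} \<Longrightarrow> \<exists>d. d \<noteq> 0 \<and> S (simple_refl n R i) = \<tau> x ** h i d ** \<sigma> i"
proof -
  define t where "t i = (SOME t. t \<in> T \<and> S (simple_refl n R i) = t ** \<sigma> i)" for i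
  have t: "t i \<in> T" "S (simple_refl n R i) = t i ** \<sigma> i" if "i \<in> {1..n}" for i
    using someI_ex [of "\<lambda>t. t \<in> T \<and> S (simple_refl n R i) = t ** \<sigma> i"] section_simple [OF S that]
    by (auto simp: t_def)
  have "braid_relations (\<lambda>i. t i ** \<sigma> i)"
    using section_braid [OF S] t(2) unfolding braid_relations_def by simp
  then obtain z where z: "z \<in> T" "\<forall>j\<in>{1..n}. rt R (\<alpha> j) z = 1"
    "\<forall>i\<in>{1..n}. \<exists>d. d \<noteq> 0 \<and> t i = z ** h i d"
    using braid_lift_central [of t] t(1) by blast
  obtain x where x: "\<And>k. x k \<noteq> 0" "z = \<tau> x" using tau_surj [OF z(1)] by blast
  show thesis
  proof (rule that [of x])
    show "\<exists>d. d \<noteq> 0 \<and> S (simple_refl n R i) = \<tau> x ** h i d ** \<sigma> i" if i: "i \<in> {1..n}" for i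
    proof -
      obtain d where "d \<noteq> 0" "t i = z ** h i d" using z(3) i by blast
      then show ?thesis using t(2) [OF i] x(2) by (intro exI [of _ d]) simp
    qed
  qed (use x z in auto)
qed

lemma section_off_diagonal:
  assumes x: "\<And>k. x k \<noteq> 0"
    and form: "\<And>i. i \<in> {1..n} \<Longrightarrow> \<exists>d. d \<noteq> 0 \<and> S (simple_refl n R i) = \<tau> x ** h i d ** \<sigma> i"
    and y: "\<And>k. k \<in> {1..n} \<Longrightarrow> x k = y k"
  shows "has_off_diagonal n R S y"
  unfolding has_off_diagonal_def
proof
  fix i assume i: "i \<in> {1..n}"
  then obtain d where d: "d \<noteq> 0" "S (simple_refl n R i) = \<tau> x ** h i d ** \<sigma> i" using form by blast
  have "\<tau> x ** h i d = \<tau> (\<lambda>k. if k = i then x i * d else x k)" by (rule tau_h [OF i x d(1)])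
  also have "\<dots> = \<tau> (\<lambda>k. if k = i then x i * d else y k)" by (rule tau_cong) (simp add: y)
  finally show "\<exists>d. d \<noteq> 0 \<and> S (simple_refl n R i) = \<tau> (\<lambda>k. if k = i then d else y k) ** \<sigma> i"
    using d x by (intro exI [of _ "x i * d"]) simp
qed

text \<open>The square \<open>z\<^sup>2 \<alpha>\<^sub>i\<^sup>\<or>(-1)\<close> has order at most 2 because the coordinates of \<open>z\<close> are fourth roots of
  unity. It is nontrivial unless \<open>-1 = 1\<close>, because \<open>z\<^sup>2\<close> has the same coordinate at \<open>i\<close> and at some
  other node. In characteristic 2 all fourth roots of unity are 1, so the square is trivial, whereas
  \<open>S(s\<^sub>i)\<close> is not, having nontrivial image in the Weyl group.\<close>

lemma section_order:
  assumes S: "weyl_section n R S" and i: "i \<in> {1..n}"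
  shows "elt_order G (S (simple_refl n R i)) = (if (2::'a) = 0 then 2 else 4)"
proof -
  obtain x where x: "\<And>k. x k \<noteq> 0" "\<forall>j\<in>{1..n}. rt R (\<alpha> j) (\<tau> x) = 1"
    and form: "\<And>i. i \<in> {1..n} \<Longrightarrow> \<exists>d. d \<noteq> 0 \<and> S (simple_refl n R i) = \<tau> x ** h i d ** \<sigma> i"
    by (rule section_form [OF S]) (rule that)
  define g where "g = S (simple_refl n R i)"
  obtain d where d: "d \<noteq> 0" "g = \<tau> x ** h i d ** \<sigma> i" using form [OF i] by (auto simp: g_def)
  note cc = central_coordinates [OF x]
  define e where "e k = (if k = i then - 1 else 1 :: 'a)" for k
  have zT: "\<tau> x \<in> T" using x by (simp add: tau_in)
  have "g ** g = (\<tau> x ** \<tau> x) ** h i (- 1)"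
    unfolding d(2) by (rule central_lift_square [OF i zT bspec [OF x(2) i] d(1)])
  also have "\<dots> = \<tau> (\<lambda>k. x k * x k * e k)"
    using i x(1) by (simp add: h_tau tau_mult e_def)
  finally have g2: "g ** g = \<tau> (\<lambda>k. x k * x k * e k)" .
  have e2: "e k * e k = 1" "e k \<noteq> 0" for k by (simp_all add: e_def)
  have x4: "x k ^ 4 = 1" if k: "k \<in> {1..n}" for k
  proof -
    have n_sq: "(x 1 ^ n) ^ 2 = 1"
    proof -
      have "(x 1 ^ n) ^ 2 = (x 1 ^ 2) ^ n" by (simp only: power_mult [symmetric] mult.commute)
      then show ?thesis using cc(1) by simp
    qed
    consider "k \<le> n - 2" | "k = n - 1" | "k = n" using k by force
    then have "(x k ^ 2) ^ 2 = 1"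
    proof cases
      case 1
      then have "x k ^ 2 = 1" using cc(2) [of k] cc(1) k by simp
      then show ?thesis by simp
    next
      case 2
      then show ?thesis using n_sq by (simp only: cc(4))
    next
      case 3
      then show ?thesis using n_sq by (simp only: cc(5))
    qed
    then show ?thesis by (simp flip: power_mult)
  qed
  have g4: "(g ** g) ** (g ** g) = mat 1"
  proof -
    have "(g ** g) ** (g ** g) = \<tau> (\<lambda>k. x k * x k * e k * (x k * x k * e k))"
      unfolding g2 by (rule tau_mult [symmetric]) (simp_all add: x e2)
    also have "\<dots> = \<tau> (\<lambda>_. 1)"
    proof (rule tau_cong)
      fix k assume "k \<in> {1..n}"
      have "x k * x k * e k * (x k * x k * e k) = x k ^ 4 * (e k * e k)"
        by (simp add: power4_eq_xxxx mult_ac)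
      then show "x k * x k * e k * (x k * x k * e k) = 1" using x4 [OF \<open>k \<in> {1..n}\<close>] e2 by simp
    qed
    finally show ?thesis by (simp add: tau_one)
  qed
  have gN: "g \<in> N" unfolding g_def by (rule section_simple_N [OF S i])
  then have gG: "g \<in> G" by (rule N_G)
  show ?thesis
  proof (cases "(2::'a) = 0")
    case True
    have sq1: "a = 1" if "a ^ 2 = 1" for a :: 'a
    proof -
      have "(a - 1) ^ 2 = a ^ 2 - 2 * a + 1" by (simp add: power2_eq_square algebra_simps)
      then show ?thesis using that True by simp
    qed
    have e1: "e k = 1" for k using sq1 [of "e k"] e2 by (simp add: power2_eq_square)
    have "x k = 1" if k: "k \<in> {1..n}" for k
    proof -
      have "(x k ^ 2) ^ 2 = 1" using x4 [OF k] by (simp flip: power_mult)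
      then show ?thesis using sq1 by blast
    qed
    then have "g ** g = \<tau> (\<lambda>_. 1)" unfolding g2 by (intro tau_cong) (simp add: e1)
    moreover have "g \<noteq> mat 1"
    proof
      assume "g = mat 1"
      have "proj R g = word_val n R [i]"
        using S simple_refl_weyl [OF i] i by (simp add: g_def weyl_section_def word_val_singleton)
      then have "word_val n R [i] = word_val n R []"
        using \<open>g = mat 1\<close> by (simp add: word_val_def weyl_one)
      then have "same_act [i] []" using i by (intro word_val_imp_same_act) auto
      then have "length [i] \<le> length ([] :: nat list)"
        using act_reduced_1 [OF i] unfolding act_reduced_def by (metis empty_subsetI list.set(1))
      then show False by simp
    qed
    ultimately show ?thesis using elt_order_2 [OF G_subgroup gG] True tau_one by (simp add: g_def)
  next
    case False
    have "g ** g \<noteq> mat 1"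
    proof
      assume "g ** g = mat 1"
      then have "\<tau> (\<lambda>k. x k * x k * e k) = \<tau> (\<lambda>_. 1)" by (simp add: g2 tau_one)
      from tau_inj [OF this] have *: "x k * x k * e k = 1" if "k \<in> {1..n}" for k
        using that x e2 by simp
      \<comment> \<open>a node other than \<open>i\<close> at which \<open>z\<^sup>2\<close> has the same coordinate\<close>
      define j where "j = (if i = n then n - 1 else if i = n - 1 then n else if i = 1 then 2 else 1)"
      have j: "j \<in> {1..n}" "j \<noteq> i" using n_ge i by (auto simp: j_def)
      have "x i ^ 2 = x j ^ 2"
      proof (cases "i \<in> {n - 1, n}")
        case True
        then show ?thesis using cc(4,5) n_ge by (auto simp: j_def)
      next
        case False
        then have r: "1 \<le> i" "i \<le> n - 2" "1 \<le> j" "j \<le> n - 2" using i n_ge by (auto simp: j_def)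
        have "x k ^ 2 = 1" if "1 \<le> k" "k \<le> n - 2" for k using cc(2) [OF that] cc(1) by simp
        then show ?thesis using r by simp
      qed
      then have "- (1::'a) = 1"
        using * [OF i] * [OF j(1)] j(2) by (simp add: e_def power2_eq_square)
      then show False using False by (metis one_add_one add.right_inverse)
    qed
    then show ?thesis using elt_order_4 [OF G_subgroup gG _ g4] False by (simp add: g_def)
  qed
qed

lemma T_conjugate_iff_simple:
  assumes S: "weyl_section n R S" and S': "weyl_section n R S'"
  shows "T_conjugate R S S' \<longleftrightarrow> (\<exists>t\<in>T. \<forall>i\<in>{1..n}.
     t ** S (simple_refl n R i) ** matrix_inv t = S' (simple_refl n R i))"
proof
  assume "T_conjugate R S S'"
  then show "\<exists>t\<in>T. \<forall>i\<in>{1..n}. t ** S (simple_refl n R i) ** matrix_inv t = S' (simple_refl n R i)"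
    unfolding T_conjugate_def using simple_refl_weyl by blast
next
  assume "\<exists>t\<in>T. \<forall>i\<in>{1..n}. t ** S (simple_refl n R i) ** matrix_inv t = S' (simple_refl n R i)"
  then obtain t where t: "t \<in> T"
    "\<And>i. i \<in> {1..n} \<Longrightarrow> t ** S (simple_refl n R i) ** matrix_inv t = S' (simple_refl n R i)" by blast
  have prod: "set is \<subseteq> {1..n} \<Longrightarrow> t ** mat_prod (\<lambda>i. S (simple_refl n R i)) is ** matrix_inv t =
     mat_prod (\<lambda>i. S' (simple_refl n R i)) is" for "is"
    by (induction "is") (simp_all add: GL_inv_right T_GL t conj_mult)
  have "t ** S w ** matrix_inv t = S' w" if w: "w \<in> carrier (weyl R)" for w
  proof -
    obtain "is" where r: "act_reduced is" "word_val n R is = w" using weyl_reduced_word [OF w] by blast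
    then show ?thesis
      using prod [of "is"] section_word [OF S r(1)] section_word [OF S' r(1)] by (simp add: act_reduced_def)
  qed
  then show "T_conjugate R S S'" using t(1) unfolding T_conjugate_def by blast
qed

text \<open>Conjugation by the torus keeps the central element of a section.\<close>

lemma T_conjugate_same_off_diagonal:
  assumes S: "weyl_section n R S" and S': "weyl_section n R S'" and conj: "T_conjugate R S S'"
  obtains x where "\<And>k. x k \<noteq> 0" "\<forall>j\<in>{1..n}. rt R (\<alpha> j) (\<tau> x) = 1"
    "\<And>y. \<forall>k\<in>{1..n}. x k = y k \<Longrightarrow> has_off_diagonal n R S y \<and> has_off_diagonal n R S' y"
proof -
  obtain x where x: "\<And>k. x k \<noteq> 0" "\<forall>j\<in>{1..n}. rt R (\<alpha> j) (\<tau> x) = 1"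
    and form: "\<And>i. i \<in> {1..n} \<Longrightarrow> \<exists>d. d \<noteq> 0 \<and> S (simple_refl n R i) = \<tau> x ** h i d ** \<sigma> i"
    by (rule section_form [OF S]) (rule that)
  have zT: "\<tau> x \<in> T" using x by (simp add: tau_in)
  obtain t where t: "t \<in> T"
    "\<And>i. i \<in> {1..n} \<Longrightarrow> t ** S (simple_refl n R i) ** matrix_inv t = S' (simple_refl n R i)"
    using conj T_conjugate_iff_simple [OF S S'] by blast
  have form': "\<exists>d. d \<noteq> 0 \<and> S' (simple_refl n R i) = \<tau> x ** h i d ** \<sigma> i" if i: "i \<in> {1..n}" for i
  proof -
    obtain d where d: "d \<noteq> 0" "S (simple_refl n R i) = \<tau> x ** h i d ** \<sigma> i" using form [OF i] by blast
    define c where "c = rt R (\<alpha> i) t"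
    have c: "c \<noteq> 0" using i t by (simp add: c_def root_nonzero simple_root_root)
    have "S' (simple_refl n R i) = t ** (\<tau> x ** h i d ** \<sigma> i) ** matrix_inv t" using t(2) [OF i] d(2) by simp
    also have "\<dots> = \<tau> x ** h i d ** h i c ** \<sigma> i"
      unfolding c_def by (rule torus_conj_lift [OF i t(1) T_mult [OF zT h_in [OF i d(1)]]])
    also have "\<dots> = \<tau> x ** h i (d * c) ** \<sigma> i"
      using i c d by (simp add: matrix_mul_assoc [symmetric] h_mult [symmetric])
    finally show ?thesis using c d by (intro exI [of _ "d * c"]) simp
  qed
  show thesis
  proof (rule that [OF x])
    fix y assume "\<forall>k\<in>{1..n}. x k = y k"
    then have y: "x k = y k" if "k \<in> {1..n}" for k using that by blast
    show "has_off_diagonal n R S y \<and> has_off_diagonal n R S' y"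
      using section_off_diagonal [OF x(1) form y] section_off_diagonal [OF x(1) form' y] by (rule conjI)
  qed
qed

text \<open>If the sections differ only in the diagonal coordinates \<open>d\<^sub>i\<close> and \<open>d\<^sub>i'\<close>, any \<open>t\<close> with
  \<open>\<alpha>\<^sub>i(t) = d\<^sub>i' / d\<^sub>i\<close> conjugates one into the other.\<close>

lemma same_off_diagonal_T_conjugate:
  assumes S: "weyl_section n R S" and S': "weyl_section n R S'" and x: "\<And>k. x k \<noteq> 0"
    and off: "has_off_diagonal n R S x" "has_off_diagonal n R S' x"
  shows "T_conjugate R S S'"
proof -
  define d where "d S i = (SOME d. d \<noteq> 0 \<and> S (simple_refl n R i) =
      \<tau> (\<lambda>k. if k = i then d else x k) ** \<sigma> i)" for S i
  have d: "d U i \<noteq> 0" "U (simple_refl n R i) = \<tau> (\<lambda>k. if k = i then d U i else x k) ** \<sigma> i"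
    if "i \<in> {1..n}" "has_off_diagonal n R U x" for U i
  proof -
    have "\<exists>d. d \<noteq> 0 \<and> U (simple_refl n R i) = \<tau> (\<lambda>k. if k = i then d else x k) ** \<sigma> i"
      using that unfolding has_off_diagonal_def by blast
    note * = someI_ex [OF this]
    show "d U i \<noteq> 0" unfolding d_def by (rule conjunct1 [OF *])
    show "U (simple_refl n R i) = \<tau> (\<lambda>k. if k = i then d U i else x k) ** \<sigma> i"
      unfolding d_def by (rule conjunct2 [OF *])
  qed
  obtain t where t: "t \<in> T" "\<And>i. i \<in> {1..n} \<Longrightarrow> rt R (\<alpha> i) t = d S' i / d S i"
    using simple_root_values [of "\<lambda>i. d S' i / d S i"] d(1) off by auto
  have "t ** S (simple_refl n R i) ** matrix_inv t = S' (simple_refl n R i)" if i: "i \<in> {1..n}" for i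
  proof -
    have nz: "(if k = i then d S i else x k) \<noteq> 0" for k using d(1) [OF i off(1)] x by simp
    have c: "d S' i / d S i \<noteq> 0" using d(1) [OF i] off by simp
    have "t ** S (simple_refl n R i) ** matrix_inv t =
        \<tau> (\<lambda>k. if k = i then d S i else x k) ** h i (d S' i / d S i) ** \<sigma> i"
      unfolding d(2) [OF i off(1)] torus_conj_lift [OF i t(1) tau_in [OF nz]] t(2) [OF i] ..
    also have "\<tau> (\<lambda>k. if k = i then d S i else x k) ** h i (d S' i / d S i) =
        \<tau> (\<lambda>k. if k = i then d S' i else x k)"
      unfolding tau_h [OF i nz c] by (rule tau_cong) (use d(1) [OF i off(1)] in auto)
    finally show ?thesis using d(2) [OF i off(2)] by simp
  qed
  then show ?thesis using t(1) T_conjugate_iff_simple [OF S S'] by blast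
qed

text \<open>For even \<open>n\<close> the relations of \<open>central_coordinates\<close> become \<open>a\<^sup>2 = b\<^sup>2 = 1\<close> and \<open>x\<^sub>1 = a b\<close> for the
  last two coordinates \<open>a\<close> and \<open>b\<close>.\<close>

theorem T_conjugate_even:
  assumes S: "weyl_section n R S" and S': "weyl_section n R S'" and ev: "even n"
  shows "T_conjugate R S S' \<longleftrightarrow> (\<exists>a b. has_params_even n R S a b \<and> has_params_even n R S' a b)"
proof
  assume conj: "T_conjugate R S S'"
  obtain x where x: "\<And>k. x k \<noteq> 0" "\<forall>j\<in>{1..n}. rt R (\<alpha> j) (\<tau> x) = 1"
    and off: "\<And>y. \<forall>k\<in>{1..n}. x k = y k \<Longrightarrow> has_off_diagonal n R S y \<and> has_off_diagonal n R S' y"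
    by (rule T_conjugate_same_off_diagonal [OF S S' conj]) (rule that)
  note cc = central_coordinates [OF x]
  have xn: "x 1 ^ n = 1" using power_involution [OF cc(1)] ev by simp
  have "odd (n - 1)" using ev n_ge by simp
  then have x1: "x 1 = x (n - 1) * x n"
    unfolding cc(3) using power_involution [OF cc(1), of "n - 1"] by simp
  have "x k = (if k = n then x n else if k = n - 1 then x (n - 1)
      else if odd k then x (n - 1) * x n else 1)" if "k \<in> {1..n}" for k
    using cc(2) [of k] that x1 by auto
  from off [OF ballI, OF this] have "has_params_even n R S (x (n - 1)) (x n) \<and> has_params_even n R S' (x (n - 1)) (x n)"
    unfolding has_params_even_def using cc(4,5) xn by simp
  then show "\<exists>a b. has_params_even n R S a b \<and> has_params_even n R S' a b" by blast
next
  assume "\<exists>a b. has_params_even n R S a b \<and> has_params_even n R S' a b"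
  then obtain a b where ab: "has_params_even n R S a b" "has_params_even n R S' a b" by blast
  then have "a \<noteq> 0" "b \<noteq> 0" by (auto simp: has_params_even_def)
  then show "T_conjugate R S S'"
    using ab unfolding has_params_even_def
    by (intro same_off_diagonal_T_conjugate [OF S S', of "\<lambda>k. if k = n then b else
        if k = n - 1 then a else if odd k then a * b else 1"]) simp_all
qed

text \<open>For odd \<open>n\<close> the relations of \<open>central_coordinates\<close> say that the last two coordinates are inverse to each other and that \<open>x\<^sub>1\<close> is the
  square of the last one.\<close>

theorem T_conjugate_odd:
  assumes S: "weyl_section n R S" and S': "weyl_section n R S'" and od: "odd n"
  shows "T_conjugate R S S' \<longleftrightarrow> (\<exists>c. has_param_odd n R S c \<and> has_param_odd n R S' c)"
proof
  assume conj: "T_conjugate R S S'"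
  obtain x where x: "\<And>k. x k \<noteq> 0" "\<forall>j\<in>{1..n}. rt R (\<alpha> j) (\<tau> x) = 1"
    and off: "\<And>y. \<forall>k\<in>{1..n}. x k = y k \<Longrightarrow> has_off_diagonal n R S y \<and> has_off_diagonal n R S' y"
    by (rule T_conjugate_same_off_diagonal [OF S S' conj]) (rule that)
  note cc = central_coordinates [OF x]
  have "x 1 ^ n = x 1" using power_involution [OF cc(1)] od by simp
  then have x1: "x 1 = x n ^ 2" using cc(5) by simp
  have c4: "x n ^ 4 = 1" using cc(1) unfolding x1 by (simp flip: power_mult)
  have "even (n - 1)" using od by simp
  then have "x (n - 1) * x n = 1"
    unfolding cc(3) using power_involution [OF cc(1), of "n - 1"] by simp
  then have inv: "x (n - 1) = inverse (x n)" by (metis inverse_unique mult.commute)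
  have "x k = (if k = n then x n else if k = n - 1 then inverse (x n)
      else if odd k then x n ^ 2 else 1)" if "k \<in> {1..n}" for k
    using cc(2) [of k] that x1 inv by auto
  from off [OF ballI, OF this] have "has_param_odd n R S (x n) \<and> has_param_odd n R S' (x n)"
    unfolding has_param_odd_def using c4 by simp
  then show "\<exists>c. has_param_odd n R S c \<and> has_param_odd n R S' c" by blast
next
  assume "\<exists>c. has_param_odd n R S c \<and> has_param_odd n R S' c"
  then obtain c where c: "has_param_odd n R S c" "has_param_odd n R S' c" by blast
  then have "c \<noteq> 0" by (auto simp: has_param_odd_def)
  then show "T_conjugate R S S'"
    using c unfolding has_param_odd_def
    by (intro same_off_diagonal_T_conjugate [OF S S', of "\<lambda>k. if k = n then c else
        if k = n - 1 then inverse c else if odd k then c ^ 2 else 1"]) simp_all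
qed

lemma order_profile_constant:
  assumes "weyl_section n R S" "weyl_section n R S'"
  shows "order_profile n R S = order_profile n R S'"
  unfolding order_profile_def
  by (rule restrict_ext) (simp only: section_order [OF assms(1)] section_order [OF assms(2)])

lemma order_profiles_singleton:
  assumes "weyl_section n R S" shows "order_profiles n R = {order_profile n R S}"
proof -
  have "p \<in> {order_profile n R S}" if p: "p \<in> order_profiles n R" for p
  proof -
    obtain S' where "weyl_section n R S'" "p = order_profile n R S'"
      using p unfolding order_profiles_def by blast
    then show ?thesis using order_profile_constant [OF assms] by simp
  qed
  moreover have "order_profile n R S \<in> order_profiles n R"
    unfolding order_profiles_def mem_Collect_eq by (rule exI [of _ S]) (simp add: assms)
  ultimately show ?thesis by (intro equalityI subsetI) (assumption | erule singletonE, hypsubst)+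
qed

lemma section_optimal:
  assumes S: "weyl_section n R S" shows "optimal_section n R S"
proof -
  have "1 \<in> {1..n}" using n_ge by simp
  then have "\<not> profile_less n p p" for p unfolding profile_less_def by blast
  then show ?thesis
    using S order_profiles_singleton [OF S] by (auto simp: optimal_section_def maximal_profile_def)
qed

end

theorem proposition3p11:
  fixes R :: "('a::alg_closed_field, 'm::finite) group_realization" and n :: nat
  assumes "n \<ge> 6"
    and "algebraic_group (Grp R)"
    and "zariski_connected (Grp R)"
    and "reductive (Grp R)"
    and "almost_simple (Grp R)"
    and "maximal_torus (Grp R) (Tor R)"
    and "type_D n R"
    and "simply_connected_D n R"
    and "realization n R"
    and "weyl_generated n R"
  shows
    "((\<exists>S. tits_section n R S) \<and>
      (\<forall>S. tits_section n R S \<longrightarrow> optimal_section n R S) \<and>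
      ((2::'a) \<noteq> 0 \<longrightarrow>
        (\<forall>S. weyl_section n R S \<longrightarrow>
          (\<forall>i\<in>{1..n}. elt_order (Grp R) (S (simple_refl n R i)) = 4))) \<and>
      (\<forall>S. tits_section n R S \<longrightarrow> order_profiles n R = {order_profile n R S})) \<and>
     (even n \<longrightarrow>
      (\<forall>S S'. weyl_section n R S \<longrightarrow> weyl_section n R S' \<longrightarrow>
        (T_conjugate R S S' \<longleftrightarrow>
          (\<exists>a b. has_params_even n R S a b \<and> has_params_even n R S' a b)))) \<and>
     (odd n \<longrightarrow>
      (\<forall>S S'. weyl_section n R S \<longrightarrow> weyl_section n R S' \<longrightarrow>
        (T_conjugate R S S' \<longleftrightarrow>
          (\<exists>c. has_param_odd n R S c \<and> has_param_odd n R S' c))))"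
proof -
  interpret D_weyl n R
    by unfold_locales (use assms in \<open>auto simp: maximal_torus_def\<close>)
  have tits: "weyl_section n R S" if "tits_section n R S" for S
    using that by (simp add: tits_section_def)
  show ?thesis
  proof (intro conjI allI impI ballI)
    show "\<exists>S. tits_section n R S" by (rule tits_section_exists)
    show "optimal_section n R S" if "tits_section n R S" for S
      by (rule section_optimal [OF tits [OF that]])
    show "elt_order (Grp R) (S (simple_refl n R i)) = 4"
      if "(2::'a) \<noteq> 0" "weyl_section n R S" "i \<in> {1..n}" for S i
      using section_order [OF that(2,3)] that(1) by simp
    show "order_profiles n R = {order_profile n R S}" if "tits_section n R S" for S
      by (rule order_profiles_singleton [OF tits [OF that]])
  qed (rule T_conjugate_even T_conjugate_odd; assumption)+
qed

end
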